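(* Let $G$ be a commutative topological group, let $g\in G$, and let $\gamma\in AP(G)$. Assume that $$g^{\perp}\cap H_{\gamma}=\{\mathbf{1}\}.$$ Then the equation $$\varphi(gx)-\varphi(x)=\gamma(x),\quad x\in G,$$ has a solution $\varphi\in AP(G)$ if and only if the sums $$s_n(x)=\sum_{k=0}^n\gamma(g^kx),\quad n\ge0,$$ are uniformly bounded (in $n\ge 0$ and $x\in G$). Under this condition and with real-valued $\gamma$, a solution in $AP(G)$ is $$\varphi(x)=\sup_{n\ge0}[-s_n(x)].$$
   Context: A character of a commutative topological group $G$ is a continuous homomorphism $\chi:G\to\mathbb{T}=\{z\in\mathbb{C}:|z|=1\}$. The characters form a group $G'$ under pointwise multiplication, with unit $\mathbf{1}(x)\equiv 1$. An almost periodic function on $G$ is a bounded continuous complex-valued function $\psi$ on $G$ such that the set of its shifts $\{x\mapsto\psi(hx):h\in G\}$ is precompact in the sup-norm; $AP(G)$ is the space of all almost periodic functions. The Bohr compact of $G$ is the compact group $bG$ dual to $G'$ taken with the discrete topology (i.e. all homomorphisms $G'\to\mathbb{T}$ with the topology of pointwise convergence), and $j:G\to bG$, $(jx)(\chi)=\chi(x)$, is a continuous homomorphism with dense image. The map $\psi\mapsto\psi\circ j$ is a bijective linear isometry $C(bG)\to AP(G)$, and the character group of $bG$ is identified with $G'$ via $\chi\mapsto\big(y\mapsto y(\chi)\big)$. For $\gamma\in AP(G)$ let $\tilde\gamma\in C(bG)$ be the function with $\gamma=\tilde\gamma\circ j$. The spectrum $\operatorname{spec}\gamma$ is the set of those $\chi\in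 G'$ for which the Fourier coefficient $\int_{bG}\tilde\gamma\,\overline{\chi}\,d\nu$ is nonzero, where $\nu$ is the normalized Haar measure on $bG$. $H_\gamma$ denotes the subgroup of $G'$ generated by $\operatorname{spec}\gamma$ (with $H_\gamma=\{\mathbf{1}\}$ if $\gamma=0$), and $g^{\perp}=\{\chi\in G':\chi(g)=1\}$. *)

theory Defs
  imports "HOL-Analysis.Analysis" "HOL-Algebra.Generated_Groups"
begin

text \<open>
  The commutative topological group \<open>G\<close> is a type of class
  \<^class>\<open>topological_ab_group_add\<close>, written additively and not assumed Hausdorff. Character groups
  and Bohr compacts depend on \<open>G\<close> and are written multiplicatively, as records of HOL-Algebra.
\<close>

definition almost_periodic :: "('a::topological_ab_group_add \<Rightarrow> complex) set" where
  "almost_periodic =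
    {\<psi>. continuous_on UNIV \<psi> \<and> bounded (range \<psi>) \<and>
        compact (closure (range (\<lambda>h. Bcontfun (\<lambda>x. \<psi> (h + x)))))}"

definition circle_group :: "complex monoid" where
  "circle_group = \<lparr>carrier = {z. cmod z = 1}, monoid.mult = (*), one = 1\<rparr>"

definition characters :: "('a::topological_ab_group_add \<Rightarrow> complex) set" where
  "characters =
    {\<xi>. continuous_on UNIV \<xi> \<and> (\<forall>x. \<xi> x \<in> carrier circle_group) \<and>
        (\<forall>x y. \<xi> (x + y) = \<xi> x * \<xi> y)}"

definition character_group :: "('a::topological_ab_group_add \<Rightarrow> complex) monoid" where
  "character_group =
    \<lparr>carrier = characters, monoid.mult = (\<lambda>\<xi> \<eta> x. \<xi> x * \<eta> x), one = (\<lambda>_. 1)\<rparr>"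

text \<open>
  The Bohr compact consists of all (not necessarily continuous) homomorphisms from the character
  group to the circle. They are represented by functions that are \<open>undefined\<close> outside
  \<^const>\<open>characters\<close>, so that equality of elements is equality of homomorphisms.
\<close>

definition bohr_group :: "(('a::topological_ab_group_add \<Rightarrow> complex) \<Rightarrow> complex) monoid" where
  "bohr_group =
    \<lparr>carrier = hom character_group circle_group \<inter> extensional characters,
     monoid.mult = (\<lambda>y z. \<lambda>\<xi>\<in>characters. y \<xi> * z \<xi>),
     one = (\<lambda>\<xi>\<in>characters. 1)\<rparr>"

definition bohr_topology :: "(('a::topological_ab_group_add \<Rightarrow> complex) \<Rightarrow> complex) topology" where
  "bohr_topology =
    subtopology (product_topology (\<lambda>_. euclidean) characters) (carrier bohr_group)"

definition bohr_map :: "'a::topological_ab_group_add \<Rightarrow> ('a \<Rightarrow> complex) \<Rightarrow> complex" where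
  "bohr_map x = (\<lambda>\<xi>\<in>characters. \<xi> x)"

text \<open>
  For almost periodic \<open>\<gamma>\<close>, the values of the extension on the Bohr compact are uniquely determined,
  because the image of \<^const>\<open>bohr_map\<close> is dense; off the Bohr compact they are irrelevant.
\<close>

definition bohr_extension ::
    "('a::topological_ab_group_add \<Rightarrow> complex) \<Rightarrow> (('a \<Rightarrow> complex) \<Rightarrow> complex) \<Rightarrow> complex" where
  "bohr_extension \<gamma> =
    (SOME f. continuous_map bohr_topology euclidean f \<and> (\<forall>x. f (bohr_map x) = \<gamma> x))"

text \<open>
  On a compact Hausdorff group the following predicate describes exactly one measure. Since the
  measure is finite, inner regularity implies outer regularity.
\<close>

definition normalized_haar_measure :: "('b, 'c) monoid_scheme \<Rightarrow> 'b topology \<Rightarrow> 'b measure \<Rightarrow> bool" where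
  "normalized_haar_measure K X \<nu> \<longleftrightarrow>
    space \<nu> = topspace X \<and>
    sets \<nu> = sigma_sets (topspace X) {U. openin X U} \<and>
    emeasure \<nu> (topspace X) = 1 \<and>
    (\<forall>a\<in>carrier K. \<forall>B\<in>sets \<nu>. emeasure \<nu> ((\<lambda>y. a \<otimes>\<^bsub>K\<^esub> y) ` B) = emeasure \<nu> B) \<and>
    (\<forall>B\<in>sets \<nu>. emeasure \<nu> B = (SUP C\<in>{C. compactin X C \<and> C \<subseteq> B}. emeasure \<nu> C))"

definition bohr_haar :: "(('a::topological_ab_group_add \<Rightarrow> complex) \<Rightarrow> complex) measure" where
  "bohr_haar = (SOME \<nu>. normalized_haar_measure bohr_group bohr_topology \<nu>)"

definition fourier_coefficient ::
    "('a::topological_ab_group_add \<Rightarrow> complex) \<Rightarrow> ('a \<Rightarrow> complex) \<Rightarrow> complex" where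
  "fourier_coefficient \<gamma> \<xi> = (\<integral>y. bohr_extension \<gamma> y * cnj (y \<xi>) \<partial>bohr_haar)"

definition spectrum :: "('a::topological_ab_group_add \<Rightarrow> complex) \<Rightarrow> ('a \<Rightarrow> complex) set" where
  "spectrum \<gamma> = {\<xi> \<in> characters. fourier_coefficient \<gamma> \<xi> \<noteq> 0}"

definition spectral_subgroup :: "('a::topological_ab_group_add \<Rightarrow> complex) \<Rightarrow> ('a \<Rightarrow> complex) set" where
  "spectral_subgroup \<gamma> = generate character_group (spectrum \<gamma>)"

definition annihilator :: "'a::topological_ab_group_add \<Rightarrow> ('a \<Rightarrow> complex) set" where
  "annihilator g = {\<xi> \<in> characters. \<xi> g = 1}"

text \<open>\<open>((+) g ^^ k) x\<close> is the translate of \<open>x\<close> by the \<open>k\<close>-fold multiple of \<open>g\<close>.\<close>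

definition orbit_sum ::
    "'a::topological_ab_group_add \<Rightarrow> ('a \<Rightarrow> complex) \<Rightarrow> nat \<Rightarrow> 'a \<Rightarrow> complex" where
  "orbit_sum g \<gamma> n x = (\<Sum>k=0..n. \<gamma> (((+) g ^^ k) x))"

definition uniformly_bounded_orbit_sums ::
    "'a::topological_ab_group_add \<Rightarrow> ('a \<Rightarrow> complex) \<Rightarrow> bool" where
  "uniformly_bounded_orbit_sums g \<gamma> \<longleftrightarrow> (\<exists>C::real. \<forall>n x. cmod (orbit_sum g \<gamma> n x) \<le> C)"

definition solves_cohomological_equation ::
    "'a::topological_ab_group_add \<Rightarrow> ('a \<Rightarrow> complex) \<Rightarrow> ('a \<Rightarrow> complex) \<Rightarrow> bool" where
  "solves_cohomological_equation g \<gamma> \<phi> \<longleftrightarrow> (\<forall>x. \<phi> (g + x) - \<phi> x = \<gamma> x)"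

end

theory Submission
  imports Defs "HOL-Complex_Analysis.Great_Picard"
begin

text \<open>
  The substance of the theorem is a density statement. Write \<open>d (x, y)\<close> for the supremum over
  \<open>z\<close> of \<open>\<bar>\<gamma> (x + z) - \<gamma> (y + z)\<bar>\<close>; this is a translation-invariant pseudometric on the group, totally
  bounded because \<open>\<gamma>\<close> is almost periodic. The hypothesis on the spectrum says exactly what is needed
  for the multiples of \<open>g\<close> to be \<open>d\<close>-dense (\<open>orbit_dense\<close>), and then the argument of Gottschalk and
  Hedlund for minimal rotations applies.

  That argument is carried out in the locale \<open>bounded_almost_periodic_cocycle\<close> for a real function
  (the real or the imaginary part of \<open>\<gamma>\<close>). The function \<open>\<phi>\<close>, the supremum of the negated partial sums,
  satisfies the equation as soon as \<open>0 \<le> \<phi>\<close>, and this holds because the orbit of \<open>g\<close> is recurrent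
  (\<open>transfer_nonneg\<close>). Being a supremum of \<open>d\<close>-continuous functions, \<open>\<phi>\<close> oscillates little near any
  point where it almost attains its least upper bound; density of the orbit and the equation itself
  carry this smallness to every point, uniformly (\<open>transfer_uniform_modulus\<close>). Hence \<open>\<phi>\<close> inherits
  continuity and almost periodicity from \<open>\<gamma>\<close>. The converse direction is a telescoping sum.

  Density rests on three facts. First, a nonzero almost periodic function has a nonzero Fourier
  coefficient (\<open>exists_correlated_unimodular_hom\<close>): convolution with a hermitian kernel is a compact
  self-adjoint operator for the mean inner product, so its square has an eigenfunction, and among the
  normalized eigenfunctions one with extremal autocorrelation has a multiplicative autocorrelation.
  Secondly, by compactness of the hull, finitely many spectral characters control the pseudometric
  \<open>d\<close> (\<open>almost_periodic_bohr_neighbourhood\<close>). Thirdly, a theorem of Kronecker type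
  (\<open>kronecker_approximation\<close>) says that finitely many characters take prescribed values
  approximately as soon as these values respect all multiplicative relations between the characters.

  The mean value of an almost periodic function is constructed on the group itself, following von
  Neumann. The spectrum, however, is defined by a Haar measure on the Bohr compactification, selected
  by a choice operator, and by an extension of \<open>\<gamma>\<close> to it, also selected by choice. So it must be shown
  that both objects exist, and that every normalized Haar measure integrates a continuous function
  to the mean value of its restriction to the group (\<open>bohr_integral_eq_mean\<close>). The Haar measure
  is obtained by the Riesz construction from the functional given by the mean value; the extension
  exists by Kronecker's theorem, applied once more to show that the group is dense in its Bohr
  compactification, together with the control of \<open>d\<close> by finitely many characters.
\<close>

section \<open>Almost periodicity without topology\<close>

text \<open>
  The condition is total boundedness of the set of translates in the supremum norm, expressed by a
  finite colouring of the group whose colour classes have diameter at most \<open>e\<close>. Colourings, as opposed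
  to finite nets, pull back along homomorphisms, and two of them have an obvious common refinement.
\<close>

definition precompact_translates :: "('a::ab_group_add \<Rightarrow> 'b::real_normed_vector) \<Rightarrow> bool" where
  "precompact_translates f \<longleftrightarrow>
    (\<forall>e>0. \<exists>c::'a \<Rightarrow> nat. finite (range c) \<and>
       (\<forall>h k. c h = c k \<longrightarrow> (\<forall>x. norm (f (h + x) - f (k + x)) \<le> e)))"

lemma precompact_translatesD:
  assumes "precompact_translates f" "0 < e"
  shows "\<exists>c::'a::ab_group_add \<Rightarrow> nat. finite (range c) \<and>
       (\<forall>h k. c h = c k \<longrightarrow> (\<forall>x. norm (f (h + x) - f (k + x)) \<le> e))"
  using assms unfolding precompact_translates_def by simp

lemma precompact_translatesE:
  assumes "precompact_translates f" "0 < e"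
  obtains c :: "'a::ab_group_add \<Rightarrow> nat" where "finite (range c)"
    "\<And>h k x. c h = c k \<Longrightarrow> norm (f (h + x) - f (k + x)) \<le> e"
  using precompact_translatesD[OF assms] by metis

lemma finite_range_representatives:
  fixes c :: "'a \<Rightarrow> nat"
  assumes "finite (range c)"
  obtains F where "finite F" "F \<noteq> {}" "\<And>h. \<exists>a\<in>F. c h = c a"
proof -
  let ?F = "(\<lambda>n. SOME a. c a = n) ` range c"
  have "\<exists>a\<in>?F. c h = c a" for h
    by (rule bexI[of _ "SOME a. c a = c h"]) (metis (mono_tags, lifting) someI, blast)
  then show ?thesis
    using that[of ?F] assms by blast
qed

lemma precompact_translates_net:
  assumes "precompact_translates f" "0 < e"
  obtains F :: "'a::ab_group_add set" where "finite F" "F \<noteq> {}"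
    "\<And>h. \<exists>a\<in>F. \<forall>x. norm (f (h + x) - f (a + x)) \<le> e"
proof -
  obtain c :: "'a \<Rightarrow> nat" where c: "finite (range c)"
    "\<And>h k x. c h = c k \<Longrightarrow> norm (f (h + x) - f (k + x)) \<le> e"
    using precompact_translatesE[OF assms] by blast
  obtain F where "finite F" "F \<noteq> {}" "\<And>h. \<exists>a\<in>F. c h = c a"
    using finite_range_representatives[OF c(1)] by blast
  then show ?thesis
    using that[of F] c(2) by metis
qed

lemma common_colouring:
  fixes c :: "'i \<Rightarrow> 'a \<Rightarrow> nat"
  assumes "finite I" "\<And>i. i \<in> I \<Longrightarrow> finite (range (c i))"
  shows "\<exists>d::'a \<Rightarrow> nat. finite (range d) \<and> (\<forall>i\<in>I. \<forall>h k. d h = d k \<longrightarrow> c i h = c i k)"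
  using assms
proof (induction I rule: finite_induct)
  case empty
  show ?case by (rule exI[of _ "\<lambda>_. 0"]) simp
next
  case (insert j I)
  then obtain d :: "'a \<Rightarrow> nat" where d: "finite (range d)"
    "\<forall>i\<in>I. \<forall>h k. d h = d k \<longrightarrow> c i h = c i k"
    by auto
  let ?d = "\<lambda>h. prod_encode (c j h, d h)"
  have "range ?d \<subseteq> prod_encode ` (range (c j) \<times> range d)"
    by auto
  moreover have "finite (range (c j))"
    using insert.prems by simp
  ultimately have "finite (range ?d)"
    using d(1) by (meson finite_SigmaI finite_imageI finite_subset)
  then show ?case
    using d(2) by (intro exI[of _ ?d]) (unfold prod_encode_eq prod.inject, blast)
qed

lemma precompact_translates_common:
  fixes f :: "'i \<Rightarrow> 'a::ab_group_add \<Rightarrow> 'b::real_normed_vector"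
  assumes "finite I" "\<And>i. i \<in> I \<Longrightarrow> precompact_translates (f i)" "0 < e"
  obtains d :: "'a \<Rightarrow> nat" where "finite (range d)"
    "\<And>i h k x. i \<in> I \<Longrightarrow> d h = d k \<Longrightarrow> norm (f i (h + x) - f i (k + x)) \<le> e"
proof -
  have "\<forall>i\<in>I. \<exists>c::'a \<Rightarrow> nat. finite (range c) \<and>
       (\<forall>h k. c h = c k \<longrightarrow> (\<forall>x. norm (f i (h + x) - f i (k + x)) \<le> e))"
    using precompact_translatesD[OF assms(2) assms(3)] by simp
  from bchoice[OF this] obtain c :: "'i \<Rightarrow> 'a \<Rightarrow> nat" where c: "\<And>i. i \<in> I \<Longrightarrow> finite (range (c i))"
    "\<And>i h k x. i \<in> I \<Longrightarrow> c i h = c i k \<Longrightarrow> norm (f i (h + x) - f i (k + x)) \<le> e"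
    by blast
  obtain d :: "'a \<Rightarrow> nat" where d: "finite (range d)"
    "\<forall>i\<in>I. \<forall>h k. d h = d k \<longrightarrow> c i h = c i k"
    using common_colouring[of I c, OF \<open>finite I\<close> c(1)] by blast
  show ?thesis
    by (rule that[of d]) (use d c(2) in blast)+
qed

lemma precompact_translates_common2:
  fixes f :: "'a::ab_group_add \<Rightarrow> 'b::real_normed_vector"
    and g :: "'a \<Rightarrow> 'c::real_normed_vector"
  assumes "precompact_translates f" "precompact_translates g" "0 < e"
  obtains d :: "'a \<Rightarrow> nat" where "finite (range d)"
    "\<And>h k x. d h = d k \<Longrightarrow> norm (f (h + x) - f (k + x)) \<le> e"
    "\<And>h k x. d h = d k \<Longrightarrow> norm (g (h + x) - g (k + x)) \<le> e"
proof -
  obtain c1 :: "'a \<Rightarrow> nat" where c1: "finite (range c1)"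
    "\<And>h k x. c1 h = c1 k \<Longrightarrow> norm (f (h + x) - f (k + x)) \<le> e"
    using precompact_translatesE[OF assms(1,3)] by blast
  obtain c2 :: "'a \<Rightarrow> nat" where c2: "finite (range c2)"
    "\<And>h k x. c2 h = c2 k \<Longrightarrow> norm (g (h + x) - g (k + x)) \<le> e"
    using precompact_translatesE[OF assms(2,3)] by blast
  let ?d = "\<lambda>h. prod_encode (c1 h, c2 h)"
  have "range ?d \<subseteq> prod_encode ` (range c1 \<times> range c2)"
    by auto
  then have "finite (range ?d)"
    using c1(1) c2(1) by (meson finite_SigmaI finite_imageI finite_subset)
  then show ?thesis
    by (rule that) (unfold prod_encode_eq prod.inject, (use c1(2) c2(2) in blast)+)
qed

text \<open>
  If \<open>g\<close> moves little whenever \<open>f\<close> does, a colouring for \<open>f\<close> serves for \<open>g\<close>. This is how almost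
  periodicity is inherited by convolutions, autocorrelations and solutions of the equation.
\<close>

lemma precompact_translates_dominated:
  fixes f :: "'a::ab_group_add \<Rightarrow> 'b::real_normed_vector"
    and g :: "'a \<Rightarrow> 'c::real_normed_vector"
  assumes "precompact_translates f"
    and "\<And>e. 0 < e \<Longrightarrow> \<exists>d>0. \<forall>h k. (\<forall>x. norm (f (h + x) - f (k + x)) \<le> d) \<longrightarrow>
            (\<forall>x. norm (g (h + x) - g (k + x)) \<le> e)"
  shows "precompact_translates g"
  unfolding precompact_translates_def
proof (intro allI impI)
  fix e :: real assume "0 < e"
  then obtain d where d: "d > 0" "\<And>h k. (\<forall>x. norm (f (h + x) - f (k + x)) \<le> d) \<Longrightarrow>
            (\<forall>x. norm (g (h + x) - g (k + x)) \<le> e)"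
    using assms(2) by blast
  obtain c :: "'a \<Rightarrow> nat" where "finite (range c)"
    "\<And>h k x. c h = c k \<Longrightarrow> norm (f (h + x) - f (k + x)) \<le> d"
    using precompact_translatesE[OF assms(1) d(1)] by blast
  then show "\<exists>c::'a \<Rightarrow> nat. finite (range c) \<and>
       (\<forall>h k. c h = c k \<longrightarrow> (\<forall>x. norm (g (h + x) - g (k + x)) \<le> e))"
    using d(2) by blast
qed

lemma precompact_translates_bounded:
  assumes "precompact_translates f"
  obtains B where "0 < B" "\<And>x. norm (f x) \<le> B"
proof -
  obtain F where F: "finite F" "F \<noteq> {}" "\<And>h. \<exists>a\<in>F. \<forall>x. norm (f (h + x) - f (a + x)) \<le> 1"
    using precompact_translates_net[OF assms, of 1] by auto
  let ?B = "1 + (\<Sum>a\<in>F. norm (f a))"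
  have "norm (f h) \<le> ?B" for h
  proof -
    obtain a where a: "a \<in> F" "norm (f (h + 0) - f (a + 0)) \<le> 1"
      using F(3) by blast
    have "norm (f a) \<le> (\<Sum>a\<in>F. norm (f a))"
      using a(1) F(1) by (intro member_le_sum) auto
    then show ?thesis
      using a(2) norm_triangle_sub[of "f h" "f a"] by simp
  qed
  moreover have "0 < ?B"
    by (simp add: add_pos_nonneg sum_nonneg)
  ultimately show ?thesis
    using that by blast
qed

lemma precompact_translates_const: "precompact_translates (\<lambda>_. c)"
  unfolding precompact_translates_def by (auto intro!: exI[of _ "\<lambda>_. 0::nat"])

lemma precompact_translates_compose_lipschitz:
  assumes "precompact_translates f" "\<And>u v. norm (T u - T v) \<le> norm (u - v)"
  shows "precompact_translates (\<lambda>x. T (f x))"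
  by (rule precompact_translates_dominated[OF assms(1)]) (meson assms(2) order_trans)

lemma precompact_translates_cnj:
  "precompact_translates f \<Longrightarrow> precompact_translates (\<lambda>x. cnj (f x))"
  by (rule precompact_translates_compose_lipschitz[of _ cnj])
    (simp_all flip: complex_cnj_diff)

lemma precompact_translates_Re:
  "precompact_translates f \<Longrightarrow> precompact_translates (\<lambda>x. Re (f x))"
  by (rule precompact_translates_compose_lipschitz[of _ Re])
    (simp_all add: abs_Re_le_cmod flip: minus_complex.sel)

lemma precompact_translates_Im:
  "precompact_translates f \<Longrightarrow> precompact_translates (\<lambda>x. Im (f x))"
  by (rule precompact_translates_compose_lipschitz[of _ Im])
    (simp_all add: abs_Im_le_cmod flip: minus_complex.sel)

lemma precompact_translates_of_real:
  "precompact_translates f \<Longrightarrow> precompact_translates (\<lambda>x. complex_of_real (f x))"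
  by (rule precompact_translates_compose_lipschitz[of _ complex_of_real])
    (simp_all flip: of_real_diff)

lemma precompact_translates_add:
  assumes f: "precompact_translates f" and g: "precompact_translates g"
  shows "precompact_translates (\<lambda>x. f x + g x)"
  unfolding precompact_translates_def
proof (intro allI impI)
  fix e :: real assume e: "0 < e"
  obtain d :: "'a \<Rightarrow> nat" where d: "finite (range d)"
    "\<And>h k x. d h = d k \<Longrightarrow> norm (f (h + x) - f (k + x)) \<le> e / 2"
    "\<And>h k x. d h = d k \<Longrightarrow> norm (g (h + x) - g (k + x)) \<le> e / 2"
    using precompact_translates_common2[OF f g half_gt_zero[OF e]] by blast
  have "norm (f (h + x) + g (h + x) - (f (k + x) + g (k + x))) \<le> e" if "d h = d k" for h k x
    using d(2)[of h k x] d(3)[of h k x] that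
      norm_triangle_ineq[of "f (h + x) - f (k + x)" "g (h + x) - g (k + x)"]
    by (simp add: algebra_simps)
  then show "\<exists>c::'a \<Rightarrow> nat. finite (range c) \<and> (\<forall>h k. c h = c k \<longrightarrow>
      (\<forall>x. norm (f (h + x) + g (h + x) - (f (k + x) + g (k + x))) \<le> e))"
    using d(1) by blast
qed

lemma precompact_translates_mult:
  fixes f g :: "'a::ab_group_add \<Rightarrow> 'b::real_normed_algebra"
  assumes f: "precompact_translates f" and g: "precompact_translates g"
  shows "precompact_translates (\<lambda>x. f x * g x)"
  unfolding precompact_translates_def
proof (intro allI impI)
  fix e :: real assume e: "0 < e"
  obtain A where A: "0 < A" "\<And>x. norm (f x) \<le> A"
    using precompact_translates_bounded[OF f] by blast
  obtain B where B: "0 < B" "\<And>x. norm (g x) \<le> B"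
    using precompact_translates_bounded[OF g] by blast
  let ?d = "e / (A + B)"
  have d0: "?d > 0"
    using e A B by simp
  obtain d :: "'a \<Rightarrow> nat" where d: "finite (range d)"
    "\<And>h k x. d h = d k \<Longrightarrow> norm (f (h + x) - f (k + x)) \<le> ?d"
    "\<And>h k x. d h = d k \<Longrightarrow> norm (g (h + x) - g (k + x)) \<le> ?d"
    using precompact_translates_common2[OF f g d0] by blast
  have "norm (f (h + x) * g (h + x) - f (k + x) * g (k + x)) \<le> e" if "d h = d k" for h k x
  proof -
    have "f (h + x) * g (h + x) - f (k + x) * g (k + x) =
        f (h + x) * (g (h + x) - g (k + x)) + (f (h + x) - f (k + x)) * g (k + x)"
      by (simp add: algebra_simps)
    also have "norm \<dots> \<le> norm (f (h + x)) * norm (g (h + x) - g (k + x))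
        + norm (f (h + x) - f (k + x)) * norm (g (k + x))"
      by (meson add_mono norm_mult_ineq norm_triangle_le)
    also have "\<dots> \<le> A * ?d + ?d * B"
      using d(2)[of h k x] d(3)[of h k x] that A B d0
      by (intro add_mono mult_mono) auto
    also have "\<dots> = (A + B) * ?d"
      by (simp only: distrib_right mult.commute[of ?d])
    also have "\<dots> = e"
      using A(1) B(1) by simp
    finally show ?thesis .
  qed
  then show "\<exists>c::'a \<Rightarrow> nat. finite (range c) \<and> (\<forall>h k. c h = c k \<longrightarrow>
      (\<forall>x. norm (f (h + x) * g (h + x) - f (k + x) * g (k + x)) \<le> e))"
    using d(1) by blast
qed

lemma precompact_translates_hom:
  fixes f :: "'b::ab_group_add \<Rightarrow> 'c::real_normed_vector"
    and \<phi> :: "'a::ab_group_add \<Rightarrow> 'b"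
  assumes "precompact_translates f" "\<And>x y. \<phi> (x + y) = \<phi> x + \<phi> y"
  shows "precompact_translates (\<lambda>x. f (\<phi> x))"
  unfolding precompact_translates_def
proof (intro allI impI)
  fix e :: real assume "0 < e"
  then obtain c :: "'b \<Rightarrow> nat" where c: "finite (range c)"
    "\<And>h k x. c h = c k \<Longrightarrow> norm (f (h + x) - f (k + x)) \<le> e"
    using precompact_translatesE[OF assms(1)] by blast
  have "finite (range (c \<circ> \<phi>))"
    using c(1) by (rule finite_subset[rotated]) auto
  then show "\<exists>c::'a \<Rightarrow> nat. finite (range c) \<and>
       (\<forall>h k. c h = c k \<longrightarrow> (\<forall>x. norm (f (\<phi> (h + x)) - f (\<phi> (k + x))) \<le> e))"
    using c(2) by (intro exI[of _ "c \<circ> \<phi>"]) (simp add: assms(2))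
qed

lemma precompact_translates_shift:
  assumes "precompact_translates f"
  shows "precompact_translates (\<lambda>x. f (a + x))"
proof (rule precompact_translates_dominated[OF assms])
  fix e :: real assume "0 < e"
  have "\<forall>x. norm (f (a + (h + x)) - f (a + (k + x))) \<le> e"
    if "\<forall>x. norm (f (h + x) - f (k + x)) \<le> e" for h k
    using that by (metis add.left_commute)
  then show "\<exists>d>0. \<forall>h k. (\<forall>x. norm (f (h + x) - f (k + x)) \<le> d) \<longrightarrow>
      (\<forall>x. norm (f (a + (h + x)) - f (a + (k + x))) \<le> e)"
    using \<open>0 < e\<close> by blast
qed

lemma precompact_translates_reflect:
  "precompact_translates f \<Longrightarrow> precompact_translates (\<lambda>x. f (- x))"
  by (rule precompact_translates_hom[of f uminus]) auto

lemma precompact_translates_cmult: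
  fixes f :: "'a::ab_group_add \<Rightarrow> 'b::real_normed_algebra"
  shows "precompact_translates f \<Longrightarrow> precompact_translates (\<lambda>x. c * f x)"
  by (rule precompact_translates_mult[OF precompact_translates_const])

lemma precompact_translates_diff:
  fixes f :: "'a::ab_group_add \<Rightarrow> 'b::real_normed_algebra_1"
  assumes "precompact_translates f" "precompact_translates g"
  shows "precompact_translates (\<lambda>x. f x - g x)"
  using precompact_translates_add[OF assms(1) precompact_translates_cmult[OF assms(2), of "-1"]]
  by simp

lemma precompact_translates_uniform_limit:
  assumes "\<And>n. precompact_translates (f n)"
    and "\<And>e. 0 < e \<Longrightarrow> \<exists>n::nat. \<forall>x. norm (f n x - g x) \<le> e"
  shows "precompact_translates g"
  unfolding precompact_translates_def
proof (intro allI impI)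
  fix e :: real assume e: "0 < e"
  then obtain n where n: "\<And>x. norm (f n x - g x) \<le> e / 3"
    using assms(2)[of "e/3"] by auto
  obtain c :: "'a \<Rightarrow> nat" where c: "finite (range c)"
    "\<And>h k x. c h = c k \<Longrightarrow> norm (f n (h + x) - f n (k + x)) \<le> e / 3"
    using precompact_translatesE[OF assms(1)[of n], of "e/3"] e by auto
  have "norm (g (h + x) - g (k + x)) \<le> e" if "c h = c k" for h k x
  proof -
    have "g (h + x) - g (k + x) = - (f n (h + x) - g (h + x))
        + ((f n (h + x) - f n (k + x)) + (f n (k + x) - g (k + x)))"
      by simp
    also have "norm \<dots> \<le> e / 3 + (e / 3 + e / 3)"
      using n c(2)[OF that] by (intro norm_triangle_le add_mono) (auto simp: norm_minus_commute)
    finally show ?thesis by simp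
  qed
  then show "\<exists>c::'a \<Rightarrow> nat. finite (range c) \<and>
       (\<forall>h k. c h = c k \<longrightarrow> (\<forall>x. norm (g (h + x) - g (k + x)) \<le> e))"
    using c(1) by blast
qed

section \<open>The mean value\<close>

text \<open>
  Averages are taken over lists, so that repeated translates get the right weight when two averages
  are composed.
\<close>

definition translation_average ::
    "'a::ab_group_add list \<Rightarrow> ('a \<Rightarrow> 'b::real_normed_vector) \<Rightarrow> 'a \<Rightarrow> 'b" where
  "translation_average as f x = (\<Sum>a\<leftarrow>as. f (a + x)) /\<^sub>R real (length as)"

definition has_mean :: "('a::ab_group_add \<Rightarrow> 'b::real_normed_vector) \<Rightarrow> 'b \<Rightarrow> bool" where
  "has_mean f c \<longleftrightarrow>
    (\<forall>e>0. \<exists>as. as \<noteq> [] \<and> (\<forall>x. norm (translation_average as f x - c) \<le> e))"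

definition mean :: "('a::ab_group_add \<Rightarrow> 'b::real_normed_vector) \<Rightarrow> 'b" where
  "mean f = (THE c. has_mean f c)"

lemma norm_sum_list_le:
  fixes g :: "'i \<Rightarrow> 'b::real_normed_vector"
  assumes "\<And>a. a \<in> set as \<Longrightarrow> norm (g a) \<le> e"
  shows "norm (\<Sum>a\<leftarrow>as. g a) \<le> real (length as) * e"
  using assms
proof (induction as)
  case (Cons a as)
  have "norm (g a + (\<Sum>a\<leftarrow>as. g a)) \<le> e + real (length as) * e"
    using Cons by (intro norm_triangle_le add_mono) auto
  then show ?case by (simp add: algebra_simps)
qed auto

lemma translation_average_minus_const:
  assumes "as \<noteq> []"
  shows "translation_average as f x - c = (\<Sum>a\<leftarrow>as. f (a + x) - c) /\<^sub>R real (length as)"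
proof -
  have "(\<Sum>a\<leftarrow>as. f (a + x) - c) = (\<Sum>a\<leftarrow>as. f (a + x)) - real (length as) *\<^sub>R c"
    by (induction as) (auto simp: algebra_simps)
  then show ?thesis
    using assms by (simp add: translation_average_def scaleR_right_diff_distrib)
qed

lemma norm_translation_average_le:
  assumes "as \<noteq> []" "\<And>a. a \<in> set as \<Longrightarrow> norm (f (a + x) - c) \<le> e"
  shows "norm (translation_average as f x - c) \<le> e"
proof -
  have "norm (\<Sum>a\<leftarrow>as. f (a + x) - c) \<le> real (length as) * e"
    using assms(2) by (rule norm_sum_list_le)
  then show ?thesis
    using assms(1) by (simp add: translation_average_minus_const field_simps)
qed

lemma scaleR_sum_list:
  fixes g :: "'i \<Rightarrow> 'b::real_vector"
  shows "r *\<^sub>R (\<Sum>a\<leftarrow>as. g a) = (\<Sum>a\<leftarrow>as. r *\<^sub>R g a)"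
  by (induction as) (auto simp: scaleR_add_right)

lemma translation_average_translation_average:
  obtains cs where "\<And>f::'a::ab_group_add \<Rightarrow> 'b::real_normed_vector. \<And>x.
      translation_average as (translation_average bs f) x = translation_average cs f x"
    "as \<noteq> [] \<Longrightarrow> bs \<noteq> [] \<Longrightarrow> cs \<noteq> []"
proof -
  let ?cs = "concat (map (\<lambda>a. map (\<lambda>b. b + a) bs) as)"
  have len: "length ?cs = length as * length bs"
    by (induction as) auto
  have sum: "(\<Sum>c\<leftarrow>?cs. f (c + x)) = (\<Sum>a\<leftarrow>as. \<Sum>b\<leftarrow>bs. f (b + (a + x)))"
    for f :: "'a \<Rightarrow> 'b" and x
    by (induction as) (auto simp: o_def add.assoc)
  have "translation_average as (translation_average bs f) x = translation_average ?cs f x"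
    for f :: "'a \<Rightarrow> 'b" and x
  proof -
    have "translation_average as (translation_average bs f) x =
        ((\<Sum>a\<leftarrow>as. \<Sum>b\<leftarrow>bs. f (b + (a + x))) /\<^sub>R real (length bs)) /\<^sub>R real (length as)"
      unfolding translation_average_def
      by (subst scaleR_sum_list[of "inverse (real (length bs))" _ as]) (rule refl)
    then show ?thesis
      unfolding translation_average_def[of ?cs] sum len by (simp add: mult.commute)
  qed
  moreover have "?cs \<noteq> []" if "as \<noteq> []" "bs \<noteq> []"
    using len that by (metis length_0_conv mult_eq_0_iff)
  ultimately show ?thesis
    using that by blast
qed

lemma sum_list_swap:
  fixes f :: "'i \<Rightarrow> 'j \<Rightarrow> 'b::comm_monoid_add"
  shows "(\<Sum>a\<leftarrow>as. \<Sum>b\<leftarrow>bs. f a b) = (\<Sum>b\<leftarrow>bs. \<Sum>a\<leftarrow>as. f a b)"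
  by (induction as) (auto simp: sum_list_addf)

text \<open>
  Commutativity of the group enters here; it makes any two averages compatible, and with it the mean
  value unique.
\<close>

lemma translation_average_commute:
  "translation_average as (translation_average bs f) x =
    translation_average bs (translation_average as f) x"
proof -
  have "translation_average as (translation_average bs f) x =
      ((\<Sum>a\<leftarrow>as. \<Sum>b\<leftarrow>bs. f (b + (a + x))) /\<^sub>R real (length bs)) /\<^sub>R real (length as)"
    for as bs x
    unfolding translation_average_def
    by (subst scaleR_sum_list[of "inverse (real (length bs))" _ as]) (rule refl)
  then show ?thesis
    by (simp add: mult.commute sum_list_swap[of _ as] add.left_commute)
qed

lemma has_mean_simultaneous:
  fixes f g :: "'a::ab_group_add \<Rightarrow> 'b::real_normed_vector"
  assumes "has_mean f c" "has_mean g d" "0 < e"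
  obtains cs where "cs \<noteq> []" "\<And>x. norm (translation_average cs f x - c) \<le> e"
    "\<And>x. norm (translation_average cs g x - d) \<le> e"
proof -
  obtain as where as: "as \<noteq> []" "\<And>x. norm (translation_average as f x - c) \<le> e"
    using assms unfolding has_mean_def by blast
  obtain bs where bs: "bs \<noteq> []" "\<And>x. norm (translation_average bs g x - d) \<le> e"
    using assms unfolding has_mean_def by blast
  obtain cs where cs: "\<And>f::'a \<Rightarrow> 'b. \<And>x.
      translation_average as (translation_average bs f) x = translation_average cs f x"
      "as \<noteq> [] \<Longrightarrow> bs \<noteq> [] \<Longrightarrow> cs \<noteq> []"
    using translation_average_translation_average[of as bs, where 'b = 'b] by blast
  have "norm (translation_average cs g x - d) \<le> e" for x
    unfolding cs(1)[symmetric] by (rule norm_translation_average_le) (use as bs in auto)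
  moreover have "norm (translation_average cs f x - c) \<le> e" for x
    unfolding cs(1)[symmetric] translation_average_commute[of as]
    by (rule norm_translation_average_le) (use as bs in auto)
  ultimately show ?thesis
    using that as bs cs(2) by blast
qed

lemma has_mean_unique:
  assumes "has_mean f c" "has_mean f d"
  shows "c = d"
proof (rule ccontr)
  assume "c \<noteq> d"
  then have "norm (c - d) / 3 > 0"
    by simp
  then obtain cs where "norm (translation_average cs f 0 - c) \<le> norm (c - d) / 3"
    "norm (translation_average cs f 0 - d) \<le> norm (c - d) / 3"
    using has_mean_simultaneous[OF assms] by blast
  then have "norm (c - d) \<le> norm (c - d) / 3 + norm (c - d) / 3"
    by (intro norm_diff_triangle_le[of c "translation_average cs f 0"]) (simp_all add: norm_minus_commute)
  then show False
    using \<open>c \<noteq> d\<close> by simp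
qed

lemma mean_eqI: "has_mean f c \<Longrightarrow> mean f = c"
  unfolding mean_def using has_mean_unique by blast

lemma has_mean_add:
  fixes f g :: "'a::ab_group_add \<Rightarrow> 'b::real_normed_vector"
  assumes "has_mean f c" "has_mean g d"
  shows "has_mean (\<lambda>x. f x + g x) (c + d)"
  unfolding has_mean_def
proof (intro allI impI)
  fix e :: real assume "0 < e"
  then have "0 < e / 2" by simp
  then obtain cs where cs: "cs \<noteq> []" "\<And>x. norm (translation_average cs f x - c) \<le> e / 2"
    "\<And>x. norm (translation_average cs g x - d) \<le> e / 2"
    using has_mean_simultaneous[OF assms] by blast
  have "norm (translation_average cs (\<lambda>x. f x + g x) x - (c + d)) \<le> e" for x
  proof -
    have "translation_average cs (\<lambda>x. f x + g x) x - (c + d)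
        = (translation_average cs f x - c) + (translation_average cs g x - d)"
      by (simp add: translation_average_def sum_list_addf scaleR_add_right)
    also have "norm \<dots> \<le> e / 2 + e / 2"
      using cs by (intro norm_triangle_le add_mono) auto
    finally show ?thesis by simp
  qed
  then show "\<exists>as. as \<noteq> [] \<and>
      (\<forall>x. norm (translation_average as (\<lambda>x. f x + g x) x - (c + d)) \<le> e)"
    using cs(1) by blast
qed

lemma has_mean_bounded_linear:
  assumes "has_mean f c" "bounded_linear T"
  shows "has_mean (\<lambda>x. T (f x)) (T c)"
  unfolding has_mean_def
proof (intro allI impI)
  fix e :: real assume e: "0 < e"
  interpret bounded_linear T by fact
  obtain K where K: "0 < K" "\<And>x. norm (T x) \<le> norm x * K"
    using pos_bounded by blast
  obtain as where as: "as \<noteq> []" "\<And>x. norm (translation_average as f x - c) \<le> e / K"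
    using assms(1) e K(1) unfolding has_mean_def by (meson divide_pos_pos)
  have "norm (translation_average as (\<lambda>x. T (f x)) x - T c) \<le> e" for x
  proof -
    have "(\<Sum>a\<leftarrow>as. T (f (a + x))) = T (\<Sum>a\<leftarrow>as. f (a + x))"
      by (induction as) (auto simp: add zero)
    then have "translation_average as (\<lambda>x. T (f x)) x - T c = T (translation_average as f x - c)"
      by (simp add: translation_average_def diff scaleR)
    also have "norm \<dots> \<le> e / K * K"
      using K as(2)[of x] by (meson mult_right_mono order_trans less_imp_le)
    finally show ?thesis
      using K(1) by simp
  qed
  then show "\<exists>as. as \<noteq> [] \<and> (\<forall>x. norm (translation_average as (\<lambda>x. T (f x)) x - T c) \<le> e)"
    using as(1) by blast
qed

lemma has_mean_const: "has_mean (\<lambda>_. c) c"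
  unfolding has_mean_def by (auto intro!: exI[of _ "[0]"] simp: translation_average_def)

lemma has_mean_sum_list:
  assumes "\<And>z. z \<in> set zs \<Longrightarrow> has_mean (g z) (m z)"
  shows "has_mean (\<lambda>x. \<Sum>z\<leftarrow>zs. g z x) (\<Sum>z\<leftarrow>zs. m z)"
  using assms by (induction zs) (auto intro: has_mean_add simp: has_mean_const)

lemma has_mean_sum:
  assumes "finite Z" "\<And>z. z \<in> Z \<Longrightarrow> has_mean (g z) (m z)"
  shows "has_mean (\<lambda>x. \<Sum>z\<in>Z. g z x) (\<Sum>z\<in>Z. m z)"
  using assms by (induction Z rule: finite_induct) (auto intro: has_mean_add simp: has_mean_const)

lemma has_mean_shift:
  assumes "has_mean f c"
  shows "has_mean (\<lambda>x. f (a + x)) c"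
proof -
  have "translation_average as (\<lambda>x. f (a + x)) x = translation_average as f (a + x)" for as x
    by (simp add: translation_average_def add.left_commute)
  then show ?thesis
    using assms unfolding has_mean_def by metis
qed

lemma has_mean_reflect:
  assumes "has_mean f c"
  shows "has_mean (\<lambda>x. f (- x)) c"
proof -
  have "translation_average (map uminus as) (\<lambda>x. f (- x)) x = translation_average as f (- x)"
    for as x
    by (simp add: translation_average_def o_def)
  then show ?thesis
    using assms unfolding has_mean_def by (metis Nil_is_map_conv)
qed

lemma has_mean_translation_average:
  assumes "has_mean f c" "as \<noteq> []"
  shows "has_mean (translation_average as f) c"
proof -
  have "has_mean (\<lambda>x. \<Sum>a\<leftarrow>as. f (a + x)) (\<Sum>a\<leftarrow>as. c)"
    by (intro has_mean_sum_list has_mean_shift assms)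
  then have "has_mean (\<lambda>x. (\<Sum>a\<leftarrow>as. f (a + x)) /\<^sub>R real (length as)) ((\<Sum>a\<leftarrow>as. c) /\<^sub>R real (length as))"
    by (rule has_mean_bounded_linear) (rule bounded_linear_scaleR_right)
  moreover have "(\<Sum>a\<leftarrow>as. c) = real (length as) *\<^sub>R c"
    by (induction as) (auto simp: algebra_simps)
  ultimately show ?thesis
    using assms(2) by (simp add: translation_average_def[abs_def])
qed

lemma norm_has_mean_le:
  assumes "has_mean f c" "\<And>x. norm (f x - d) \<le> B"
  shows "norm (c - d) \<le> B"
proof (rule field_le_epsilon)
  fix e :: real assume "0 < e"
  then obtain as where as: "as \<noteq> []" "\<And>x. norm (translation_average as f x - c) \<le> e"
    using assms(1) unfolding has_mean_def by blast
  have "norm (translation_average as f 0 - d) \<le> B"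
    by (rule norm_translation_average_le) (use as assms in auto)
  then show "norm (c - d) \<le> B + e"
    using as(2)[of 0] norm_diff_triangle_le[of c "translation_average as f 0" e d B]
    by (simp add: norm_minus_commute)
qed

lemma has_mean_nonneg:
  fixes f :: "'a::ab_group_add \<Rightarrow> real"
  assumes "has_mean f c" "\<And>x. l \<le> f x"
  shows "l \<le> c"
proof (rule field_le_epsilon)
  fix e :: real assume "0 < e"
  then obtain as where as: "as \<noteq> []" "\<And>x. norm (translation_average as f x - c) \<le> e"
    using assms(1) unfolding has_mean_def by blast
  have "real (length as) * l \<le> (\<Sum>a\<leftarrow>as. f (a + 0))"
    using sum_list_mono[of as "\<lambda>_. l" "\<lambda>a. f (a + 0)"] assms(2) by (simp add: sum_list_triv)
  then have "l \<le> translation_average as f 0"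
    using as(1) by (simp add: translation_average_def field_simps)
  then show "l \<le> c + e"
    using as(2)[of 0] by (simp add: abs_le_iff)
qed

lemma sum_list_le_gap:
  fixes g :: "'i \<Rightarrow> real"
  assumes "\<And>a. a \<in> set as \<Longrightarrow> g a \<le> u" "a0 \<in> set as" "g a0 \<le> u - d"
  shows "(\<Sum>a\<leftarrow>as. g a) \<le> real (length as) * u - d"
  using assms
proof (induction as)
  case (Cons a as)
  have bound: "(\<Sum>a\<leftarrow>as. g a) \<le> real (length as) * u"
    using sum_list_mono[of as g "\<lambda>_. u"] Cons.prems(1) by (simp add: sum_list_triv)
  show ?case
  proof (cases "a0 \<in> set as")
    case True
    then have "(\<Sum>a\<leftarrow>as. g a) \<le> real (length as) * u - d"
      using Cons by simp
    then show ?thesis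
      using Cons.prems(1)[of a] by (simp add: algebra_simps)
  next
    case False
    then show ?thesis
      using Cons.prems bound by (simp add: algebra_simps)
  qed
qed auto

lemma translation_average_le:
  fixes f :: "'a::ab_group_add \<Rightarrow> real"
  assumes "as \<noteq> []" "\<And>x. f x \<le> u"
  shows "translation_average as f x \<le> u"
  using sum_list_mono[of as "\<lambda>a. f (a + x)" "\<lambda>_. u"] assms
  by (simp add: sum_list_triv translation_average_def field_simps)

lemma translation_average_ge:
  fixes f :: "'a::ab_group_add \<Rightarrow> real"
  assumes "as \<noteq> []" "\<And>x. l \<le> f x"
  shows "l \<le> translation_average as f x"
  using sum_list_mono[of as "\<lambda>_. l" "\<lambda>a. f (a + x)"] assms
  by (simp add: sum_list_triv translation_average_def field_simps)

text \<open>
  Von Neumann's argument. Let \<open>osc\<close> be the infimum of the oscillations of all averages of \<open>f\<close>. Given an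
  average \<open>k\<close> with oscillation close to \<open>osc\<close>, averaging \<open>k\<close> over a finite net brings at every point
  one almost minimal value of \<open>k\<close> into the average and lowers the supremum by a fixed amount. The
  size of the net is the same for all averages \<open>k\<close>, because averaging does not increase distances
  between translates; therefore \<open>osc > 0\<close> is impossible.
\<close>

lemma precompact_oscillation_shrinks:
  fixes f :: "'a::ab_group_add \<Rightarrow> real"
  assumes f: "precompact_translates f" and e: "0 < e"
  shows "\<exists>as l. as \<noteq> [] \<and> (\<forall>x. l \<le> translation_average as f x \<and> translation_average as f x \<le> l + e)"
proof -
  define Osc where "Osc = {e. e \<ge> 0 \<and> (\<exists>as l. as \<noteq> [] \<and>
      (\<forall>x. l \<le> translation_average as f x \<and> translation_average as f x \<le> l + e))}"
  obtain B where B: "0 < B" "\<And>x. norm (f x) \<le> B"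
    using precompact_translates_bounded[OF f] by blast
  have "2 * B \<in> Osc"
  proof -
    have "- B \<le> translation_average [0] f x \<and> translation_average [0] f x \<le> - B + 2 * B" for x
      using B(2)[of x] by (simp add: translation_average_def abs_le_iff)
    then show ?thesis
      using B(1) unfolding Osc_def by (auto intro!: exI[of _ "[0]"] exI[of _ "- B"])
  qed
  then have ne: "Osc \<noteq> {}" by auto
  have bdd: "bdd_below Osc"
    unfolding Osc_def by (rule bdd_belowI[of _ 0]) auto
  define osc where "osc = Inf Osc"
  have o_le: "osc \<le> d" if "d \<in> Osc" for d
    unfolding osc_def using that bdd by (rule cInf_lower)
  have "osc \<ge> 0"
    unfolding osc_def by (rule cInf_greatest[OF ne]) (auto simp: Osc_def)
  have "osc = 0"
  proof (rule ccontr)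
    assume "osc \<noteq> 0"
    then have o: "0 < osc"
      using \<open>osc \<ge> 0\<close> by simp
    obtain F where F: "finite F" "F \<noteq> {}"
      "\<And>h. \<exists>a\<in>F. \<forall>x. norm (f (h + x) - f (a + x)) \<le> osc / 4"
      using precompact_translates_net[OF f, of "osc/4"] o by auto
    obtain fs where fs: "set fs = F"
      using finite_list[OF F(1)] by blast
    have N: "0 < real (length fs)"
      using fs F(2) by auto
    define \<eta> where "\<eta> = osc / 4 / real (length fs)"
    have \<eta>: "0 < \<eta>"
      unfolding \<eta>_def using o N by simp
    then have "Inf Osc < osc + \<eta>"
      unfolding osc_def by simp
    then obtain d where d: "d \<in> Osc" "d < osc + \<eta>"
      using cInf_less_iff[OF ne bdd] by blast
    then obtain as l where as: "as \<noteq> []"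
      "\<And>x. l \<le> translation_average as f x" "\<And>x. translation_average as f x \<le> l + d"
      unfolding Osc_def by blast
    define k where "k = translation_average as f"
    have k: "l \<le> k x" "k x \<le> l + d" for x
      using as unfolding k_def by auto
    \<comment> \<open>otherwise the values of \<open>k\<close> would lie in an interval of length \<open>osc / 2\<close>\<close>
    have "\<exists>p. k p \<le> l + d - osc / 2"
    proof (rule ccontr)
      assume "\<not> (\<exists>p. k p \<le> l + d - osc / 2)"
      then have "\<forall>x. l + d - osc / 2 \<le> k x \<and> k x \<le> (l + d - osc / 2) + osc / 2"
        using k(2) by (auto simp: not_le less_imp_le)
      then have "osc / 2 \<in> Osc"
        using as(1) o unfolding Osc_def k_def by (auto intro!: exI[of _ as])
      then show False
        using o_le o by force
    qed
    then obtain p where p: "k p \<le> l + d - osc / 2" by blast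
    have net: "\<bar>k (h + x) - k (a + x)\<bar> \<le> osc / 4" if "\<forall>x. norm (f (h + x) - f (a + x)) \<le> osc / 4" for h a x
    proof -
      have "k (h + x) - k (a + x) = translation_average as (\<lambda>y. f (h + y) - f (a + y)) x - 0"
        unfolding k_def translation_average_def
        by (simp add: sum_list_subtractf algebra_simps add.left_commute)
      also have "norm \<dots> \<le> osc / 4"
        by (rule norm_translation_average_le) (use as that in auto)
      finally show ?thesis by simp
    qed
    have up: "translation_average fs k x \<le> l + (d - \<eta>)" for x
    proof -
      obtain a where a: "a \<in> F" "\<forall>y. norm (f ((p - x) + y) - f (a + y)) \<le> osc / 4"
        using F(3) by blast
      have "k (a + x) \<le> k p + osc / 4"
        using net[OF a(2), of x] by simp argo
      then have "k (a + x) \<le> (l + d) - osc / 4"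
        using p by simp
      then have "(\<Sum>a\<leftarrow>fs. k (a + x)) \<le> real (length fs) * (l + d) - osc / 4"
        using a(1) fs k(2) by (intro sum_list_le_gap) auto
      then have "(\<Sum>a\<leftarrow>fs. k (a + x)) / real (length fs) \<le>
          (real (length fs) * (l + d) - osc / 4) / real (length fs)"
        using N by (intro divide_right_mono) auto
      also have "\<dots> = l + (d - \<eta>)"
        using N unfolding \<eta>_def diff_divide_distrib by simp
      finally show ?thesis
        unfolding translation_average_def by (simp add: divide_inverse_commute)
    qed
    have lo: "l \<le> translation_average fs k x" for x
      by (rule translation_average_ge) (use k N in auto)
    obtain cs where cs: "\<And>f::'a \<Rightarrow> real. \<And>x.
      translation_average fs (translation_average as f) x = translation_average cs f x"
      "fs \<noteq> [] \<Longrightarrow> as \<noteq> [] \<Longrightarrow> cs \<noteq> []"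
      using translation_average_translation_average[of fs as, where 'b = real] by blast
    have "0 \<le> d - \<eta>"
      using lo[of 0] up[of 0] by simp
    moreover have "\<forall>x. l \<le> translation_average cs f x \<and> translation_average cs f x \<le> l + (d - \<eta>)"
      using lo up cs(1)[of f] unfolding k_def by simp
    moreover have "cs \<noteq> []"
      using cs(2) N as(1) by auto
    ultimately have "d - \<eta> \<in> Osc"
      unfolding Osc_def by blast
    then show False
      using o_le d(2) by force
  qed
  then have "Inf Osc < e"
    unfolding osc_def using e by simp
  then obtain d where d: "d \<in> Osc" "d < e"
    using cInf_less_iff[OF ne bdd] by blast
  then obtain as l where as: "as \<noteq> []"
      "\<And>x. l \<le> translation_average as f x" "\<And>x. translation_average as f x \<le> l + d"
    unfolding Osc_def by blast
  have "translation_average as f x \<le> l + e" for x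
    using as(3)[of x] d(2) by linarith
  then show ?thesis
    using as(1,2) by (intro exI[of _ as] exI[of _ l]) simp
qed

text \<open>
  The mean value is the least upper bound of all lower bounds of averages. An average that is almost
  constant pins this number down, since lower bounds of one average cannot exceed upper bounds of
  another one.
\<close>

lemma has_mean_exists_real:
  fixes f :: "'a::ab_group_add \<Rightarrow> real"
  assumes f: "precompact_translates f"
  shows "\<exists>c. has_mean f c"
proof -
  define L where "L = {l. \<exists>as. as \<noteq> [] \<and> (\<forall>x. l \<le> translation_average as f x)}"
  have upper: "l' \<le> u" if as: "as \<noteq> []" "\<And>x. translation_average as f x \<le> u" and l': "l' \<in> L"
    for as u l'
  proof -
    obtain bs where bs: "bs \<noteq> []" "\<And>x. l' \<le> translation_average bs f x"
      using l' unfolding L_def by blast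
    have "l' \<le> translation_average as (translation_average bs f) 0"
      by (rule translation_average_ge) (use as bs in auto)
    also have "\<dots> = translation_average bs (translation_average as f) 0"
      by (rule translation_average_commute)
    also have "\<dots> \<le> u"
      by (rule translation_average_le) (use as bs in auto)
    finally show ?thesis .
  qed
  have "has_mean f (Sup L)"
    unfolding has_mean_def
  proof (intro allI impI)
    fix e :: real assume "0 < e"
    then obtain as l where as: "as \<noteq> []" and bounds:
      "\<forall>x. l \<le> translation_average as f x \<and> translation_average as f x \<le> l + e"
      using precompact_oscillation_shrinks[OF f, of e] by auto
    have lL: "l \<in> L"
      unfolding L_def using as bounds by auto
    have le: "\<And>x. translation_average as f x \<le> l + e"
      using bounds by simp
    have "bdd_above L"
      using upper[OF as le] by (rule bdd_aboveI)
    then have "l \<le> Sup L"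
      using lL by (rule cSup_upper[rotated])
    moreover have "Sup L \<le> l + e"
      using lL upper[OF as le] by (intro cSup_least) auto
    ultimately have "norm (translation_average as f x - Sup L) \<le> e" for x
      using bounds[rule_format, of x] by (simp add: abs_le_iff)
    then show "\<exists>as. as \<noteq> [] \<and> (\<forall>x. norm (translation_average as f x - Sup L) \<le> e)"
      using as by blast
  qed
  then show ?thesis by blast
qed

lemma has_mean_mean:
  fixes f :: "'a::ab_group_add \<Rightarrow> complex"
  assumes f: "precompact_translates f"
  shows "has_mean f (mean f)"
proof -
  obtain r where r: "has_mean (\<lambda>x. Re (f x)) r"
    using has_mean_exists_real precompact_translates_Re[OF f] by blast
  obtain i where i: "has_mean (\<lambda>x. Im (f x)) i"
    using has_mean_exists_real precompact_translates_Im[OF f] by blast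
  have "has_mean (\<lambda>x. complex_of_real (Re (f x))) (complex_of_real r)"
    by (rule has_mean_bounded_linear[OF r]) (rule bounded_linear_of_real)
  moreover have "has_mean (\<lambda>x. \<i> * complex_of_real (Im (f x))) (\<i> * complex_of_real i)"
    by (rule has_mean_bounded_linear[OF i])
      (intro bounded_linear_const_mult bounded_linear_of_real)
  ultimately have "has_mean (\<lambda>x. complex_of_real (Re (f x)) + \<i> * complex_of_real (Im (f x)))
      (complex_of_real r + \<i> * complex_of_real i)"
    by (rule has_mean_add)
  then have "has_mean f (complex_of_real r + \<i> * complex_of_real i)"
    by (simp flip: complex_eq)
  then show ?thesis
    using mean_eqI[of f] by metis
qed

lemma mean_add:
  fixes f g :: "'a::ab_group_add \<Rightarrow> complex"
  assumes "precompact_translates f" "precompact_translates g"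
  shows "mean (\<lambda>x. f x + g x) = mean f + mean g"
  using assms by (intro mean_eqI has_mean_add has_mean_mean)

lemma mean_cmult:
  fixes f :: "'a::ab_group_add \<Rightarrow> complex"
  assumes "precompact_translates f"
  shows "mean (\<lambda>x. c * f x) = c * mean f"
  using assms by (intro mean_eqI has_mean_bounded_linear[of f _ "\<lambda>z. c * z"] has_mean_mean)
    (auto intro: bounded_linear_mult_right)

lemma mean_cnj:
  fixes f :: "'a::ab_group_add \<Rightarrow> complex"
  assumes "precompact_translates f"
  shows "mean (\<lambda>x. cnj (f x)) = cnj (mean f)"
  using assms by (intro mean_eqI has_mean_bounded_linear[of f _ cnj] has_mean_mean)
    (auto intro: bounded_linear_cnj)

lemma mean_diff:
  fixes f g :: "'a::ab_group_add \<Rightarrow> complex"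
  assumes "precompact_translates f" "precompact_translates g"
  shows "mean (\<lambda>x. f x - g x) = mean f - mean g"
  using mean_add[OF assms(1) precompact_translates_cmult[OF assms(2), of "-1"]]
    mean_cmult[OF assms(2), of "-1"] by simp

lemma mean_const: "mean (\<lambda>_. c) = c"
  by (intro mean_eqI has_mean_const)

lemma mean_shift:
  fixes f :: "'a::ab_group_add \<Rightarrow> complex"
  assumes "precompact_translates f"
  shows "mean (\<lambda>x. f (a + x)) = mean f"
  using assms by (intro mean_eqI has_mean_shift has_mean_mean)

lemma mean_reflect:
  fixes f :: "'a::ab_group_add \<Rightarrow> complex"
  assumes "precompact_translates f"
  shows "mean (\<lambda>x. f (- x)) = mean f"
  using assms by (intro mean_eqI has_mean_reflect has_mean_mean)

lemma norm_mean_le: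
  fixes f :: "'a::ab_group_add \<Rightarrow> complex"
  assumes "precompact_translates f" "\<And>x. norm (f x) \<le> B"
  shows "norm (mean f) \<le> B"
  using norm_has_mean_le[OF has_mean_mean[OF assms(1)], of 0 B] assms(2) by simp

lemma has_mean_Re:
  fixes f :: "'a::ab_group_add \<Rightarrow> complex"
  assumes "precompact_translates f"
  shows "has_mean (\<lambda>x. Re (f x)) (Re (mean f))"
  by (rule has_mean_bounded_linear[OF has_mean_mean[OF assms]]) (rule bounded_linear_Re)

lemma Re_mean_mono:
  fixes f g :: "'a::ab_group_add \<Rightarrow> complex"
  assumes "precompact_translates f" "precompact_translates g" "\<And>x. Re (f x) \<le> Re (g x)"
  shows "Re (mean f) \<le> Re (mean g)"
proof -
  have "0 \<le> Re (mean (\<lambda>x. g x - f x))"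
    by (rule has_mean_nonneg[OF has_mean_Re]) (use assms precompact_translates_diff in auto)
  then show ?thesis
    by (simp add: mean_diff assms)
qed

text \<open>
  The mean value is faithful on nonnegative almost periodic functions: over a finite net of
  translates, the average at every point contains a value comparable to the positive value at \<open>p\<close>.
\<close>

lemma Re_mean_pos:
  fixes f :: "'a::ab_group_add \<Rightarrow> complex"
  assumes f: "precompact_translates f" and nonneg: "\<And>x. 0 \<le> Re (f x)" and p: "0 < Re (f p)"
  shows "0 < Re (mean f)"
proof -
  define r where "r = (\<lambda>x. Re (f x))"
  have r: "precompact_translates r" "has_mean r (Re (mean f))"
    unfolding r_def by (intro precompact_translates_Re f) (rule has_mean_Re[OF f])
  obtain F where F: "finite F" "F \<noteq> {}"
      "\<And>h. \<exists>a\<in>F. \<forall>x. norm (r (h + x) - r (a + x)) \<le> r p / 2"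
    using precompact_translates_net[OF r(1), of "r p / 2"] p unfolding r_def by auto
  obtain fs where fs: "set fs = F"
    using finite_list[OF F(1)] by blast
  have N: "fs \<noteq> []"
    using fs F(2) by auto
  have "r p / 2 / real (length fs) \<le> translation_average fs r x" for x
  proof -
    obtain a where a: "a \<in> F" "norm (r ((p - x) + x) - r (a + x)) \<le> r p / 2"
      using F(3) by blast
    then have "r p / 2 \<le> r (a + x)"
      by simp argo
    also have "\<dots> \<le> (\<Sum>a\<leftarrow>fs. r (a + x))"
      using a(1) fs nonneg by (intro member_le_sum_list) (auto simp: r_def)
    finally show ?thesis
      using N by (simp add: translation_average_def field_simps)
  qed
  then have "r p / 2 / real (length fs) \<le> Re (mean f)"
    by (rule has_mean_nonneg[OF has_mean_translation_average[OF r(2) N]])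
  moreover have "0 < r p / 2 / real (length fs)"
    using p N by (simp add: r_def)
  ultimately show ?thesis by linarith
qed

subsection \<open>Iterated means\<close>

lemma precompact_translates_slice:
  fixes F :: "'a::ab_group_add \<times> 'b::ab_group_add \<Rightarrow> complex"
  assumes "precompact_translates F"
  shows "precompact_translates (\<lambda>y. F (x, y))"
  unfolding precompact_translates_def
proof (intro allI impI)
  fix e :: real assume "0 < e"
  then obtain c :: "'a \<times> 'b \<Rightarrow> nat" where c: "finite (range c)"
    "\<And>h k x. c h = c k \<Longrightarrow> norm (F (h + x) - F (k + x)) \<le> e"
    using precompact_translatesE[OF assms] by blast
  have "finite (range (\<lambda>y. c (0, y)))"
    using c(1) by (rule finite_subset[rotated]) auto
  moreover have "norm (F (x, h + y) - F (x, k + y)) \<le> e" if "c (0, h) = c (0, k)" for h k y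
    using c(2)[OF that, of "(x, y)"] by simp
  ultimately show "\<exists>c::'b \<Rightarrow> nat. finite (range c) \<and>
       (\<forall>h k. c h = c k \<longrightarrow> (\<forall>y. norm (F (x, h + y) - F (x, k + y)) \<le> e))"
    by (intro exI[of _ "\<lambda>y. c (0, y)"]) simp
qed

lemma precompact_translates_mean_slice:
  fixes F :: "'a::ab_group_add \<times> 'b::ab_group_add \<Rightarrow> complex"
  assumes F: "precompact_translates F"
  shows "precompact_translates (\<lambda>x. mean (\<lambda>y. F (x, y)))"
  unfolding precompact_translates_def
proof (intro allI impI)
  fix e :: real assume "0 < e"
  then obtain c :: "'a \<times> 'b \<Rightarrow> nat" where c: "finite (range c)"
    "\<And>h k x. c h = c k \<Longrightarrow> norm (F (h + x) - F (k + x)) \<le> e"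
    using precompact_translatesE[OF assms] by blast
  have "finite (range (\<lambda>x. c (x, 0)))"
    using c(1) by (rule finite_subset[rotated]) auto
  moreover have "norm (mean (\<lambda>y. F (h + x, y)) - mean (\<lambda>y. F (k + x, y))) \<le> e"
    if "c (h, 0) = c (k, 0)" for h k x
  proof -
    have "norm (mean (\<lambda>y. F (h + x, y) - F (k + x, y))) \<le> e"
      using c(2)[OF that, of "(x, _)"]
      by (intro norm_mean_le precompact_translates_diff precompact_translates_slice F) simp
    then show ?thesis
      by (simp add: mean_diff precompact_translates_slice F)
  qed
  ultimately show "\<exists>c::'a \<Rightarrow> nat. finite (range c) \<and>
       (\<forall>h k. c h = c k \<longrightarrow> (\<forall>x. norm (mean (\<lambda>y. F (h + x, y)) - mean (\<lambda>y. F (k + x, y))) \<le> e))"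
    by (intro exI[of _ "\<lambda>x. c (x, 0)"]) simp
qed

text \<open>
  Averaging a function on the product group over a list of pairs and then taking the mean in the
  second variable leaves an average of the partial mean over the first components of the pairs.
\<close>

lemma mean_mean_slice:
  fixes F :: "'a::ab_group_add \<times> 'b::ab_group_add \<Rightarrow> complex"
  assumes F: "precompact_translates F"
  shows "mean (\<lambda>x. mean (\<lambda>y. F (x, y))) = mean F"
proof (rule mean_eqI, unfold has_mean_def, intro allI impI)
  fix e :: real assume "0 < e"
  then obtain zs where zs: "zs \<noteq> []" "\<And>z. norm (translation_average zs F z - mean F) \<le> e"
    using has_mean_mean[OF F] unfolding has_mean_def by blast
  define F1 where "F1 = (\<lambda>x. mean (\<lambda>y. F (x, y)))"
  have "norm (translation_average (map fst zs) F1 x - mean F) \<le> e" for x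
  proof -
    have "has_mean (\<lambda>y. F (fst z + x, snd z + y)) (F1 (fst z + x))" for z
      unfolding F1_def by (intro has_mean_shift has_mean_mean precompact_translates_slice F)
    then have "has_mean (\<lambda>y. \<Sum>z\<leftarrow>zs. F (fst z + x, snd z + y)) (\<Sum>z\<leftarrow>zs. F1 (fst z + x))"
      by (rule has_mean_sum_list)
    then have "has_mean (\<lambda>y. (\<Sum>z\<leftarrow>zs. F (fst z + x, snd z + y)) /\<^sub>R real (length zs))
        ((\<Sum>z\<leftarrow>zs. F1 (fst z + x)) /\<^sub>R real (length zs))"
      by (rule has_mean_bounded_linear) (rule bounded_linear_scaleR_right)
    moreover have "(\<lambda>y. (\<Sum>z\<leftarrow>zs. F (fst z + x, snd z + y)) /\<^sub>R real (length zs)) =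
        (\<lambda>y. translation_average zs F (x, y))"
      by (simp add: translation_average_def plus_prod_def)
    moreover have "(\<Sum>z\<leftarrow>zs. F1 (fst z + x)) /\<^sub>R real (length zs) =
        translation_average (map fst zs) F1 x"
      by (simp add: translation_average_def o_def)
    ultimately have "has_mean (\<lambda>y. translation_average zs F (x, y))
        (translation_average (map fst zs) F1 x)"
      by simp
    then show ?thesis
      by (rule norm_has_mean_le) (rule zs(2))
  qed
  then show "\<exists>as. as \<noteq> [] \<and> (\<forall>x. norm (translation_average as (\<lambda>x. mean (\<lambda>y. F (x, y))) x
      - mean F) \<le> e)"
    using zs(1) unfolding F1_def by (intro exI[of _ "map fst zs"]) simp
qed

lemma mean_mean_swap:
  fixes F :: "'a::ab_group_add \<Rightarrow> 'b::ab_group_add \<Rightarrow> complex"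
  assumes F: "precompact_translates (\<lambda>z. F (fst z) (snd z))"
  shows "mean (\<lambda>x. mean (\<lambda>y. F x y)) = mean (\<lambda>y. mean (\<lambda>x. F x y))"
proof -
  define F' where "F' = (\<lambda>z. F (snd z) (fst z))"
  have F': "precompact_translates F'"
    unfolding F'_def
    using precompact_translates_hom[OF F, of prod.swap] by (simp add: plus_prod_def)
  have "has_mean F' (mean (\<lambda>z. F (fst z) (snd z)))"
    unfolding has_mean_def
  proof (intro allI impI)
    fix e :: real assume "0 < e"
    then obtain zs where zs: "zs \<noteq> []"
      "\<And>z. norm (translation_average zs (\<lambda>z. F (fst z) (snd z)) z
          - mean (\<lambda>z. F (fst z) (snd z))) \<le> e"
      using has_mean_mean[OF F] unfolding has_mean_def by blast
    have "translation_average (map prod.swap zs) F' z =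
        translation_average zs (\<lambda>z. F (fst z) (snd z)) (prod.swap z)" for z
      by (simp add: translation_average_def F'_def o_def)
    then show "\<exists>as. as \<noteq> [] \<and> (\<forall>z. norm (translation_average as F' z
        - mean (\<lambda>z. F (fst z) (snd z))) \<le> e)"
      using zs by (intro exI[of _ "map prod.swap zs"]) simp
  qed
  then have "mean F' = mean (\<lambda>z. F (fst z) (snd z))"
    by (rule mean_eqI)
  then show ?thesis
    using mean_mean_slice[OF F] mean_mean_slice[OF F'] unfolding F'_def by simp
qed

section \<open>The mean inner product and convolution operators\<close>

lemmas precompact_translates_intros =
  precompact_translates_add precompact_translates_mult precompact_translates_cnj
  precompact_translates_diff precompact_translates_const precompact_translates_shift

definition mean_inner :: "('a::ab_group_add \<Rightarrow> complex) \<Rightarrow> ('a \<Rightarrow> complex) \<Rightarrow> complex" where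
  "mean_inner u v = mean (\<lambda>x. u x * cnj (v x))"

definition mean_sq :: "('a::ab_group_add \<Rightarrow> complex) \<Rightarrow> real" where
  "mean_sq u = Re (mean_inner u u)"

lemma mean_inner_commute:
  assumes "precompact_translates u" "precompact_translates v"
  shows "mean_inner v u = cnj (mean_inner u v)"
  unfolding mean_inner_def
  by (subst mean_cnj[symmetric]) (auto intro!: precompact_translates_intros assms simp: mult.commute)

lemma mean_inner_self:
  assumes "precompact_translates u"
  shows "mean_inner u u = complex_of_real (mean_sq u)"
  using mean_inner_commute[OF assms assms] unfolding mean_sq_def
  by (simp add: complex_eq_iff)

lemma mean_sq_nonneg:
  assumes "precompact_translates u"
  shows "0 \<le> mean_sq u"
  unfolding mean_sq_def mean_inner_def
  by (rule has_mean_nonneg[OF has_mean_Re]) (auto intro!: precompact_translates_intros assms)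

lemma mean_sq_le:
  fixes u :: "'a::ab_group_add \<Rightarrow> complex"
  assumes "precompact_translates u" "\<And>x. (cmod (u x))\<^sup>2 \<le> B"
  shows "mean_sq u \<le> B"
proof -
  have "Re (mean (\<lambda>x. u x * cnj (u x))) \<le> Re (mean (\<lambda>_::'a. complex_of_real B))"
    using assms(2)
    by (intro Re_mean_mono precompact_translates_intros assms(1))
      (simp add: complex_mult_cnj cmod_power2)
  then show ?thesis
    by (simp add: mean_sq_def mean_inner_def mean_const)
qed

lemma mean_sq_pos:
  assumes "precompact_translates u" "u p \<noteq> 0"
  shows "0 < mean_sq u"
  unfolding mean_sq_def mean_inner_def
  by (rule Re_mean_pos[where p = p])
    (use assms in \<open>auto intro!: precompact_translates_intros simp: complex_neq_0 power2_eq_square\<close>)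

lemma mean_sq_lincomb:
  assumes u: "precompact_translates u" and v: "precompact_translates v"
  shows "mean_sq (\<lambda>x. \<alpha> * u x + \<beta> * v x) =
    (cmod \<alpha>)\<^sup>2 * mean_sq u + 2 * Re (\<alpha> * cnj \<beta> * mean_inner u v) + (cmod \<beta>)\<^sup>2 * mean_sq v"
proof -
  have "mean_inner (\<lambda>x. \<alpha> * u x + \<beta> * v x) (\<lambda>x. \<alpha> * u x + \<beta> * v x) =
      mean (\<lambda>x. ((\<alpha> * cnj \<alpha>) * (u x * cnj (u x)) + (\<alpha> * cnj \<beta>) * (u x * cnj (v x))) +
        ((\<beta> * cnj \<alpha>) * (v x * cnj (u x)) + (\<beta> * cnj \<beta>) * (v x * cnj (v x))))"
    unfolding mean_inner_def by (rule arg_cong[of _ _ mean]) (simp add: fun_eq_iff algebra_simps)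
  also have "\<dots> = ((\<alpha> * cnj \<alpha>) * mean_inner u u + (\<alpha> * cnj \<beta>) * mean_inner u v) +
        ((\<beta> * cnj \<alpha>) * mean_inner v u + (\<beta> * cnj \<beta>) * mean_inner v v)"
    unfolding mean_inner_def
    by (simp add: mean_add mean_cmult precompact_translates_intros u v)
  finally show ?thesis
    unfolding mean_sq_def[of "\<lambda>x. \<alpha> * u x + \<beta> * v x"]
    by (simp add: mean_inner_commute[OF u v] mean_inner_self u v complex_mult_cnj cmod_power2
        complex_eq_iff) (simp add: algebra_simps)
qed

text \<open>
  The form \<open>mean_inner\<close> is only used on almost periodic functions, which do not form a type; hence
  the classical discriminant argument is repeated here.
\<close>

lemma mean_Cauchy_Schwarz:
  assumes u: "precompact_translates u" and v: "precompact_translates v"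
  shows "(cmod (mean_inner u v))\<^sup>2 \<le> mean_sq u * mean_sq v"
proof -
  define A where "A = (cmod (mean_inner u v))\<^sup>2"
  have quad: "0 \<le> mean_sq u - 2 * t * A + t\<^sup>2 * A * mean_sq v" for t :: real
  proof -
    let ?c = "- complex_of_real t * mean_inner u v"
    have "0 \<le> mean_sq (\<lambda>x. 1 * u x + ?c * v x)"
      by (intro mean_sq_nonneg precompact_translates_intros u v)
    also have "\<dots> = mean_sq u - 2 * t * A + t\<^sup>2 * A * mean_sq v"
      unfolding mean_sq_lincomb[OF u v]
      by (simp add: A_def norm_mult power_mult_distrib cmod_power2)
        (simp add: algebra_simps power2_eq_square)
    finally show ?thesis .
  qed
  have "A \<ge> 0" unfolding A_def by simp
  show ?thesis
  proof (cases "mean_sq v = 0")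
    case True
    have "A = 0"
    proof (rule ccontr)
      assume "A \<noteq> 0"
      then show False
        using quad[of "(mean_sq u + 1) / (2 * A)"] True by simp
    qed
    then show ?thesis
      using True by (simp add: A_def)
  next
    case False
    then have pos: "0 < mean_sq v"
      using mean_sq_nonneg[OF v] by simp
    have "0 \<le> mean_sq u - A / mean_sq v"
      using quad[of "1 / mean_sq v"] False by (simp add: power2_eq_square)
    then show ?thesis
      using pos by (simp add: A_def field_simps)
  qed
qed

lemma mean_sq_cmult:
  assumes "precompact_translates u"
  shows "mean_sq (\<lambda>x. c * u x) = (cmod c)\<^sup>2 * mean_sq u"
  using mean_sq_lincomb[OF assms assms, of c 0] by simp

lemma mean_sq_cnj:
  assumes "precompact_translates u"
  shows "mean_sq (\<lambda>x. cnj (u x)) = mean_sq u"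
  unfolding mean_sq_def mean_inner_def by (simp add: mult.commute)

definition convolution :: "('a::ab_group_add \<Rightarrow> complex) \<Rightarrow> ('a \<Rightarrow> complex) \<Rightarrow> 'a \<Rightarrow> complex" where
  "convolution k u x = mean (\<lambda>y. k (x - y) * u y)"

lemma precompact_translates_difference_kernel:
  assumes "precompact_translates k"
  shows "precompact_translates (\<lambda>y. k (x - y))"
  using precompact_translates_reflect[OF precompact_translates_shift[OF assms, of x]] by simp

lemma mean_sq_difference_kernel:
  assumes "precompact_translates k"
  shows "mean_sq (\<lambda>y. k (x - y)) = mean_sq k"
proof -
  have "precompact_translates (\<lambda>y. k y * cnj (k y))"
    by (intro precompact_translates_intros assms)
  from mean_reflect[OF precompact_translates_shift[OF this, of x]] mean_shift[OF this, of x]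
  show ?thesis
    unfolding mean_sq_def mean_inner_def by simp
qed

lemma mean_mult_le:
  assumes "precompact_translates u" "precompact_translates v"
  shows "(cmod (mean (\<lambda>y. u y * v y)))\<^sup>2 \<le> mean_sq u * mean_sq v"
  using mean_Cauchy_Schwarz[OF assms(1) precompact_translates_cnj[OF assms(2)]] assms(2)
  by (simp add: mean_inner_def mean_sq_cnj)

lemma convolution_le:
  assumes "precompact_translates k" "precompact_translates u"
  shows "(cmod (convolution k u x))\<^sup>2 \<le> mean_sq k * mean_sq u"
  using mean_mult_le[OF precompact_translates_difference_kernel[OF assms(1)] assms(2)]
  by (simp add: convolution_def mean_sq_difference_kernel assms)

text \<open>
  Convolutions with unit vectors inherit the modulus of continuity of the kernel. This
  equicontinuity is what makes the convolution operator compact.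
\<close>

lemma convolution_lipschitz:
  assumes k: "precompact_translates k" and u: "precompact_translates u"
    and d: "0 \<le> d" "\<And>z. cmod (k (h + z) - k (h' + z)) \<le> d"
  shows "cmod (convolution k u h - convolution k u h') \<le> d * sqrt (mean_sq u)"
proof -
  define w where "w = (\<lambda>y. k (h - y) - k (h' - y))"
  have w: "precompact_translates w"
    unfolding w_def by (intro precompact_translates_intros precompact_translates_difference_kernel k)
  have "convolution k u h - convolution k u h' = mean (\<lambda>y. w y * u y)"
    unfolding convolution_def w_def
    by (subst mean_diff[symmetric])
      (auto intro!: precompact_translates_intros precompact_translates_difference_kernel k u
        simp: algebra_simps)
  then have "(cmod (convolution k u h - convolution k u h'))\<^sup>2 \<le> mean_sq w * mean_sq u"
    using mean_mult_le[OF w u] by simp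
  also have "\<dots> \<le> d\<^sup>2 * mean_sq u"
  proof (intro mult_right_mono mean_sq_le w mean_sq_nonneg u power_mono)
    show "cmod (w x) \<le> d" for x
      using d(2)[of "- x"] by (simp add: w_def)
  qed simp
  also have "\<dots> = (d * sqrt (mean_sq u))\<^sup>2"
    using mean_sq_nonneg[OF u] by (simp add: power_mult_distrib)
  finally show ?thesis
    by (rule power2_le_imp_le) (use d mean_sq_nonneg[OF u] in auto)
qed

lemma precompact_translates_convolution:
  assumes k: "precompact_translates k" and u: "precompact_translates u"
  shows "precompact_translates (convolution k u)"
proof (rule precompact_translates_dominated[OF k])
  fix e :: real assume e: "0 < e"
  define d where "d = e / (sqrt (mean_sq u) + 1)"
  have s: "0 \<le> sqrt (mean_sq u)"
    using mean_sq_nonneg[OF u] by simp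
  have d: "0 < d" "d * sqrt (mean_sq u) \<le> e"
  proof -
    show "0 < d"
      unfolding d_def using e s by (intro divide_pos_pos) linarith+
    have "e * sqrt (mean_sq u) \<le> e * (sqrt (mean_sq u) + 1)"
      using e by (intro mult_left_mono) auto
    then show "d * sqrt (mean_sq u) \<le> e"
      unfolding d_def using s by (simp add: pos_divide_le_eq add_nonneg_pos)
  qed
  have "norm (convolution k u (h + x) - convolution k u (h' + x)) \<le> e"
    if "\<forall>x. norm (k (h + x) - k (h' + x)) \<le> d" for h h' x
    using convolution_lipschitz[OF k u, of d "h + x" "h' + x"] that d
    by (simp add: add.assoc)
  then show "\<exists>d>0. \<forall>h h'. (\<forall>x. norm (k (h + x) - k (h' + x)) \<le> d) \<longrightarrow>
      (\<forall>x. norm (convolution k u (h + x) - convolution k u (h' + x)) \<le> e)"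
    using d(1) by blast
qed

lemma convolution_lincomb:
  assumes k: "precompact_translates k" and u: "precompact_translates u"
    and v: "precompact_translates v"
  shows "convolution k (\<lambda>x. \<alpha> * u x + \<beta> * v x) = (\<lambda>x. \<alpha> * convolution k u x + \<beta> * convolution k v x)"
proof
  fix x
  have "convolution k (\<lambda>x. \<alpha> * u x + \<beta> * v x) x =
      mean (\<lambda>y. \<alpha> * (k (x - y) * u y) + \<beta> * (k (x - y) * v y))"
    unfolding convolution_def by (rule arg_cong[of _ _ mean]) (simp add: fun_eq_iff algebra_simps)
  also have "\<dots> = \<alpha> * convolution k u x + \<beta> * convolution k v x"
    unfolding convolution_def
    by (simp add: mean_add mean_cmult precompact_translates_intros
        precompact_translates_difference_kernel k u v)
  finally show "convolution k (\<lambda>x. \<alpha> * u x + \<beta> * v x) x =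
      \<alpha> * convolution k u x + \<beta> * convolution k v x" .
qed

lemma convolution_shift:
  assumes k: "precompact_translates k" and u: "precompact_translates u"
  shows "convolution k (\<lambda>x. u (a + x)) x = convolution k u (a + x)"
proof -
  have "precompact_translates (\<lambda>y. k (a + x - y) * u y)"
    by (intro precompact_translates_intros precompact_translates_difference_kernel k u)
  from mean_shift[OF this, of a] show ?thesis
    by (simp add: convolution_def)
qed

lemma precompact_translates_pair:
  fixes k u v :: "'a::ab_group_add \<Rightarrow> complex"
  assumes k: "precompact_translates k"
  shows "precompact_translates (\<lambda>z::'a \<times> 'a. k (fst z - snd z))"
    "precompact_translates (\<lambda>z::'a \<times> 'a. k (fst z + snd z))"
    "precompact_translates (\<lambda>z::'a \<times> 'a. k (fst z))"
    "precompact_translates (\<lambda>z::'a \<times> 'a. k (snd z))"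
  by (rule precompact_translates_hom[OF k]; simp add: algebra_simps)+

lemma convolution_selfadjoint:
  assumes k: "precompact_translates k" and u: "precompact_translates u"
    and v: "precompact_translates v" and herm: "\<And>x. k (- x) = cnj (k x)"
  shows "mean_inner (convolution k u) v = mean_inner u (convolution k v)"
proof -
  have "mean_inner (convolution k u) v = mean (\<lambda>x. mean (\<lambda>y. cnj (v x) * (k (x - y) * u y)))"
    unfolding mean_inner_def convolution_def
    by (simp add: mean_cmult precompact_translates_intros
        precompact_translates_difference_kernel k u mult.commute)
  also have "\<dots> = mean (\<lambda>y. mean (\<lambda>x. cnj (v x) * (k (x - y) * u y)))"
    by (rule mean_mean_swap) (intro precompact_translates_intros precompact_translates_pair k u
        precompact_translates_pair(3)[OF precompact_translates_cnj[OF v]])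
  also have "\<dots> = mean (\<lambda>y. u y * cnj (convolution k v y))"
  proof (rule arg_cong[of _ _ mean], rule ext)
    fix y
    have "k (x - y) = cnj (k (y - x))" for x
      using herm[of "y - x"] by simp
    then have "mean (\<lambda>x. cnj (v x) * (k (x - y) * u y)) = mean (\<lambda>x. u y * cnj (k (y - x) * v x))"
      by (simp add: mult_ac)
    also have "\<dots> = u y * cnj (convolution k v y)"
      unfolding convolution_def
      by (subst mean_cmult, intro precompact_translates_intros precompact_translates_difference_kernel k v)
        (subst mean_cnj, auto intro!: precompact_translates_intros precompact_translates_difference_kernel k v)
    finally show "mean (\<lambda>x. cnj (v x) * (k (x - y) * u y)) = u y * cnj (convolution k v y)" .
  qed
  finally show ?thesis
    unfolding mean_inner_def .
qed

subsection \<open>Uniform limits\<close>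

lemma mean_uniform_limit:
  fixes F :: "nat \<Rightarrow> 'a::ab_group_add \<times> 'b::ab_group_add \<Rightarrow> complex"
  assumes F: "\<And>n. precompact_translates (F n)" and G: "precompact_translates G"
    and lim: "uniform_limit UNIV F G sequentially"
  shows "uniform_limit UNIV (\<lambda>n x. mean (\<lambda>y. F n (x, y)))
    (\<lambda>x. mean (\<lambda>y. G (x, y))) sequentially"
proof (rule uniform_limitI)
  fix e :: real assume "0 < e"
  then have "\<forall>\<^sub>F n in sequentially. \<forall>z\<in>UNIV. dist (F n z) (G z) < e / 2"
    using uniform_limitD[OF lim, of "e/2"] by simp
  then show "\<forall>\<^sub>F n in sequentially. \<forall>x\<in>UNIV. dist (mean (\<lambda>y. F n (x, y))) (mean (\<lambda>y. G (x, y))) < e"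
  proof eventually_elim
    case (elim n)
    have "norm (mean (\<lambda>y. F n (x, y) - G (x, y))) \<le> e / 2" for x
    proof (rule norm_mean_le)
      show "norm (F n (x, y) - G (x, y)) \<le> e / 2" for y
        using elim by (simp add: dist_norm less_imp_le)
    qed (intro precompact_translates_diff precompact_translates_slice F G)
    then have "dist (mean (\<lambda>y. F n (x, y))) (mean (\<lambda>y. G (x, y))) \<le> e / 2" for x
      by (simp add: mean_diff precompact_translates_slice F G dist_norm)
    moreover have "e / 2 < e"
      using \<open>0 < e\<close> by simp
    ultimately show ?case
      using le_less_trans by blast
  qed
qed

lemma uniform_limit_precompact_mult:
  assumes "uniform_limit UNIV f g sequentially" "precompact_translates g"
    and "uniform_limit UNIV f' g' sequentially" "precompact_translates g'"
  shows "uniform_limit UNIV (\<lambda>n x. f n x * f' n x :: complex) (\<lambda>x. g x * g' x) sequentially"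
proof (rule uniform_lim_mult[OF assms(1,3)])
  show "bounded (g ` UNIV)" "bounded (g' ` UNIV)"
    using precompact_translates_bounded[OF assms(2)] precompact_translates_bounded[OF assms(4)]
    unfolding bounded_iff by (metis rangeE)+
qed

lemma uniform_limit_hom:
  assumes "uniform_limit UNIV f g sequentially"
  shows "uniform_limit UNIV (\<lambda>n x. f n (\<phi> x)) (\<lambda>x. g (\<phi> x)) sequentially"
  by (rule uniform_limit_compose'[OF assms]) auto

lemma convolution_uniform_limit:
  fixes k :: "'a::ab_group_add \<Rightarrow> complex"
  assumes k: "precompact_translates k" and f: "\<And>n. precompact_translates (f n)"
    and g: "precompact_translates g" and lim: "uniform_limit UNIV f g sequentially"
  shows "uniform_limit UNIV (\<lambda>n. convolution k (f n)) (convolution k g) sequentially"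
proof -
  have "uniform_limit UNIV (\<lambda>n x. mean (\<lambda>y. (\<lambda>z. k (fst z - snd z) * f n (snd z)) (x, y)))
      (\<lambda>x. mean (\<lambda>y. (\<lambda>z. k (fst z - snd z) * g (snd z)) (x, y))) sequentially"
    by (intro mean_uniform_limit precompact_translates_intros precompact_translates_pair k f g
        uniform_limit_precompact_mult uniform_limit_hom[OF lim] uniform_limit_const)
  then show ?thesis
    by (simp add: convolution_def[abs_def])
qed

definition autocorrelation :: "('a::ab_group_add \<Rightarrow> complex) \<Rightarrow> 'a \<Rightarrow> complex" where
  "autocorrelation w x = mean (\<lambda>y. w (x + y) * cnj (w y))"

lemma precompact_translates_autocorrelation:
  assumes w: "precompact_translates w"
  shows "precompact_translates (autocorrelation w)"
proof -
  have "precompact_translates (\<lambda>x. mean (\<lambda>y. (\<lambda>z. w (fst z + snd z) * cnj (w (snd z))) (x, y)))"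
    by (intro precompact_translates_mean_slice precompact_translates_intros
        precompact_translates_pair w)
  then show ?thesis
    by (simp add: autocorrelation_def[abs_def])
qed

lemma autocorrelation_uniform_limit:
  fixes f :: "nat \<Rightarrow> 'a::ab_group_add \<Rightarrow> complex"
  assumes f: "\<And>n. precompact_translates (f n)"
    and g: "precompact_translates g" and lim: "uniform_limit UNIV f g sequentially"
  shows "uniform_limit UNIV (\<lambda>n. autocorrelation (f n)) (autocorrelation g) sequentially"
proof -
  have "uniform_limit UNIV (\<lambda>n x. mean (\<lambda>y. (\<lambda>z. f n (fst z + snd z) * cnj (f n (snd z))) (x, y)))
      (\<lambda>x. mean (\<lambda>y. (\<lambda>z. g (fst z + snd z) * cnj (g (snd z))) (x, y))) sequentially"
    by (intro mean_uniform_limit precompact_translates_intros precompact_translates_pair f g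
        uniform_limit_precompact_mult uniform_limit_hom[OF lim]
        bounded_linear.uniform_limit[OF bounded_linear_cnj])
  then show ?thesis
    by (simp add: autocorrelation_def[abs_def])
qed

lemma autocorrelation_zero:
  assumes "precompact_translates w"
  shows "autocorrelation w 0 = complex_of_real (mean_sq w)"
  using mean_inner_self[OF assms] by (simp add: autocorrelation_def mean_inner_def)

lemma mean_sq_tendsto:
  fixes f :: "nat \<Rightarrow> 'a::ab_group_add \<Rightarrow> complex"
  assumes f: "\<And>n. precompact_translates (f n)"
    and g: "precompact_translates g" and lim: "uniform_limit UNIV f g sequentially"
  shows "(\<lambda>n. mean_sq (f n)) \<longlonglongrightarrow> mean_sq g"
proof -
  have "(\<lambda>n. autocorrelation (f n) 0) \<longlonglongrightarrow> autocorrelation g 0"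
    by (rule tendsto_uniform_limitI[OF autocorrelation_uniform_limit[OF f g lim]]) simp
  then have "(\<lambda>n. complex_of_real (mean_sq (f n))) \<longlonglongrightarrow> complex_of_real (mean_sq g)"
    by (simp add: autocorrelation_zero f g)
  then show ?thesis
    by (simp add: tendsto_of_real_iff)
qed

lemma autocorrelation_minus:
  assumes w: "precompact_translates w"
  shows "autocorrelation w (- a) = cnj (autocorrelation w a)"
proof -
  have "precompact_translates (\<lambda>y. w (- a + y) * cnj (w y))"
    by (intro precompact_translates_intros w)
  from mean_shift[OF this, of a]
  have "autocorrelation w (- a) = mean (\<lambda>y. cnj (w (a + y) * cnj (w y)))"
    by (simp add: autocorrelation_def mult.commute)
  also have "\<dots> = cnj (autocorrelation w a)"
    unfolding autocorrelation_def by (intro mean_cnj precompact_translates_intros w)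
  finally show ?thesis .
qed

lemma autocorrelation_le:
  assumes w: "precompact_translates w"
  shows "(cmod (autocorrelation w x))\<^sup>2 \<le> (mean_sq w)\<^sup>2"
proof -
  have "precompact_translates (\<lambda>y. w y * cnj (w y))"
    by (intro precompact_translates_intros w)
  from mean_shift[OF this, of x] have "mean_sq (\<lambda>y. w (x + y)) = mean_sq w"
    by (simp add: mean_sq_def mean_inner_def)
  then show ?thesis
    using mean_Cauchy_Schwarz[OF precompact_translates_shift[OF w, of x] w]
    by (simp add: autocorrelation_def mean_inner_def power2_eq_square)
qed

text \<open>
  The translates of \<open>k\<close> define a totally bounded pseudometric on the group. Functions that are uniformly
  bounded and uniformly Lipschitz for it form a relatively compact set in the supremum norm: a
  diagonal sequence converges on a countable dense set, and by equicontinuity uniformly.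
\<close>

lemma Arzela_Ascoli_precompact:
  fixes k :: "'a::ab_group_add \<Rightarrow> complex" and v :: "nat \<Rightarrow> 'a \<Rightarrow> complex"
  assumes k: "precompact_translates k" and B: "\<And>n x. cmod (v n x) \<le> B"
    and equi: "\<And>n h h' d. 0 \<le> d \<Longrightarrow> (\<And>z. cmod (k (h + z) - k (h' + z)) \<le> d) \<Longrightarrow>
      cmod (v n h - v n h') \<le> d * C"
    and C: "0 \<le> C"
  shows "\<exists>r g. strict_mono (r :: nat \<Rightarrow> nat) \<and> uniform_limit UNIV (\<lambda>n. v (r n)) g sequentially"
proof -
  have "\<exists>F. finite F \<and> (\<forall>h. \<exists>a\<in>F. \<forall>x. norm (k (h + x) - k (a + x)) \<le> 1 / real (Suc m))" for m
  proof -
    have "0 < 1 / real (Suc m)" by simp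
    from precompact_translates_net[OF k this] show ?thesis by metis
  qed
  then obtain F where F: "\<And>m. finite (F m)"
    "\<And>m h. \<exists>a\<in>F m. \<forall>x. norm (k (h + x) - k (a + x)) \<le> 1 / real (Suc m)"
    by metis
  have "countable (\<Union>m. F m)"
    using F(1) by (simp add: countable_finite)
  then obtain r where r: "strict_mono r" "\<And>x. x \<in> (\<Union>m. F m) \<Longrightarrow> \<exists>l. (\<lambda>n. v (r n) x) \<longlonglongrightarrow> l"
    using function_convergent_subsequence[of "\<Union>m. F m" v B] B by blast
  have "\<exists>N. \<forall>m n x. N \<le> m \<and> N \<le> n \<and> True \<longrightarrow> dist (v (r m) x) (v (r n) x) < e" if e: "0 < e" for e
  proof -
    obtain j where "4 * C / e < real (Suc j)"
      by (meson lessI less_trans of_nat_less_iff reals_Archimedean2)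
    then have j: "1 / real (Suc j) * C \<le> e / 4"
      using e by (simp add: field_simps)
    have "\<exists>N. \<forall>m\<ge>N. \<forall>n\<ge>N. dist (v (r m) a) (v (r n) a) < e / 4" if a: "a \<in> F j" for a
    proof -
      have "Cauchy (\<lambda>n. v (r n) a)"
        using r(2)[of a] a by (blast intro: LIMSEQ_imp_Cauchy)
      then show ?thesis
        using e unfolding Cauchy_def by (meson zero_less_divide_iff zero_less_numeral)
    qed
    then obtain N where N: "\<And>a m n. a \<in> F j \<Longrightarrow> m \<ge> N a \<Longrightarrow> n \<ge> N a \<Longrightarrow>
        dist (v (r m) a) (v (r n) a) < e / 4"
      by metis
    define M where "M = Max (insert 0 (N ` F j))"
    have M: "N a \<le> M" if "a \<in> F j" for a
      unfolding M_def using F(1) that by simp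
    have "dist (v (r m) x) (v (r n) x) < e" if mn: "M \<le> m" "M \<le> n" for m n x
    proof -
      obtain a where a: "a \<in> F j" "\<And>z. norm (k (x + z) - k (a + z)) \<le> 1 / real (Suc j)"
        using F(2) by blast
      have near: "dist (v i x) (v i a) \<le> e / 4" for i
        using order_trans[OF equi[OF _ a(2), of i] j] by (simp add: dist_norm)
      have "dist (v (r m) a) (v (r n) a) < e / 4"
        using N[OF a(1)] M[OF a(1)] mn by (meson order_trans)
      then show ?thesis
        using near[of "r m"] near[of "r n"] e
          dist_triangle[of "v (r m) x" "v (r n) x" "v (r m) a"]
          dist_triangle[of "v (r m) a" "v (r n) x" "v (r n) a"]
        by (simp add: dist_commute)
    qed
    then show ?thesis by blast
  qed
  then obtain g where g: "\<forall>e>0. \<exists>N. \<forall>n x. N \<le> n \<and> True \<longrightarrow> dist (v (r n) x) (g x) < e"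
    using uniformly_convergent_eq_cauchy[of "\<lambda>_. True" "\<lambda>n. v (r n)"] by blast
  then have "uniform_limit UNIV (\<lambda>n. v (r n)) g sequentially"
    unfolding uniform_limit_sequentially_iff by simp
  then show ?thesis
    using r(1) by blast
qed

lemma precompact_translates_uniform_limit':
  assumes "\<And>n. precompact_translates (f n)" "uniform_limit UNIV f g sequentially"
  shows "precompact_translates g"
proof (rule precompact_translates_uniform_limit[OF assms(1)])
  fix e :: real assume "0 < e"
  then obtain N where "\<forall>n\<ge>N. \<forall>x\<in>UNIV. dist (f n x) (g x) < e"
    using assms(2) unfolding uniform_limit_sequentially_iff by blast
  then show "\<exists>n. \<forall>x. norm (f n x - g x) \<le> e"
    by (auto simp: dist_norm intro!: exI[of _ N] less_imp_le)
qed

section \<open>Characters detect almost periodic functions\<close>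

definition unimodular_hom :: "('a::ab_group_add \<Rightarrow> complex) \<Rightarrow> bool" where
  "unimodular_hom \<xi> \<longleftrightarrow> (\<forall>x. cmod (\<xi> x) = 1) \<and> (\<forall>x y. \<xi> (x + y) = \<xi> x * \<xi> y)"

lemma unimodular_hom_mult_cnj:
  assumes "unimodular_hom \<xi>"
  shows "\<xi> x * cnj (\<xi> x) = 1" "cnj (\<xi> x) * \<xi> x = 1"
  using assms unfolding unimodular_hom_def
  by (simp_all add: complex_norm_square[symmetric] mult.commute[of "cnj (\<xi> x)"])

lemma unimodular_hom_minus:
  assumes "unimodular_hom \<xi>"
  shows "\<xi> (- x) = cnj (\<xi> x)"
proof -
  have "\<xi> (- x) * \<xi> x = \<xi> 0" "\<xi> 0 * \<xi> 0 = \<xi> 0"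
    using assms unfolding unimodular_hom_def by (metis add.left_inverse, metis add.left_neutral)
  moreover have "\<xi> 0 \<noteq> 0"
    using assms unfolding unimodular_hom_def by (metis norm_zero zero_neq_one)
  ultimately have "\<xi> (- x) * \<xi> x = 1" by simp
  then show ?thesis
    using unimodular_hom_mult_cnj(1)[OF assms, of x]
    by (metis mult.assoc mult.left_neutral mult.right_neutral)
qed

lemma precompact_translates_unimodular_hom:
  fixes \<xi> :: "'a::ab_group_add \<Rightarrow> complex"
  assumes \<xi>: "unimodular_hom \<xi>"
  shows "precompact_translates \<xi>"
  unfolding precompact_translates_def
proof (intro allI impI)
  fix e :: real assume e: "0 < e"
  have "compact (sphere (0::complex) 1)" by simp
  then have "\<exists>K. finite K \<and> sphere (0::complex) 1 \<subseteq> (\<Union>z\<in>K. ball z (e / 2))"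
    using e unfolding compact_eq_totally_bounded by simp
  then obtain K where K: "finite K" "sphere (0::complex) 1 \<subseteq> (\<Union>z\<in>K. ball z (e / 2))"
    by blast
  have "\<exists>z\<in>K. dist z (\<xi> x) < e / 2" for x
  proof -
    have "\<xi> x \<in> sphere 0 1"
      using \<xi> by (simp add: unimodular_hom_def)
    then show ?thesis
      using K(2) by (auto dest!: subsetD)
  qed
  then obtain m where m: "\<And>x. m x \<in> K" "\<And>x. dist (m x) (\<xi> x) < e / 2"
    by metis
  define c where "c = (\<lambda>x. to_nat_on K (m x))"
  have "range c \<subseteq> to_nat_on K ` K"
    using m(1) unfolding c_def by auto
  then have "finite (range c)"
    using K(1) by (meson finite_imageI finite_subset)
  moreover have "norm (\<xi> (h + x) - \<xi> (k + x)) \<le> e" if "c h = c k" for h k x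
  proof -
    have "inj_on (to_nat_on K) K"
      using K(1) by (simp add: countable_finite inj_on_to_nat_on)
    then have "m h = m k"
      using that m(1) unfolding c_def by (simp add: inj_on_eq_iff)
    then have "dist (\<xi> h) (\<xi> k) < e"
      using m(2)[of h] m(2)[of k] dist_triangle_half_r[of "m h" "\<xi> h" e "\<xi> k"] by simp
    moreover have "\<xi> (h + x) - \<xi> (k + x) = (\<xi> h - \<xi> k) * \<xi> x"
      using \<xi> by (simp add: unimodular_hom_def algebra_simps)
    ultimately show ?thesis
      using \<xi> by (simp add: unimodular_hom_def norm_mult dist_norm)
  qed
  ultimately show "\<exists>c::'a \<Rightarrow> nat. finite (range c) \<and>
       (\<forall>h k. c h = c k \<longrightarrow> (\<forall>x. norm (\<xi> (h + x) - \<xi> (k + x)) \<le> e))"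
    by blast
qed

lemma convolution_coefficient:
  assumes k: "precompact_translates k" and u: "precompact_translates u" and \<xi>: "unimodular_hom \<xi>"
  shows "mean_inner (convolution k u) \<xi> = mean_inner k \<xi> * mean_inner u \<xi>"
proof -
  note pc = precompact_translates_unimodular_hom[OF \<xi>]
  have "mean_inner (convolution k u) \<xi> = mean (\<lambda>x. mean (\<lambda>y. cnj (\<xi> x) * (k (x - y) * u y)))"
    unfolding mean_inner_def convolution_def
    by (simp add: mean_cmult precompact_translates_intros
        precompact_translates_difference_kernel k u mult.commute)
  also have "\<dots> = mean (\<lambda>y. mean (\<lambda>x. cnj (\<xi> x) * (k (x - y) * u y)))"
    by (rule mean_mean_swap) (intro precompact_translates_intros precompact_translates_pair k u
        precompact_translates_pair(3)[OF precompact_translates_cnj[OF pc]])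
  also have "\<dots> = mean (\<lambda>y. mean_inner k \<xi> * (u y * cnj (\<xi> y)))"
  proof (rule arg_cong[of _ _ mean], rule ext)
    fix y
    have kc: "precompact_translates (\<lambda>x. k x * cnj (\<xi> x))"
      by (intro precompact_translates_intros k pc)
    have "\<xi> x = \<xi> (- y + x) * \<xi> y" for x
    proof -
      have "\<xi> ((- y + x) + y) = \<xi> (- y + x) * \<xi> y"
        using \<xi> unfolding unimodular_hom_def by blast
      then show ?thesis by simp
    qed
    note split = this
    have "cnj (\<xi> x) * (k (x - y) * u y) =
        (u y * cnj (\<xi> y)) * (k (- y + x) * cnj (\<xi> (- y + x)))" for x
      by (subst split[of x]) (simp add: mult_ac)
    then have "mean (\<lambda>x. cnj (\<xi> x) * (k (x - y) * u y)) =
        (u y * cnj (\<xi> y)) * mean (\<lambda>x. k (- y + x) * cnj (\<xi> (- y + x)))"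
      by (simp only: mean_cmult precompact_translates_shift[OF kc, of "- y"])
    also have "mean (\<lambda>x. k (- y + x) * cnj (\<xi> (- y + x))) = mean_inner k \<xi>"
      unfolding mean_inner_def by (rule mean_shift[OF kc])
    finally show "mean (\<lambda>x. cnj (\<xi> x) * (k (x - y) * u y)) = mean_inner k \<xi> * (u y * cnj (\<xi> y))"
      by (simp add: mult.commute)
  qed
  also have "\<dots> = mean_inner k \<xi> * mean_inner u \<xi>"
    unfolding mean_inner_def by (intro mean_cmult precompact_translates_intros u pc)
  finally show ?thesis .
qed

text \<open>
  The autocorrelation is the convolution of \<open>w\<close> with its adjoint, so its Fourier coefficients are
  the squared moduli of those of \<open>w\<close>.
\<close>

lemma autocorrelation_coefficient:
  assumes w: "precompact_translates w" and \<xi>: "unimodular_hom \<xi>"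
  shows "mean_inner (autocorrelation w) \<xi> = mean_inner w \<xi> * cnj (mean_inner w \<xi>)"
proof -
  note pc = precompact_translates_unimodular_hom[OF \<xi>]
  have auto_conv: "autocorrelation w = convolution w (\<lambda>y. cnj (w (- y)))"
  proof
    fix x
    have "precompact_translates (\<lambda>y. w (x + y) * cnj (w y))"
      by (intro precompact_translates_intros w)
    from mean_reflect[OF this] show "autocorrelation w x = convolution w (\<lambda>y. cnj (w (- y))) x"
      by (simp add: autocorrelation_def convolution_def)
  qed
  have wc: "precompact_translates (\<lambda>x. w x * cnj (\<xi> x))"
    by (intro precompact_translates_intros w pc)
  have "(\<lambda>y. cnj (w (- y)) * cnj (\<xi> y)) = (\<lambda>y. cnj (w (- y) * cnj (\<xi> (- y))))"
    by (simp add: unimodular_hom_minus[OF \<xi>])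
  then have "mean_inner (\<lambda>y. cnj (w (- y))) \<xi> = mean (\<lambda>y. cnj (w (- y) * cnj (\<xi> (- y))))"
    unfolding mean_inner_def by simp
  also have "\<dots> = cnj (mean_inner w \<xi>)"
    unfolding mean_inner_def mean_cnj[OF precompact_translates_reflect[OF wc]] mean_reflect[OF wc] ..
  finally show ?thesis
    unfolding auto_conv
    using convolution_coefficient[OF w precompact_translates_cnj[OF precompact_translates_reflect[OF w]] \<xi>]
    by simp
qed

lemma convolution_diff:
  assumes k: "precompact_translates k" and u: "precompact_translates u"
    and v: "precompact_translates v"
  shows "convolution k (\<lambda>x. u x - c * v x) = (\<lambda>x. convolution k u x - c * convolution k v x)"
  using convolution_lincomb[OF k u v, of 1 "- c"] by simp

lemma convolution_cmult:
  assumes k: "precompact_translates k" and u: "precompact_translates u"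
  shows "convolution k (\<lambda>x. c * u x) = (\<lambda>x. c * convolution k u x)"
  using convolution_lincomb[OF k u u, of c 0] by simp

text \<open>
  The number \<open>L\<close> is the square of the operator norm of convolution with \<open>k\<close>.
\<close>

lemma convolution_operator_bound:
  assumes k: "precompact_translates k"
  obtains L where "0 \<le> L" "\<And>u. precompact_translates u \<Longrightarrow> mean_sq (convolution k u) \<le> L * mean_sq u"
    "\<And>n. \<exists>u. precompact_translates u \<and> mean_sq u \<le> 1 \<and>
        L - 1 / real (Suc n) < mean_sq (convolution k u)"
proof -
  note pcc = precompact_translates_convolution[OF k]
  define Q where "Q = {mean_sq (convolution k u) | u. precompact_translates u \<and> mean_sq u \<le> 1}"
  have K0: "0 \<le> mean_sq k" using mean_sq_nonneg[OF k] .
  have le_k: "mean_sq (convolution k u) \<le> mean_sq k * mean_sq u" if "precompact_translates u" for u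
    by (rule mean_sq_le) (use that convolution_le[OF k that] pcc in auto)
  have bdd: "bdd_above Q"
  proof (rule bdd_aboveI[of _ "mean_sq k"])
    fix q assume "q \<in> Q"
    then obtain u where u: "q = mean_sq (convolution k u)" "precompact_translates u" "mean_sq u \<le> 1"
      unfolding Q_def by blast
    then show "q \<le> mean_sq k"
      using le_k[OF u(2)] mult_left_mono[OF u(3) K0] by simp
  qed
  define L where "L = Sup Q"
  have L_upper: "mean_sq (convolution k u) \<le> L" if "precompact_translates u" "mean_sq u \<le> 1" for u
    unfolding L_def by (rule cSup_upper[OF _ bdd]) (use that in \<open>auto simp: Q_def\<close>)
  have bound: "mean_sq (convolution k u) \<le> L * mean_sq u" if u: "precompact_translates u" for u
  proof (cases "mean_sq u = 0")
    case True
    then show ?thesis using le_k[OF u] by simp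
  next
    case False
    then have s: "0 < mean_sq u" using mean_sq_nonneg[OF u] by simp
    define c where "c = complex_of_real (1 / sqrt (mean_sq u))"
    have c: "(cmod c)\<^sup>2 = 1 / mean_sq u"
      using s by (simp add: c_def norm_divide power_divide)
    have "mean_sq (convolution k (\<lambda>x. c * u x)) \<le> L"
      by (rule L_upper) (use c s in \<open>auto simp: mean_sq_cmult u intro!: precompact_translates_intros\<close>)
    then show ?thesis
      using s c by (simp add: convolution_cmult k mean_sq_cmult pcc u field_simps)
  qed
  have zero: "mean_sq (\<lambda>_::'a. 0) = 0"
    by (simp add: mean_sq_def mean_inner_def mean_const)
  have "mean_sq (convolution k (\<lambda>_. 0)) \<in> Q"
    unfolding Q_def using zero precompact_translates_const[of 0] by force
  then have ne: "Q \<noteq> {}" by blast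
  have "\<exists>u. precompact_translates u \<and> mean_sq u \<le> 1 \<and> L - 1 / real (Suc n) < mean_sq (convolution k u)" for n
  proof -
    have "\<exists>q\<in>Q. L - 1 / real (Suc n) < q"
      using less_cSup_iff[OF ne bdd, of "L - 1 / real (Suc n)"] unfolding L_def by simp
    then show ?thesis
      unfolding Q_def by blast
  qed
  moreover have "0 \<le> L"
    using L_upper[OF precompact_translates_const[of 0]] zero
      mean_sq_nonneg[OF pcc[OF precompact_translates_const[of 0]]] by simp
  ultimately show ?thesis
    using that[of L] bound by blast
qed

text \<open>
  Let \<open>T\<close> be the square of the convolution operator, which is positive with norm \<open>L\<close>. For a sequence
  \<open>u n\<close> of vectors of norm at most one on which the operator norm is almost attained, \<open>T (u n) - L u n\<close>
  tends to zero in mean square, and \<open>T (u n)\<close> has a uniformly convergent subsequence by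
  equicontinuity; its limit is the required eigenfunction.
\<close>

lemma convolution_square_eigenfunction:
  fixes k :: "'a::ab_group_add \<Rightarrow> complex"
  assumes k: "precompact_translates k" and herm: "\<And>x. k (- x) = cnj (k x)" and nz: "k p \<noteq> 0"
  obtains L v where "0 < L" "\<And>u. precompact_translates u \<Longrightarrow> mean_sq (convolution k u) \<le> L * mean_sq u"
    "precompact_translates v" "0 < mean_sq v"
    "\<And>x. convolution k (convolution k v) x = complex_of_real L * v x"
proof -
  note pcc = precompact_translates_convolution[OF k]
  have K0: "0 \<le> mean_sq k" using mean_sq_nonneg[OF k] .
  obtain L where "0 \<le> L"
    and bound: "\<And>u. precompact_translates u \<Longrightarrow> mean_sq (convolution k u) \<le> L * mean_sq u"
    and approx: "\<And>n. \<exists>u. precompact_translates u \<and> mean_sq u \<le> 1 \<and>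
        L - 1 / real (Suc n) < mean_sq (convolution k u)"
    using convolution_operator_bound[OF k] by metis
  have L0: "0 < L"
  proof -
    have "convolution k k 0 = mean (\<lambda>y. k y * cnj (k y))"
      by (simp add: convolution_def herm mult.commute)
    also have "\<dots> = complex_of_real (mean_sq k)"
      using mean_inner_self[OF k] by (simp add: mean_inner_def)
    finally have "convolution k k 0 \<noteq> 0"
      using mean_sq_pos[of k p] k nz by simp
    then have "0 < mean_sq (convolution k k)"
      by (rule mean_sq_pos[OF pcc[OF k]])
    then have "0 < L * mean_sq k"
      using bound[OF k] by linarith
    then show ?thesis
      using K0 by (simp add: zero_less_mult_iff)
  qed
  obtain u where u: "\<And>n. precompact_translates (u n)" "\<And>n. mean_sq (u n) \<le> 1"
    "\<And>n. L - 1 / real (Suc n) < mean_sq (convolution k (u n))"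
    using approx by metis
  define v where "v n = convolution k (convolution k (u n))" for n
  have cu: "precompact_translates (convolution k (u n))" for n
    by (intro pcc u)
  have v: "precompact_translates (v n)" for n
    unfolding v_def by (intro pcc u)
  have cuL: "mean_sq (convolution k (u n)) \<le> L" for n
    using bound[OF u(1), of n] mult_left_mono[OF u(2)[of n] \<open>0 \<le> L\<close>] by simp
  have vB: "cmod (v n x) \<le> sqrt (mean_sq k * L)" for n x
  proof (rule real_le_rsqrt)
    show "(cmod (v n x))\<^sup>2 \<le> mean_sq k * L"
      using convolution_le[OF k cu, of n x] mult_left_mono[OF cuL K0, of n] unfolding v_def by linarith
  qed
  have v_equi: "cmod (v n h - v n h') \<le> d * sqrt L"
    if d: "0 \<le> d" "\<And>z. cmod (k (h + z) - k (h' + z)) \<le> d" for n h h' d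
    using convolution_lipschitz[OF k cu d] mult_left_mono[OF real_sqrt_le_mono[OF cuL] d(1), of n]
    unfolding v_def by (meson order_trans)
  have "\<exists>r g. strict_mono (r :: nat \<Rightarrow> nat) \<and> uniform_limit UNIV (\<lambda>n. v (r n)) g sequentially"
    by (rule Arzela_Ascoli_precompact[where C = "sqrt L", OF k vB v_equi]) (use L0 in auto)
  then obtain r g where r: "strict_mono (r :: nat \<Rightarrow> nat)" and g: "uniform_limit UNIV (\<lambda>n. v (r n)) g sequentially"
    by blast
  have pg: "precompact_translates g"
    by (rule precompact_translates_uniform_limit'[OF v g])
  have Tlim: "uniform_limit UNIV (\<lambda>n. convolution k (convolution k (v (r n))))
      (convolution k (convolution k g)) sequentially"
    by (intro convolution_uniform_limit k pcc v pg g)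
  have inner_uv: "mean_inner (v n) (u n) = complex_of_real (mean_sq (convolution k (u n)))" for n
    unfolding v_def convolution_selfadjoint[OF k cu u(1) herm] by (rule mean_inner_self[OF cu])
  have small: "(cmod (convolution k (convolution k (v n)) x - L * v n x))\<^sup>2 \<le>
      mean_sq k * L * (2 * L / real (Suc n))" for n x
  proof -
    define w where "w = (\<lambda>x. v n x - complex_of_real L * u n x)"
    have w: "precompact_translates w"
      unfolding w_def by (intro precompact_translates_intros v u)
    have "mean_sq w = mean_sq (v n) - 2 * L * mean_sq (convolution k (u n)) + L\<^sup>2 * mean_sq (u n)"
      using mean_sq_lincomb[OF v[of n] u(1)[of n], of 1 "- complex_of_real L"] inner_uv[of n]
      unfolding w_def by simp
    moreover have "mean_sq (v n) \<le> L * L"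
      using order_trans[OF bound[OF cu, of n] mult_left_mono[OF cuL[of n], of L]] L0
      unfolding v_def by simp
    moreover have "2 * L * mean_sq (convolution k (u n)) \<ge> 2 * L * (L - 1 / real (Suc n))"
      using u(3)[of n] L0 by (intro mult_left_mono) auto
    moreover have "L\<^sup>2 * mean_sq (u n) \<le> L\<^sup>2 * 1"
      using u(2)[of n] by (intro mult_left_mono) auto
    ultimately have "mean_sq w \<le> L * L - 2 * L * (L - 1 / real (Suc n)) + L\<^sup>2 * 1"
      by linarith
    also have "\<dots> = 2 * L / real (Suc n)"
      by (simp add: right_diff_distrib power2_eq_square)
    finally have "L * mean_sq w \<le> L * (2 * L / real (Suc n))"
      using L0 by (intro mult_left_mono) auto
    then have "mean_sq (convolution k w) \<le> L * (2 * L / real (Suc n))"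
      using bound[OF w] by linarith
    then have "mean_sq k * mean_sq (convolution k w) \<le> mean_sq k * (L * (2 * L / real (Suc n)))"
      using K0 by (intro mult_left_mono) auto
    moreover have "convolution k (convolution k w) x = convolution k (convolution k (v n)) x - L * v n x"
      unfolding w_def convolution_diff[OF k v u(1)] convolution_diff[OF k pcc[OF v] pcc[OF u(1)]]
      by (simp add: v_def)
    ultimately show ?thesis
      using convolution_le[OF k pcc[OF w], of x] by (simp add: mult.assoc)
  qed
  have eig: "convolution k (convolution k g) x = complex_of_real L * g x" for x
  proof -
    have "(\<lambda>n. convolution k (convolution k (v (r n))) x - L * v (r n) x) \<longlonglongrightarrow>
        convolution k (convolution k g) x - L * g x"
      by (intro tendsto_intros tendsto_uniform_limitI[OF Tlim] tendsto_uniform_limitI[OF g]) auto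
    moreover have "(\<lambda>n. convolution k (convolution k (v (r n))) x - L * v (r n) x) \<longlonglongrightarrow> 0"
    proof (rule tendsto_norm_zero_cancel)
      have "(\<lambda>n. (mean_sq k * L * (2 * L)) * inverse (real (Suc n))) \<longlonglongrightarrow> 0"
        by (rule tendsto_mult_right_zero[OF LIMSEQ_inverse_real_of_nat])
      then have lim: "(\<lambda>n. mean_sq k * L * (2 * L / real (Suc n))) \<longlonglongrightarrow> 0"
        by (simp add: divide_inverse mult.assoc)
      have "(\<lambda>n. (cmod (convolution k (convolution k (v (r n))) x - L * v (r n) x))\<^sup>2) \<longlonglongrightarrow> 0"
        by (rule tendsto_sandwich[OF _ _ tendsto_const LIMSEQ_subseq_LIMSEQ[OF lim r]])
          (use small in \<open>auto simp: o_def\<close>)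
      then show "(\<lambda>n. cmod (convolution k (convolution k (v (r n))) x - L * v (r n) x)) \<longlonglongrightarrow> 0"
        using tendsto_real_sqrt by fastforce
    qed
    ultimately have "convolution k (convolution k g) x - L * g x = 0"
      by (rule LIMSEQ_unique)
    then show ?thesis by simp
  qed
  have inv0: "(\<lambda>n. 1 / real (Suc n)) \<longlonglongrightarrow> 0"
    using LIMSEQ_inverse_real_of_nat by (simp add: inverse_eq_divide)
  have "0 < mean_sq g"
  proof -
    have low: "(L - 1 / real (Suc n))\<^sup>2 \<le> mean_sq (v n)" if "1 / real (Suc n) \<le> L" for n
    proof -
      have "(L - 1 / real (Suc n))\<^sup>2 \<le> (mean_sq (convolution k (u n)))\<^sup>2"
        using u(3)[of n] that by (intro power_mono) auto
      also have "\<dots> = (cmod (mean_inner (v n) (u n)))\<^sup>2"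
        by (simp add: inner_uv)
      also have "\<dots> \<le> mean_sq (v n) * mean_sq (u n)"
        by (rule mean_Cauchy_Schwarz[OF v u(1)])
      also have "\<dots> \<le> mean_sq (v n) * 1"
        by (intro mult_left_mono u(2) mean_sq_nonneg v)
      finally show ?thesis by simp
    qed
    have "(\<lambda>n. mean_sq (v (r n))) \<longlonglongrightarrow> mean_sq g"
      by (rule mean_sq_tendsto[OF v pg g])
    moreover have "(\<lambda>n. (L - 1 / real (Suc n))\<^sup>2) \<longlonglongrightarrow> (L - 0)\<^sup>2"
      by (intro tendsto_intros inv0)
    from LIMSEQ_subseq_LIMSEQ[OF this r]
    have "(\<lambda>n. (L - 1 / real (Suc (r n)))\<^sup>2) \<longlonglongrightarrow> L\<^sup>2" by (simp add: o_def)
    moreover have "\<forall>\<^sub>F n in sequentially. (L - 1 / real (Suc (r n)))\<^sup>2 \<le> mean_sq (v (r n))"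
    proof -
      from LIMSEQ_subseq_LIMSEQ[OF inv0 r] have "\<forall>\<^sub>F n in sequentially. 1 / real (Suc (r n)) < L"
        using L0 by (simp only: o_def order_tendsto_iff)
      then show ?thesis
        by eventually_elim (rule low, rule less_imp_le)
    qed
    ultimately have "L\<^sup>2 \<le> mean_sq g"
      by (rule tendsto_le[OF sequentially_bot])
    then show ?thesis
      using L0 by (meson less_le_trans zero_less_power)
  qed
  then show ?thesis
    using that[of L g] L0 bound pg eig by blast
qed

text \<open>
  Adding a multiple of a translate to \<open>w\<close> changes the autocorrelation by translates of itself. This
  formula turns the extremality of an autocorrelation into a functional equation for it.
\<close>

lemma autocorrelation_perturbation:
  fixes w :: "'a::ab_group_add \<Rightarrow> complex" and \<epsilon> :: real and z :: complex
  assumes w: "precompact_translates w" and z: "cmod z = 1"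
  shows "autocorrelation (\<lambda>x. 1 * w x + \<epsilon> * z * w (a + x)) x =
    complex_of_real (1 + \<epsilon>\<^sup>2) * autocorrelation w x +
    complex_of_real \<epsilon> * (z * autocorrelation w (a + x) + cnj z * autocorrelation w (- a + x))"
proof -
  have zz: "z * cnj z = 1"
    using z by (simp add: complex_norm_square[symmetric])
  define A where "A b c = (\<lambda>y. w (b + x + y) * cnj (w (c + y)))" for b c
  have A: "precompact_translates (A b c)" for b c
    unfolding A_def by (intro precompact_translates_intros w)
  have mA: "mean (A b c) = autocorrelation w (b - c + x)" for b c
    using mean_shift[OF A, of b c "- c"] unfolding A_def autocorrelation_def
    by (simp add: algebra_simps)
  have "autocorrelation (\<lambda>x. 1 * w x + \<epsilon> * z * w (a + x)) x =
      mean (\<lambda>y. (A 0 0 y + \<epsilon> * z * A a 0 y) + (\<epsilon> * cnj z * A 0 a y + (\<epsilon> * \<epsilon> * (z * cnj z)) * A a a y))"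
    unfolding autocorrelation_def A_def
    by (rule arg_cong[of _ _ mean]) (simp add: fun_eq_iff algebra_simps)
  also have "\<dots> = (mean (A 0 0) + \<epsilon> * z * mean (A a 0)) +
      (\<epsilon> * cnj z * mean (A 0 a) + (\<epsilon> * \<epsilon> * (z * cnj z)) * mean (A a a))"
    by (simp only: mean_add mean_cmult precompact_translates_intros precompact_translates_cmult A)
  also have "\<dots> = complex_of_real (1 + \<epsilon>\<^sup>2) * autocorrelation w x +
    complex_of_real \<epsilon> * (z * autocorrelation w (a + x) + cnj z * autocorrelation w (- a + x))"
    unfolding mA zz by (simp add: algebra_simps power2_eq_square)
  finally show ?thesis .
qed

lemma first_variation:
  fixes X Y :: real
  assumes "\<And>\<epsilon>. 2 * (1 + \<epsilon>\<^sup>2) * \<epsilon> * X + \<epsilon>\<^sup>2 * Y \<le> 0"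
  shows "X = 0 \<and> Y \<le> 0"
proof -
  have "X \<le> 0" if le: "\<And>\<epsilon>. 2 * (1 + \<epsilon>\<^sup>2) * \<epsilon> * X + \<epsilon>\<^sup>2 * Y \<le> 0" for X :: real
  proof (rule ccontr)
    assume "\<not> X \<le> 0"
    then have X: "0 < X" by simp
    \<comment> \<open>small enough for the linear term to dominate the quadratic one\<close>
    define \<epsilon> where "\<epsilon> = X / (\<bar>Y\<bar> + 1)"
    have \<epsilon>: "0 < \<epsilon>" "\<epsilon> * (\<bar>Y\<bar> + 1) = X"
      using X by (simp_all add: \<epsilon>_def)
    have "\<epsilon> * (2 * (1 + \<epsilon>\<^sup>2) * X + \<epsilon> * Y) \<le> 0"
      using le[of \<epsilon>] by (simp add: algebra_simps power2_eq_square)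
    then have "2 * (1 + \<epsilon>\<^sup>2) * X + \<epsilon> * Y \<le> 0"
      using \<epsilon>(1) by (simp add: mult_le_0_iff)
    moreover have "- (\<epsilon> * \<bar>Y\<bar>) \<le> \<epsilon> * Y"
      using \<epsilon>(1) mult_left_mono[of "- \<bar>Y\<bar>" Y \<epsilon>] by simp
    moreover have "\<epsilon> * \<bar>Y\<bar> < X"
      using \<epsilon> by (simp add: algebra_simps)
    moreover have "0 \<le> 2 * \<epsilon>\<^sup>2 * X"
      using X by simp
    moreover have "2 * (1 + \<epsilon>\<^sup>2) * X = 2 * X + 2 * \<epsilon>\<^sup>2 * X"
      by (simp add: algebra_simps)
    ultimately show False
      using X by linarith
  qed
  note nonpos = this
  have "2 * (1 + \<epsilon>\<^sup>2) * \<epsilon> * (- X) + \<epsilon>\<^sup>2 * Y \<le> 0" for \<epsilon>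
    using assms[of "- \<epsilon>"] by simp
  then have "X = 0"
    using nonpos[of X, OF assms] nonpos[of "- X"] by simp
  then show ?thesis
    using assms[of 1] by simp
qed

text \<open>
  Among the eigenfunctions \<open>w\<close> of mean square one, consider one whose autocorrelation \<open>q\<close> has the largest
  mean square \<open>M\<close>; it exists by compactness. Replacing \<open>w\<close> by \<open>w + \<epsilon> z w(a + \<cdot>)\<close> stays in the eigenspace,
  and the resulting inequality for all real \<open>\<epsilon>\<close> forces equality in the Cauchy-Schwarz inequality
  between \<open>q\<close> and \<open>s x = z q (a + x) + cnj z q (- a + x)\<close>. So \<open>s\<close> is a multiple of \<open>q\<close>, for every
  \<open>a\<close> and every unimodular \<open>z\<close>, and the choices \<open>z = 1\<close> and \<open>z = \<i>\<close> yield \<open>q (a + x) = q a * q x\<close>. In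
  terms of Fourier series, \<open>M\<close> is the largest sum of squares of a probability vector, and that is
  attained at a single character.
\<close>

lemma exists_correlated_unimodular_hom_hermitian:
  fixes k :: "'a::ab_group_add \<Rightarrow> complex"
  assumes k: "precompact_translates k" and herm: "\<And>x. k (- x) = cnj (k x)" and nz: "k p \<noteq> 0"
  shows "\<exists>\<xi>. unimodular_hom \<xi> \<and> mean_inner k \<xi> \<noteq> 0"
proof -
  note pcc = precompact_translates_convolution[OF k]
  note pca = precompact_translates_autocorrelation
  have K0: "0 \<le> mean_sq k" using mean_sq_nonneg[OF k] .
  obtain L v where L: "0 < L"
    and bound: "\<And>u. precompact_translates u \<Longrightarrow> mean_sq (convolution k u) \<le> L * mean_sq u"
    and v: "precompact_translates v" "0 < mean_sq v"
    and eig: "\<And>x. convolution k (convolution k v) x = complex_of_real L * v x"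
    using convolution_square_eigenfunction[OF k herm nz] by metis
  define E where "E = {w. precompact_translates w \<and>
      (\<forall>x. convolution k (convolution k w) x = complex_of_real L * w x)}"
  have E_pc: "precompact_translates w" if "w \<in> E" for w
    using that by (simp add: E_def)
  have E_eig: "convolution k (convolution k w) = (\<lambda>x. complex_of_real L * w x)" if "w \<in> E" for w
    using that by (auto simp: E_def)
  have E_lincomb: "(\<lambda>x. \<alpha> * w x + \<beta> * w' x) \<in> E" if w: "w \<in> E" "w' \<in> E" for \<alpha> \<beta> w w'
    using w unfolding E_def
    by (auto simp: convolution_lincomb k pcc algebra_simps
        intro!: precompact_translates_add precompact_translates_cmult)
  have E_shift: "(\<lambda>x. w (a + x)) \<in> E" if w: "w \<in> E" for a w
  proof -
    have "convolution k (\<lambda>x. u (a + x)) = (\<lambda>x. convolution k u (a + x))"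
      if "precompact_translates u" for u
      using convolution_shift[OF k that] by blast
    then show ?thesis
      using w pcc unfolding E_def by (auto intro!: precompact_translates_shift)
  qed
  define J where "J w = mean_sq (autocorrelation w)" for w :: "'a \<Rightarrow> complex"
  have J_le: "J w \<le> (mean_sq w)\<^sup>2" if "w \<in> E" for w
    unfolding J_def by (intro mean_sq_le pca E_pc[OF that] autocorrelation_le)
  define E1 where "E1 = {w \<in> E. mean_sq w = 1}"
  have scale: "(\<lambda>x. complex_of_real (1 / sqrt (mean_sq w)) * w x) \<in> E1"
    "J (\<lambda>x. complex_of_real (1 / sqrt (mean_sq w)) * w x) = J w / (mean_sq w)\<^sup>2"
    if w: "w \<in> E" "0 < mean_sq w" for w
  proof -
    let ?c = "complex_of_real (1 / sqrt (mean_sq w))"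
    have c: "(cmod ?c)\<^sup>2 = 1 / mean_sq w" "?c * cnj ?c = complex_of_real (1 / mean_sq w)"
      using w(2) by (simp_all add: norm_divide power_divide flip: of_real_mult)
    have "mean_sq (\<lambda>x. ?c * w x) = 1"
      unfolding mean_sq_cmult[OF E_pc[OF w(1)]] c(1) using w(2) by simp
    then show "(\<lambda>x. ?c * w x) \<in> E1"
      using E_lincomb[OF w(1) w(1), of ?c 0] by (simp add: E1_def)
    have "autocorrelation (\<lambda>x. ?c * w x) = (\<lambda>x. complex_of_real (1 / mean_sq w) * autocorrelation w x)"
    proof
      fix x
      have "precompact_translates (\<lambda>y. w (x + y) * cnj (w y))"
        by (intro precompact_translates_intros E_pc w)
      from mean_cmult[OF this, of "?c * cnj ?c"]
      show "autocorrelation (\<lambda>x. ?c * w x) x = complex_of_real (1 / mean_sq w) * autocorrelation w x"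
        unfolding c(2)[symmetric] autocorrelation_def by (simp add: mult_ac)
    qed
    then have "J (\<lambda>x. ?c * w x) = (cmod (complex_of_real (1 / mean_sq w)))\<^sup>2 * J w"
      unfolding J_def by (simp only: mean_sq_cmult[OF pca[OF E_pc[OF w(1)]]])
    then show "J (\<lambda>x. ?c * w x) = J w / (mean_sq w)\<^sup>2"
      by (simp add: norm_divide power_divide)
  qed
  have ne: "J ` E1 \<noteq> {}"
    using scale(1)[of v] v eig by (auto simp: E_def)
  have bdd: "bdd_above (J ` E1)"
    by (rule bdd_aboveI[of _ 1]) (use J_le in \<open>fastforce simp: E1_def\<close>)
  define M where "M = Sup (J ` E1)"
  have M_upper: "J w \<le> M" if "w \<in> E1" for w
    unfolding M_def by (rule cSup_upper[OF _ bdd]) (use that in auto)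
  have M_bound: "J w \<le> M * (mean_sq w)\<^sup>2" if w: "w \<in> E" for w
  proof (cases "mean_sq w = 0")
    case True
    then show ?thesis using J_le[OF w] by simp
  next
    case False
    then have s: "0 < mean_sq w"
      using mean_sq_nonneg[OF E_pc[OF w]] by simp
    then have "J w / (mean_sq w)\<^sup>2 \<le> M"
      using M_upper[OF scale(1)[OF w s]] unfolding scale(2)[OF w s] by simp
    then show ?thesis
      using s by (simp add: pos_divide_le_eq)
  qed
  have "\<exists>w\<in>E1. M - 1 / real (Suc n) < J w" for n
    using less_cSup_iff[OF ne bdd, of "M - 1 / real (Suc n)"] unfolding M_def by simp
  then obtain u where u: "\<And>n. u n \<in> E1" "\<And>n. M - 1 / real (Suc n) < J (u n)"
    by metis
  have uE: "u n \<in> E" "mean_sq (u n) = 1" for n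
    using u(1)[of n] by (auto simp: E1_def)
  note upc = E_pc[OF uE(1)]
  have cuL: "mean_sq (convolution k (u n)) \<le> L" for n
    using bound[OF upc] uE(2) by (metis mult.right_neutral)
  have u_eq: "u n x = convolution k (convolution k (u n)) x / L" for n x
    using E_eig[OF uE(1), of n] L by (simp add: fun_eq_iff)
  have uB: "cmod (u n x) \<le> sqrt (mean_sq k * L) / L" for n x
  proof -
    have "(cmod (convolution k (convolution k (u n)) x))\<^sup>2 \<le> mean_sq k * L"
      using convolution_le[OF k pcc[OF upc], of n x] mult_left_mono[OF cuL K0, of n] by linarith
    then have "cmod (convolution k (convolution k (u n)) x) / L \<le> sqrt (mean_sq k * L) / L"
      using L by (intro divide_right_mono real_le_rsqrt) auto
    moreover have "cmod (u n x) = cmod (convolution k (convolution k (u n)) x) / L"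
      using L by (subst u_eq) (simp add: norm_divide)
    ultimately show ?thesis by simp
  qed
  have u_equi: "cmod (u n h - u n h') \<le> d * (sqrt L / L)"
    if d: "0 \<le> d" "\<And>z. cmod (k (h + z) - k (h' + z)) \<le> d" for n h h' d
  proof -
    have "cmod (convolution k (convolution k (u n)) h - convolution k (convolution k (u n)) h') \<le> d * sqrt L"
      using convolution_lipschitz[OF k pcc[OF upc] d] mult_left_mono[OF real_sqrt_le_mono[OF cuL] d(1), of n]
      by (meson order_trans)
    then have "cmod (convolution k (convolution k (u n)) h - convolution k (convolution k (u n)) h') / L
        \<le> d * sqrt L / L"
      using L by (intro divide_right_mono) auto
    moreover have "cmod (u n h - u n h') =
        cmod (convolution k (convolution k (u n)) h - convolution k (convolution k (u n)) h') / L"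
      using L by (subst u_eq[of n h], subst u_eq[of n h'])
        (simp add: norm_divide flip: diff_divide_distrib)
    ultimately show ?thesis by simp
  qed
  have "\<exists>r w. strict_mono (r :: nat \<Rightarrow> nat) \<and> uniform_limit UNIV (\<lambda>n. u (r n)) w sequentially"
    by (rule Arzela_Ascoli_precompact[where C = "sqrt L / L", OF k uB u_equi]) (use L in auto)
  then obtain r w where r: "strict_mono (r :: nat \<Rightarrow> nat)" and wlim: "uniform_limit UNIV (\<lambda>n. u (r n)) w sequentially"
    by blast
  have w: "precompact_translates w"
    by (rule precompact_translates_uniform_limit'[OF upc wlim])
  have wE: "w \<in> E"
  proof -
    have Tlim: "uniform_limit UNIV (\<lambda>n. convolution k (convolution k (u (r n))))
        (convolution k (convolution k w)) sequentially"
      by (intro convolution_uniform_limit k pcc upc w wlim)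
    have "convolution k (convolution k w) x = complex_of_real L * w x" for x
    proof (rule LIMSEQ_unique)
      show "(\<lambda>n. convolution k (convolution k (u (r n))) x) \<longlonglongrightarrow> convolution k (convolution k w) x"
        by (rule tendsto_uniform_limitI[OF Tlim]) simp
      show "(\<lambda>n. convolution k (convolution k (u (r n))) x) \<longlonglongrightarrow> complex_of_real L * w x"
        unfolding E_eig[OF uE(1)]
        by (intro tendsto_intros tendsto_uniform_limitI[OF wlim]) simp
    qed
    then show ?thesis
      using w by (simp add: E_def)
  qed
  have w1: "mean_sq w = 1"
    using mean_sq_tendsto[OF upc w wlim] uE(2) LIMSEQ_unique[OF _ tendsto_const] by simp
  have Jw: "J w = M"
  proof (rule antisym)
    show "J w \<le> M"
      by (rule M_upper) (use wE w1 in \<open>simp add: E1_def\<close>)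
    have "(\<lambda>n. J (u (r n))) \<longlonglongrightarrow> J w"
      unfolding J_def
      by (intro mean_sq_tendsto pca upc w autocorrelation_uniform_limit wlim)
    moreover have "(\<lambda>n. M - 1 / real (Suc n)) \<longlonglongrightarrow> M - 0"
      using LIMSEQ_inverse_real_of_nat by (intro tendsto_intros) (simp add: inverse_eq_divide)
    from LIMSEQ_subseq_LIMSEQ[OF this r] have "(\<lambda>n. M - 1 / real (Suc (r n))) \<longlonglongrightarrow> M"
      by (simp add: o_def)
    moreover have "\<forall>\<^sub>F n in sequentially. M - 1 / real (Suc (r n)) \<le> J (u (r n))"
      using u(2) by (auto intro!: always_eventually less_imp_le)
    ultimately show "M \<le> J w"
      by (rule tendsto_le[OF sequentially_bot])
  qed
  define q where "q = autocorrelation w"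
  have q: "precompact_translates q"
    unfolding q_def by (rule pca[OF w])
  have q0: "q 0 = 1"
    unfolding q_def autocorrelation_zero[OF w] w1 by simp
  have q_minus: "q (- x) = cnj (q x)" for x
    unfolding q_def by (rule autocorrelation_minus[OF w])
  have qM: "mean_sq q = M"
    using Jw unfolding J_def q_def .
  have variation: "z * q (a + x) + cnj z * q (- a + x) = complex_of_real (2 * Re (z * q a)) * q x"
    if z: "cmod z = 1" for z a x
  proof -
    define s where "s = (\<lambda>x. z * q (a + x) + cnj z * q (- a + x))"
    have s: "precompact_translates s"
      unfolding s_def by (intro precompact_translates_intros q)
    define \<rho> where "\<rho> = 2 * Re (z * q a)"
    have s0: "s 0 = complex_of_real \<rho>"
      unfolding s_def \<rho>_def by (simp add: q_minus complex_eq_iff)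
    have ineq: "2 * (1 + \<epsilon>\<^sup>2) * \<epsilon> * (Re (mean_inner q s) - M * \<rho>) + \<epsilon>\<^sup>2 * (mean_sq s - M * \<rho>\<^sup>2) \<le> 0"
      for \<epsilon> :: real
    proof -
      define w' where "w' = (\<lambda>x. 1 * w x + complex_of_real \<epsilon> * z * w (a + x))"
      have w': "w' \<in> E"
        unfolding w'_def by (rule E_lincomb[OF wE E_shift[OF wE]])
      have acorr: "autocorrelation w' = (\<lambda>x. complex_of_real (1 + \<epsilon>\<^sup>2) * q x + complex_of_real \<epsilon> * s x)"
        unfolding w'_def q_def s_def using autocorrelation_perturbation[OF w z] by blast
      have "complex_of_real (mean_sq w') = complex_of_real ((1 + \<epsilon>\<^sup>2) + \<epsilon> * \<rho>)"
        using autocorrelation_zero[OF E_pc[OF w']] unfolding acorr q0 s0 by simp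
      then have msq: "mean_sq w' = (1 + \<epsilon>\<^sup>2) + \<epsilon> * \<rho>"
        by (simp only: of_real_eq_iff)
      have "J w' = (1 + \<epsilon>\<^sup>2)\<^sup>2 * M + 2 * ((1 + \<epsilon>\<^sup>2) * \<epsilon> * Re (mean_inner q s)) + \<epsilon>\<^sup>2 * mean_sq s"
        unfolding J_def acorr mean_sq_lincomb[OF q s] qM
        by (simp only: complex_cnj_complex_of_real of_real_mult[symmetric] norm_of_real power2_abs
            Re_complex_of_real flip: of_real_mult) simp
      moreover have "J w' \<le> M * ((1 + \<epsilon>\<^sup>2) + \<epsilon> * \<rho>)\<^sup>2"
        using M_bound[OF w'] unfolding msq .
      ultimately show ?thesis
        by (simp add: algebra_simps power2_eq_square)
    qed
    have X: "Re (mean_inner q s) = M * \<rho>" and Y: "mean_sq s \<le> M * \<rho>\<^sup>2"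
      using first_variation[OF ineq] by auto
    have "mean_sq (\<lambda>x. 1 * s x + (- complex_of_real \<rho>) * q x) =
        mean_sq s - 2 * \<rho> * Re (mean_inner s q) + \<rho>\<^sup>2 * M"
      unfolding mean_sq_lincomb[OF s q] qM by simp
    also have "Re (mean_inner s q) = M * \<rho>"
      unfolding mean_inner_commute[OF q s] using X by simp
    finally have "mean_sq (\<lambda>x. 1 * s x + (- complex_of_real \<rho>) * q x) \<le> 0"
      using Y by (simp add: algebra_simps power2_eq_square)
    moreover have "precompact_translates (\<lambda>x. 1 * s x + (- complex_of_real \<rho>) * q x)"
      by (intro precompact_translates_add precompact_translates_cmult s q)
    ultimately have "1 * s x + (- complex_of_real \<rho>) * q x = 0"
      using mean_sq_pos[of "\<lambda>x. 1 * s x + (- complex_of_real \<rho>) * q x" x] by linarith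
    then have "s x = complex_of_real \<rho> * q x"
      by simp
    then show ?thesis
      unfolding s_def \<rho>_def .
  qed
  have hom: "q (a + x) = q a * q x" for a x
  proof -
    have 1: "q (a + x) + q (- a + x) = complex_of_real (2 * Re (q a)) * q x"
      using variation[of 1 a x] by simp
    have "\<i> * (q (a + x) - q (- a + x)) = complex_of_real (2 * Re (\<i> * q a)) * q x"
      using variation[of \<i> a x] by (simp add: algebra_simps)
    then have "\<i> * (q (a + x) - q (- a + x)) = \<i> * (\<i> * complex_of_real (2 * Im (q a)) * q x)"
      by (simp add: mult.assoc[symmetric])
    then have 2: "q (a + x) - q (- a + x) = \<i> * complex_of_real (2 * Im (q a)) * q x"
      by (simp only: mult_cancel_left) simp
    have "2 * q (a + x) = (q (a + x) + q (- a + x)) + (q (a + x) - q (- a + x))"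
      by simp
    also have "\<dots> = 2 * ((Re (q a) + \<i> * Im (q a)) * q x)"
      unfolding 1 2 by (simp add: algebra_simps)
    also have "\<dots> = 2 * (q a * q x)"
      by (simp flip: complex_eq)
    finally show ?thesis by simp
  qed
  \<comment> \<open>\<open>q (- x) = cnj (q x)\<close> and \<open>q 0 = 1\<close> make the values unimodular\<close>
  have uq: "unimodular_hom q"
  proof -
    have "q x * cnj (q x) = 1" for x
      using hom[of x "- x"] q0 q_minus by simp
    then have "(cmod (q x))\<^sup>2 = 1" for x
      by (metis complex_norm_square of_real_eq_1_iff)
    then have "cmod (q x) = 1" for x
      by (metis norm_ge_zero power2_eq_1_iff zero_le_one order_trans neg_0_le_iff_le not_one_le_zero)
    then show ?thesis
      using hom by (simp add: unimodular_hom_def)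
  qed
  have "mean_inner q q = 1"
    unfolding mean_inner_def by (simp add: unimodular_hom_mult_cnj[OF uq] mean_const)
  then have c0: "mean_inner w q \<noteq> 0"
    using autocorrelation_coefficient[OF w uq] unfolding q_def[symmetric] by auto
  have "complex_of_real L * mean_inner w q = mean_inner (convolution k (convolution k w)) q"
    unfolding E_eig[OF wE] mean_inner_def
    using mean_cmult[OF precompact_translates_mult[OF w precompact_translates_cnj[OF q]], of L]
    by (simp add: mult.assoc)
  also have "\<dots> = mean_inner k q * (mean_inner k q * mean_inner w q)"
    by (simp add: convolution_coefficient k pcc w uq)
  finally have "mean_inner k q \<noteq> 0"
    using c0 L by auto
  then show ?thesis
    using uq by blast
qed

text \<open>
  The autocorrelation of \<open>f\<close> is a nonzero hermitian kernel, and its Fourier coefficients are the squared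
  moduli of those of \<open>f\<close>.
\<close>

theorem exists_correlated_unimodular_hom:
  fixes f :: "'a::ab_group_add \<Rightarrow> complex"
  assumes f: "precompact_translates f" and nz: "f p \<noteq> 0"
  shows "\<exists>\<xi>. unimodular_hom \<xi> \<and> mean (\<lambda>x. f x * cnj (\<xi> x)) \<noteq> 0"
proof -
  have "autocorrelation f 0 \<noteq> 0"
    unfolding autocorrelation_zero[OF f] using mean_sq_pos[of f p] f nz by simp
  from exists_correlated_unimodular_hom_hermitian[OF precompact_translates_autocorrelation[OF f]
      autocorrelation_minus[OF f] this]
  obtain \<xi> where \<xi>: "unimodular_hom \<xi>" "mean_inner (autocorrelation f) \<xi> \<noteq> 0"
    by blast
  then have "mean_inner f \<xi> \<noteq> 0"
    using autocorrelation_coefficient[OF f \<xi>(1)] by auto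
  then show ?thesis
    using \<xi>(1) unfolding mean_inner_def by blast
qed

section \<open>A Kronecker approximation theorem\<close>

lemma unimodular_hom_one: "unimodular_hom (\<lambda>_. 1)"
  by (simp add: unimodular_hom_def)

lemma unimodular_hom_mult:
  "unimodular_hom \<xi> \<Longrightarrow> unimodular_hom \<eta> \<Longrightarrow> unimodular_hom (\<lambda>x. \<xi> x * \<eta> x)"
  by (simp add: unimodular_hom_def norm_mult)

lemma unimodular_hom_cnj: "unimodular_hom \<xi> \<Longrightarrow> unimodular_hom (\<lambda>x. cnj (\<xi> x))"
  by (simp add: unimodular_hom_def)

lemma unimodular_hom_power: "unimodular_hom \<xi> \<Longrightarrow> unimodular_hom (\<lambda>x. \<xi> x ^ (n::nat))"
  by (simp add: unimodular_hom_def norm_power power_mult_distrib)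

lemma unimodular_hom_prod:
  "(\<And>s. s \<in> S \<Longrightarrow> unimodular_hom (\<xi> s)) \<Longrightarrow> unimodular_hom (\<lambda>x. \<Prod>s\<in>S. \<xi> s x)"
  by (induction S rule: infinite_finite_induct)
    (simp_all add: unimodular_hom_one unimodular_hom_mult)

lemma has_mean_unimodular_hom:
  assumes "unimodular_hom \<xi>"
  shows "has_mean \<xi> (if \<forall>x. \<xi> x = 1 then 1 else 0)"
proof (cases "\<forall>x. \<xi> x = 1")
  case True
  then have "\<xi> = (\<lambda>_. 1)" by auto
  then show ?thesis by (simp add: has_mean_const)
next
  case False
  then obtain a where a: "\<xi> a \<noteq> 1" by blast
  note pc = precompact_translates_unimodular_hom[OF assms]
  have "mean \<xi> = mean (\<lambda>x. \<xi> (a + x))"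
    using mean_shift[OF pc, of a] by simp
  also have "\<dots> = \<xi> a * mean \<xi>"
    using assms mean_cmult[OF pc, of "\<xi> a"] by (simp add: unimodular_hom_def)
  finally have "mean \<xi> = 0"
    using a by simp
  then have "has_mean \<xi> 0"
    using has_mean_mean[OF pc] by simp
  then show ?thesis
    by (subst if_not_P[OF False])
qed

lemma power_times_exponential_tendsto_0:
  fixes \<rho> :: real
  assumes "0 \<le> \<rho>" "\<rho> < 1" "0 < d"
  shows "(\<lambda>n. (real n + 1) ^ d * \<rho> ^ n) \<longlonglongrightarrow> 0"
proof -
  \<comment> \<open>then \<open>(n + 1) ^ d * \<rho> ^ n\<close> is the \<open>d\<close>-th power of \<open>(n + 1) * \<sigma> ^ n\<close>\<close>
  define \<sigma> where "\<sigma> = root d \<rho>"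
  have \<sigma>: "0 \<le> \<sigma>" "\<sigma> < 1" "\<sigma> ^ d = \<rho>"
    using assms by (simp_all add: \<sigma>_def)
  have "(\<lambda>n. real n * \<sigma> ^ n + \<sigma> ^ n) \<longlonglongrightarrow> 0 + 0"
    using \<sigma> by (intro tendsto_add powser_times_n_limit_0 LIMSEQ_power_zero) auto
  then have "(\<lambda>n. (real n * \<sigma> ^ n + \<sigma> ^ n) ^ d) \<longlonglongrightarrow> 0 ^ d"
    using tendsto_power by fastforce
  moreover have "(real n * \<sigma> ^ n + \<sigma> ^ n) ^ d = (real n + 1) ^ d * \<rho> ^ n" for n
  proof -
    have "(real n * \<sigma> ^ n + \<sigma> ^ n) ^ d = ((real n + 1) * \<sigma> ^ n) ^ d"
      by (simp add: algebra_simps)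
    also have "\<dots> = (real n + 1) ^ d * (\<sigma> ^ d) ^ n"
      by (simp add: power_mult_distrib power_mult[symmetric] mult.commute)
    finally show ?thesis
      using \<sigma>(3) by simp
  qed
  ultimately show ?thesis
    using assms(3) by (simp add: zero_power)
qed

lemma cmod_half_one_plus:
  assumes "cmod u = 1"
  shows "(cmod ((1 + u) / 2))\<^sup>2 = 1 - (cmod (u - 1))\<^sup>2 / 4"
proof -
  have "(Re u)\<^sup>2 + (Im u)\<^sup>2 = 1"
    using assms by (simp add: cmod_def)
  then have "(cmod (1 + u))\<^sup>2 = 2 + 2 * Re u" "(cmod (u - 1))\<^sup>2 = 2 - 2 * Re u"
    unfolding cmod_power2 by (simp_all add: power2_sum power2_diff)
  moreover have "(cmod ((1 + u) / 2))\<^sup>2 = (cmod (1 + u))\<^sup>2 / 4"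
    by (simp add: norm_divide power_divide)
  ultimately show ?thesis
    by (simp add: diff_divide_distrib add_divide_distrib)
qed

text \<open>
  After rotating by \<open>t\<close> the prescribed values become \<open>1\<close>. If the rotated characters \<open>u s\<close> are never
  simultaneously close to \<open>1\<close>, the product \<open>\<Phi>\<close> of the factors \<open>(1 + u s) / 2\<close> has modulus bounded away
  from \<open>1\<close>, so the mean value of \<open>\<bar>\<Phi>\<bar>\<^sup>2\<^sup>n\<close> decays exponentially in \<open>n\<close>. On the other hand, expand \<open>\<Phi>\<^sup>n\<close>
  into monomials: it has at most \<open>(n + 1)\<close> to the power \<open>card S\<close> many of them, with nonnegative
  coefficients of sum one. By the assumption on relations, the correlation of two monomials has mean
  value \<open>0\<close> or \<open>1\<close>, and it is \<open>1\<close> on the diagonal; so by Cauchy-Schwarz the mean value of \<open>\<bar>\<Phi>\<bar>\<^sup>2\<^sup>n\<close> decays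
  only polynomially.
\<close>

theorem kronecker_approximation:
  fixes \<psi> :: "'i \<Rightarrow> 'l::ab_group_add \<Rightarrow> complex" and t :: "'i \<Rightarrow> complex"
  assumes S: "finite S" and \<psi>: "\<And>s. s \<in> S \<Longrightarrow> unimodular_hom (\<psi> s)"
    and t: "\<And>s. s \<in> S \<Longrightarrow> cmod (t s) = 1"
    and rel: "\<And>k l :: 'i \<Rightarrow> nat. (\<And>x. (\<Prod>s\<in>S. \<psi> s x ^ k s) = (\<Prod>s\<in>S. \<psi> s x ^ l s)) \<Longrightarrow>
      (\<Prod>s\<in>S. t s ^ k s) = (\<Prod>s\<in>S. t s ^ l s)"
    and \<delta>: "0 < \<delta>"
  shows "\<exists>x. \<forall>s\<in>S. cmod (\<psi> s x - t s) < \<delta>"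
proof (rule ccontr)
  assume "\<not> ?thesis"
  then have far: "\<exists>s\<in>S. \<delta> \<le> cmod (\<psi> s x - t s)" for x
    by (meson not_less)
  then have "S \<noteq> {}" by blast
  then have d0: "0 < card S"
    using S by (simp add: card_gt_0_iff)
  define u where "u s x = \<psi> s x * cnj (t s)" for s x
  have tt: "t s * cnj (t s) = 1" if "s \<in> S" for s
    using t[OF that] by (simp add: complex_norm_square[symmetric])
  have u1: "cmod (u s x) = 1" if "s \<in> S" for s x
    using \<psi>[OF that] t[OF that] by (simp add: u_def unimodular_hom_def norm_mult)
  have u_dist: "cmod (u s x - 1) = cmod (\<psi> s x - t s)" if "s \<in> S" for s x
  proof -
    have "u s x - 1 = (\<psi> s x - t s) * cnj (t s)"
      using tt[OF that] by (simp add: u_def algebra_simps)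
    then show ?thesis
      using t[OF that] by (simp add: norm_mult)
  qed
  define \<Phi> where "\<Phi> x = (\<Prod>s\<in>S. (1 + u s x) / 2)" for x
  define \<rho> where "\<rho> = 1 - \<delta>\<^sup>2 / 4"
  have factor: "(cmod ((1 + u s x) / 2))\<^sup>2 \<le> 1" if "s \<in> S" for s x
    unfolding cmod_half_one_plus[OF u1[OF that]] by simp
  have \<Phi>_le: "(cmod (\<Phi> x))\<^sup>2 \<le> \<rho>" for x
  proof -
    obtain s where s: "s \<in> S" "\<delta> \<le> cmod (\<psi> s x - t s)"
      using far by blast
    have "(cmod (\<Phi> x))\<^sup>2 = (\<Prod>s\<in>S. (cmod ((1 + u s x) / 2))\<^sup>2)"
      unfolding \<Phi>_def prod_norm[symmetric] by (simp add: prod_power_distrib)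
    also have "\<dots> = (cmod ((1 + u s x) / 2))\<^sup>2 * (\<Prod>s\<in>S - {s}. (cmod ((1 + u s x) / 2))\<^sup>2)"
      by (rule prod.remove[OF S s(1)])
    also have "\<dots> \<le> (cmod ((1 + u s x) / 2))\<^sup>2 * 1"
      using factor by (intro mult_left_mono prod_le_1) auto
    also have "\<dots> = 1 - (cmod (\<psi> s x - t s))\<^sup>2 / 4"
      unfolding cmod_half_one_plus[OF u1[OF s(1)]] u_dist[OF s(1)] by simp
    also have "\<dots> \<le> \<rho>"
      unfolding \<rho>_def using s(2) \<delta> by (simp add: power_mono)
    finally show ?thesis .
  qed
  have \<rho>: "0 \<le> \<rho>" "\<rho> < 1"
    using order_trans[OF zero_le_power2 \<Phi>_le] \<delta> by (auto simp: \<rho>_def)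
  have lower: "1 / (real n + 1) ^ card S \<le> \<rho> ^ n" for n
  proof -
    define P where "P = PiE S (\<lambda>_. {..n})"
    have P: "finite P" "card P = (n + 1) ^ card S"
      unfolding P_def using S by (simp_all add: finite_PiE card_PiE)
    define c where "c p = (\<Prod>s\<in>S. real (n choose p s) / 2 ^ n)" for p :: "'i \<Rightarrow> nat"
    define m where "m p x = (\<Prod>s\<in>S. u s x ^ p s)" for p :: "'i \<Rightarrow> nat" and x
    have c0: "0 \<le> c p" for p
      unfolding c_def by (intro prod_nonneg) auto
    have "(\<Sum>p\<in>P. c p) = (\<Prod>s\<in>S. \<Sum>j\<le>n. real (n choose j) / 2 ^ n)"
      unfolding c_def P_def by (rule prod_sum_PiE[symmetric]) (use S in auto)
    also have "(\<Sum>j\<le>n. real (n choose j) / 2 ^ n) = 1"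
      unfolding sum_divide_distrib[symmetric] of_nat_sum[symmetric] choose_row_sum by simp
    finally have c_sum: "(\<Sum>p\<in>P. c p) = 1" by simp
    have expand: "\<Phi> x ^ n = (\<Sum>p\<in>P. complex_of_real (c p) * m p x)" for x
    proof -
      have "\<Phi> x ^ n = (\<Prod>s\<in>S. ((1 + u s x) / 2) ^ n)"
        unfolding \<Phi>_def by (rule prod_power_distrib)
      also have "\<dots> = (\<Prod>s\<in>S. \<Sum>j\<le>n. complex_of_real (real (n choose j) / 2 ^ n) * u s x ^ j)"
      proof (rule prod.cong[OF refl])
        fix s
        have "((1 + u s x) / 2) ^ n = (u s x + 1) ^ n / 2 ^ n"
          by (simp add: power_divide add.commute)
        also have "(u s x + 1) ^ n = (\<Sum>j\<le>n. of_nat (n choose j) * u s x ^ j)"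
          by (simp add: binomial_ring)
        finally show "((1 + u s x) / 2) ^ n =
            (\<Sum>j\<le>n. complex_of_real (real (n choose j) / 2 ^ n) * u s x ^ j)"
          by (simp add: sum_divide_distrib)
      qed
      also have "\<dots> = (\<Sum>p\<in>P. \<Prod>s\<in>S. complex_of_real (real (n choose p s) / 2 ^ n) * u s x ^ p s)"
        unfolding P_def by (rule prod_sum_PiE) (use S in auto)
      also have "\<dots> = (\<Sum>p\<in>P. complex_of_real (c p) * m p x)"
        by (simp only: c_def m_def of_real_prod prod.distrib)
      finally show ?thesis .
    qed
    have correlation: "\<exists>v::real. has_mean (\<lambda>x. m p x * cnj (m r x)) (complex_of_real v)
        \<and> 0 \<le> v \<and> (p = r \<longrightarrow> v = 1)" for p r
    proof -
      define \<eta> where "\<eta> x = (\<Prod>s\<in>S. \<psi> s x ^ p s) * cnj (\<Prod>s\<in>S. \<psi> s x ^ r s)" for x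
      define \<kappa> where "\<kappa> = cnj (\<Prod>s\<in>S. t s ^ p s) * (\<Prod>s\<in>S. t s ^ r s)"
      have up: "unimodular_hom (\<lambda>x. \<Prod>s\<in>S. \<psi> s x ^ q s)" for q :: "'i \<Rightarrow> nat"
        by (intro unimodular_hom_prod unimodular_hom_power \<psi>)
      have \<eta>: "unimodular_hom \<eta>"
        unfolding \<eta>_def by (intro unimodular_hom_mult unimodular_hom_cnj up)
      have "m p x * cnj (m r x) = \<kappa> * \<eta> x" for x
        unfolding m_def u_def \<kappa>_def \<eta>_def by (simp add: power_mult_distrib prod.distrib mult_ac)
      moreover have "has_mean (\<lambda>x. \<kappa> * \<eta> x) (\<kappa> * (if \<forall>x. \<eta> x = 1 then 1 else 0))"
        by (rule has_mean_bounded_linear[OF has_mean_unimodular_hom[OF \<eta>]])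
          (rule bounded_linear_mult_right)
      ultimately have hm: "has_mean (\<lambda>x. m p x * cnj (m r x)) (\<kappa> * (if \<forall>x. \<eta> x = 1 then 1 else 0))"
        by simp
      show ?thesis
      proof (cases "\<forall>x. \<eta> x = 1")
        case True
        have "(\<Prod>s\<in>S. \<psi> s x ^ p s) = (\<Prod>s\<in>S. \<psi> s x ^ r s)" for x
        proof -
          have "(\<Prod>s\<in>S. \<psi> s x ^ p s) * cnj (\<Prod>s\<in>S. \<psi> s x ^ r s) = 1"
            using True unfolding \<eta>_def by blast
          then show ?thesis
            using unimodular_hom_mult_cnj(2)[OF up[of r], of x]
            by (metis (no_types, lifting) mult.assoc mult.left_neutral mult.right_neutral)
        qed
        then have "(\<Prod>s\<in>S. t s ^ p s) = (\<Prod>s\<in>S. t s ^ r s)"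
          by (rule rel)
        then have "\<kappa> = (\<Prod>s\<in>S. (t s * cnj (t s)) ^ r s)"
          unfolding \<kappa>_def by (simp add: power_mult_distrib prod.distrib)
        also have "\<dots> = 1"
          by (simp add: tt)
        finally show ?thesis
          using hm True by (intro exI[of _ 1]) simp
      next
        case False
        have "\<eta> x = 1" if "p = r" for x
          unfolding \<eta>_def that by (rule unimodular_hom_mult_cnj(1)[OF up])
        then show ?thesis
          using hm False by (intro exI[of _ 0]) auto
      qed
    qed
    then obtain v where v: "\<And>p r. has_mean (\<lambda>x. m p x * cnj (m r x)) (complex_of_real (v p r))"
      "\<And>p r. 0 \<le> v p r" "\<And>p. v p p = (1::real)"
      by metis
    define V where "V = (\<Sum>p\<in>P. \<Sum>r\<in>P. c p * c r * v p r)"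
    have "has_mean (\<lambda>x. \<Sum>p\<in>P. \<Sum>r\<in>P. complex_of_real (c p * c r) * (m p x * cnj (m r x)))
        (\<Sum>p\<in>P. \<Sum>r\<in>P. complex_of_real (c p * c r) * complex_of_real (v p r))"
      by (intro has_mean_sum P has_mean_bounded_linear[OF v(1)] bounded_linear_mult_right)
    moreover have "(\<Sum>p\<in>P. \<Sum>r\<in>P. complex_of_real (c p * c r) * (m p x * cnj (m r x)))
        = \<Phi> x ^ n * cnj (\<Phi> x ^ n)" for x
      unfolding expand by (simp add: sum_product mult_ac)
    ultimately have "has_mean (\<lambda>x. \<Phi> x ^ n * cnj (\<Phi> x ^ n)) (complex_of_real V)"
      by (simp add: V_def)
    then have "norm (complex_of_real V - 0) \<le> \<rho> ^ n"
    proof (rule norm_has_mean_le)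
      fix x
      have "norm (\<Phi> x ^ n * cnj (\<Phi> x ^ n) - 0) = ((cmod (\<Phi> x))\<^sup>2) ^ n"
        by (simp add: norm_mult norm_power power2_eq_square power_mult_distrib)
      also have "\<dots> \<le> \<rho> ^ n"
        by (intro power_mono \<Phi>_le) simp
      finally show "norm (\<Phi> x ^ n * cnj (\<Phi> x ^ n) - 0) \<le> \<rho> ^ n" .
    qed
    then have V_le: "V \<le> \<rho> ^ n"
      by (simp add: abs_le_iff)
    have "1 = (\<Sum>p\<in>P. c p)\<^sup>2"
      using c_sum by simp
    also have "\<dots> \<le> (\<Sum>p\<in>P. (c p)\<^sup>2) * card P"
      by (rule sum_squared_le_sum_of_squares)
    also have "(\<Sum>p\<in>P. (c p)\<^sup>2) \<le> V"
      unfolding V_def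
    proof (rule sum_mono)
      fix p assume p: "p \<in> P"
      have "(c p)\<^sup>2 = c p * c p * v p p"
        by (simp add: v power2_eq_square)
      also have "\<dots> \<le> (\<Sum>r\<in>P. c p * c r * v p r)"
        using p P(1) c0 v(2) by (intro member_le_sum) auto
      finally show "(c p)\<^sup>2 \<le> (\<Sum>r\<in>P. c p * c r * v p r)" .
    qed
    finally have "1 \<le> V * (real n + 1) ^ card S"
      unfolding P(2) by (simp add: mult_right_mono add.commute)
    then have "1 / (real n + 1) ^ card S \<le> V"
      by (simp add: pos_divide_le_eq)
    then show ?thesis
      using V_le by linarith
  qed
  have "1 \<le> (real n + 1) ^ card S * \<rho> ^ n" for n
  proof -
    have "0 < (real n + 1) ^ card S" by simp
    then show ?thesis
      using lower[of n] by (simp add: pos_divide_le_eq mult.commute)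
  qed
  then have "1 \<le> (0::real)"
    by (intro tendsto_lowerbound[OF power_times_exponential_tendsto_0[OF \<rho> d0]]) auto
  then show False by simp
qed

section \<open>Almost periodic functions on a topological group\<close>

lemma characters_iff: "\<xi> \<in> characters \<longleftrightarrow> continuous_on UNIV \<xi> \<and> unimodular_hom \<xi>"
  by (auto simp: characters_def circle_group_def unimodular_hom_def)

lemma almost_periodic_translate_bcontfun:
  assumes "\<gamma> \<in> almost_periodic"
  shows "(\<lambda>x. \<gamma> (h + x)) \<in> bcontfun"
    "apply_bcontfun (Bcontfun (\<lambda>x. \<gamma> (h + x))) = (\<lambda>x. \<gamma> (h + x))"
proof -
  have "continuous_on UNIV \<gamma>" "bounded (range \<gamma>)"
    using assms by (auto simp: almost_periodic_def)
  then have "continuous_on UNIV (\<lambda>x. \<gamma> (h + x))" "bounded (range (\<lambda>x. \<gamma> (h + x)))"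
    by (auto intro!: continuous_on_compose2[of UNIV \<gamma>] continuous_intros elim!: bounded_subset)
  then show bc: "(\<lambda>x. \<gamma> (h + x)) \<in> bcontfun"
    by (simp add: bcontfun_def)
  show "apply_bcontfun (Bcontfun (\<lambda>x. \<gamma> (h + x))) = (\<lambda>x. \<gamma> (h + x))"
    by (rule Bcontfun_inverse[OF bc])
qed

lemma almost_periodic_precompact_translates:
  fixes \<gamma> :: "'a::topological_ab_group_add \<Rightarrow> complex"
  assumes \<gamma>: "\<gamma> \<in> almost_periodic"
  shows "precompact_translates \<gamma>"
  unfolding precompact_translates_def
proof (intro allI impI)
  fix e :: real assume e: "0 < e"
  define T where "T h = Bcontfun (\<lambda>x. \<gamma> (h + x))" for h
  have T: "apply_bcontfun (T h) x = \<gamma> (h + x)" for h x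
    unfolding T_def almost_periodic_translate_bcontfun(2)[OF \<gamma>] ..
  have "compact (closure (range T))"
    using \<gamma> unfolding almost_periodic_def T_def[abs_def] by blast
  then have "\<exists>K. finite K \<and> closure (range T) \<subseteq> (\<Union>z\<in>K. ball z (e / 2))"
    using e unfolding compact_eq_totally_bounded by simp
  then obtain K where K: "finite K" "closure (range T) \<subseteq> (\<Union>z\<in>K. ball z (e / 2))"
    by blast
  have "\<exists>z\<in>K. dist z (T h) < e / 2" for h
  proof -
    have "T h \<in> closure (range T)"
      by (rule subsetD[OF closure_subset]) simp
    then have "T h \<in> (\<Union>z\<in>K. ball z (e / 2))"
      using K(2) by (rule subsetD[rotated])
    then show ?thesis
      unfolding mem_ball UN_iff .
  qed
  then obtain m where m: "\<And>h. m h \<in> K" "\<And>h. dist (m h) (T h) < e / 2"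
    by metis
  define c where "c = (\<lambda>h. to_nat_on K (m h))"
  have "range c \<subseteq> to_nat_on K ` K"
    using m(1) unfolding c_def by auto
  then have "finite (range c)"
    using K(1) by (meson finite_imageI finite_subset)
  moreover have "norm (\<gamma> (h + x) - \<gamma> (k + x)) \<le> e" if "c h = c k" for h k x
  proof -
    have "inj_on (to_nat_on K) K"
      using K(1) by (simp add: countable_finite inj_on_to_nat_on)
    then have "m h = m k"
      using that m(1) unfolding c_def by (simp add: inj_on_eq_iff)
    then have "dist (T h) (T k) < e"
      using m(2)[of h] m(2)[of k] dist_triangle_half_r[of "m h" "T h" e "T k"] by simp
    then show ?thesis
      using dist_fun_lt_imp_dist_val_lt[of "T h" "T k" e x] by (simp add: T dist_norm)
  qed
  ultimately show "\<exists>c::'a \<Rightarrow> nat. finite (range c) \<and>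
       (\<forall>h k. c h = c k \<longrightarrow> (\<forall>x. norm (\<gamma> (h + x) - \<gamma> (k + x)) \<le> e))"
    by blast
qed

lemma precompact_translates_finite_net:
  fixes f :: "'a::ab_group_add \<Rightarrow> complex"
  assumes "precompact_translates f" "0 < e"
  shows "\<exists>F. finite F \<and> (\<forall>h. \<exists>a\<in>F. \<forall>x. norm (f (h + x) - f (a + x)) \<le> e)"
  using precompact_translates_net[OF assms] by metis

text \<open>
  Completeness for an arbitrary topological space as domain: the uniform limit of a Cauchy sequence
  of bounded continuous functions is again bounded and continuous.
\<close>

lemma bcontfun_closed_imp_complete:
  fixes S :: "('a::topological_space \<Rightarrow>\<^sub>C 'b::complete_space) set"
  assumes "closed S"
  shows "complete S"
proof (rule completeI)
  fix f :: "nat \<Rightarrow> 'a \<Rightarrow>\<^sub>C 'b"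
  assume f: "\<forall>n. f n \<in> S" "Cauchy f"
  have "\<forall>e>0. \<exists>N. \<forall>m n x. N \<le> m \<and> N \<le> n \<and> True \<longrightarrow> dist (f m x) (f n x) < e"
    using f(2) dist_fun_lt_imp_dist_val_lt unfolding Cauchy_def by metis
  then obtain g where "uniform_limit UNIV (\<lambda>n. apply_bcontfun (f n)) g sequentially"
    unfolding uniformly_convergent_eq_cauchy[symmetric] uniform_limit_sequentially_iff by auto
  from uniform_limit_bcontfunE[OF this sequentially_bot] obtain l where "f \<longlonglongrightarrow> l"
    by metis
  then show "\<exists>l\<in>S. f \<longlonglongrightarrow> l"
    using f(1) assms unfolding closed_sequential_limits by blast
qed

lemma almost_periodicI:
  fixes \<phi> :: "'a::topological_ab_group_add \<Rightarrow> complex"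
  assumes cont: "continuous_on UNIV \<phi>" and pc: "precompact_translates \<phi>"
  shows "\<phi> \<in> almost_periodic"
proof -
  define T where "T h = Bcontfun (\<lambda>x. \<phi> (h + x))" for h
  obtain B where B: "\<And>x. norm (\<phi> x) \<le> B"
    using precompact_translates_bounded[OF pc] by blast
  have T: "apply_bcontfun (T h) x = \<phi> (h + x)" for h x
  proof -
    have "(\<lambda>x. \<phi> (h + x)) \<in> bcontfun"
      by (rule bcontfun_normI[OF _ B])
        (intro continuous_on_compose2[OF cont] continuous_intros subset_UNIV)
    then show ?thesis
      unfolding T_def by (simp add: Bcontfun_inverse)
  qed
  have "\<exists>K. finite K \<and> closure (range T) \<subseteq> (\<Union>z\<in>K. ball z e)" if e: "0 < e" for e
  proof -
    obtain F where F: "finite F" "\<And>h. \<exists>a\<in>F. \<forall>x. norm (\<phi> (h + x) - \<phi> (a + x)) \<le> e / 2"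
      using precompact_translates_finite_net[OF pc half_gt_zero[OF e]] by auto
    have "range T \<subseteq> (\<Union>a\<in>F. cball (T a) (e / 2))"
    proof clarify
      fix h
      obtain a where a: "a \<in> F" "\<forall>x. norm (\<phi> (h + x) - \<phi> (a + x)) \<le> e / 2"
        using F(2) by blast
      have "dist (T a) (T h) \<le> e / 2"
        by (rule dist_bound) (use a(2) in \<open>simp add: T dist_norm norm_minus_commute\<close>)
      then show "T h \<in> (\<Union>a\<in>F. cball (T a) (e / 2))"
        using a(1) by auto
    qed
    then have "closure (range T) \<subseteq> (\<Union>a\<in>F. cball (T a) (e / 2))"
      using F(1) by (intro closure_minimal closed_UN) auto
    also have "\<dots> \<subseteq> (\<Union>z\<in>T ` F. ball z e)"
      using e by force
    finally show ?thesis
      using F(1) by blast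
  qed
  moreover have "complete (closure (range T))"
    by (intro bcontfun_closed_imp_complete closed_closure)
  ultimately have "compact (closure (range T))"
    unfolding compact_eq_totally_bounded by blast
  then show ?thesis
    using cont B unfolding almost_periodic_def T_def[abs_def] bounded_iff by auto
qed

lemma continuous_on_UNIV_iff_tendsto_nhds:
  "continuous_on UNIV f \<longleftrightarrow> (\<forall>x. (f \<longlongrightarrow> f x) (nhds x))"
proof
  assume f: "continuous_on UNIV f"
  show "\<forall>x. (f \<longlongrightarrow> f x) (nhds x)"
  proof (intro allI topological_tendstoI)
    fix x S assume "open S" "f x \<in> S"
    then have "open (f -` S)" "x \<in> f -` S"
      using f by (auto intro: open_vimage)
    then show "\<forall>\<^sub>F y in nhds x. f y \<in> S"
      unfolding eventually_nhds by blast
  qed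
next
  assume "\<forall>x. (f \<longlongrightarrow> f x) (nhds x)"
  then show "continuous_on UNIV f"
    unfolding continuous_on_def using tendsto_mono[OF at_within_le_nhds] by blast
qed

text \<open>
  On the totally bounded set of translates, pointwise closeness at finitely many points implies
  uniform closeness. For every member \<open>a\<close> of a finite net whose translate is far from that of \<open>x0\<close>,
  choose a point \<open>w a\<close> that witnesses this; by continuity at these points, \<open>x\<close> near \<open>x0\<close> is not
  represented by such a member.
\<close>

lemma precompact_translates_uniformly_continuous:
  fixes f :: "'a::topological_ab_group_add \<Rightarrow> complex"
  assumes cont: "continuous_on UNIV f" and pc: "precompact_translates f" and e: "0 < e"
  shows "\<forall>\<^sub>F x in nhds x0. \<forall>y. cmod (f (x + y) - f (x0 + y)) \<le> e"
proof -
  have e4: "0 < e / 4" using e by simp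
  obtain F where F: "finite F" "\<And>h. \<exists>a\<in>F. \<forall>x. norm (f (h + x) - f (a + x)) \<le> e / 4"
    using precompact_translates_finite_net[OF pc e4] by auto
  define F' where "F' = {a\<in>F. \<exists>y. cmod (f (a + y) - f (x0 + y)) > 3 * e / 4}"
  have "\<forall>a\<in>F'. \<exists>y. cmod (f (a + y) - f (x0 + y)) > 3 * e / 4"
    by (simp add: F'_def)
  from bchoice[OF this] obtain w where w: "\<And>a. a \<in> F' \<Longrightarrow> cmod (f (a + w a) - f (x0 + w a)) > 3 * e / 4"
    by blast
  have "\<forall>\<^sub>F x in nhds x0. \<forall>a\<in>F'. cmod (f (x + w a) - f (x0 + w a)) < e / 4"
  proof (rule eventually_ball_finite)
    show "finite F'"
      using F(1) by (simp add: F'_def)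
    show "\<forall>a\<in>F'. \<forall>\<^sub>F x in nhds x0. cmod (f (x + w a) - f (x0 + w a)) < e / 4"
    proof
      fix a
      have "continuous_on UNIV (\<lambda>x. f (x + w a))"
        by (intro continuous_on_compose2[OF cont] continuous_intros subset_UNIV)
      then have "((\<lambda>x. f (x + w a)) \<longlongrightarrow> f (x0 + w a)) (nhds x0)"
        unfolding continuous_on_UNIV_iff_tendsto_nhds by blast
      then show "\<forall>\<^sub>F x in nhds x0. cmod (f (x + w a) - f (x0 + w a)) < e / 4"
        using e by (auto dest!: tendstoD[of _ _ _ "e/4"] simp: dist_norm)
    qed
  qed
  then show ?thesis
  proof eventually_elim
    case (elim x)
    obtain a where a: "a \<in> F" "\<And>y. norm (f (x + y) - f (a + y)) \<le> e / 4"
      using F(2) by blast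
    have "a \<notin> F'"
    proof
      assume a': "a \<in> F'"
      have "cmod (f (a + w a) - f (x0 + w a)) \<le>
          cmod (f (x + w a) - f (a + w a)) + cmod (f (x + w a) - f (x0 + w a))"
        using norm_triangle_ineq4[of "f (x + w a) - f (x0 + w a)" "f (x + w a) - f (a + w a)"] by simp
      then show False
        using w[OF a'] a(2)[of "w a"] bspec[OF elim a'] e by linarith
    qed
    then have near: "cmod (f (a + y) - f (x0 + y)) \<le> 3 * e / 4" for y
      using a(1) unfolding F'_def by (auto simp: not_less)
    have "cmod (f (x + y) - f (x0 + y)) \<le> e / 4 + 3 * e / 4" for y
      using norm_triangle_le[OF add_mono[OF a(2)[of y] near[of y]]] by simp
    then show ?case by simp
  qed
qed

lemma unimodular_hom_coefficient_shift:
  assumes f: "precompact_translates f" and \<xi>: "unimodular_hom \<xi>"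
  shows "mean (\<lambda>x. f (a + x) * cnj (\<xi> x)) = \<xi> a * mean (\<lambda>x. f x * cnj (\<xi> x))"
proof -
  note pc = precompact_translates_unimodular_hom[OF \<xi>]
  have fc: "precompact_translates (\<lambda>x. f x * cnj (\<xi> x))"
    by (intro precompact_translates_intros f pc)
  have "f (a + x) * cnj (\<xi> x) = \<xi> a * (f (a + x) * cnj (\<xi> (a + x)))" for x
  proof -
    have "\<xi> a * (f (a + x) * cnj (\<xi> (a + x))) = (\<xi> a * cnj (\<xi> a)) * (f (a + x) * cnj (\<xi> x))"
      using \<xi> by (simp add: unimodular_hom_def mult_ac)
    also have "\<dots> = f (a + x) * cnj (\<xi> x)"
      by (simp add: unimodular_hom_mult_cnj[OF \<xi>])
    finally show ?thesis by (rule sym)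
  qed
  then have "mean (\<lambda>x. f (a + x) * cnj (\<xi> x)) = mean (\<lambda>x. \<xi> a * (f (a + x) * cnj (\<xi> (a + x))))"
    by (intro arg_cong[of _ _ mean] ext)
  also have "\<dots> = \<xi> a * mean (\<lambda>x. f x * cnj (\<xi> x))"
    using mean_cmult[OF precompact_translates_shift[OF fc, of a]] mean_shift[OF fc, of a] by simp
  finally show ?thesis .
qed

text \<open>
  Translating \<open>f\<close> multiplies the coefficient at \<open>\<xi>\<close> by a value of \<open>\<xi>\<close>, and the translates of \<open>f\<close> depend
  continuously on the translation parameter.
\<close>

lemma unimodular_hom_continuous:
  fixes f :: "'a::topological_ab_group_add \<Rightarrow> complex"
  assumes cont: "continuous_on UNIV f" and pc: "precompact_translates f"
    and \<xi>: "unimodular_hom \<xi>" and nz: "mean (\<lambda>x. f x * cnj (\<xi> x)) \<noteq> 0"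
  shows "\<xi> \<in> characters"
proof -
  define c where "c = mean (\<lambda>x. f x * cnj (\<xi> x))"
  note pcx = precompact_translates_unimodular_hom[OF \<xi>]
  have "((\<lambda>x. \<xi> x * c) \<longlongrightarrow> \<xi> x0 * c) (nhds x0)" for x0
  proof (rule tendstoI)
    fix e :: real assume e: "0 < e"
    have "\<forall>\<^sub>F x in nhds x0. \<forall>y. cmod (f (x + y) - f (x0 + y)) \<le> e / 2"
      using precompact_translates_uniformly_continuous[OF cont pc, of "e/2"] e by simp
    then show "\<forall>\<^sub>F x in nhds x0. dist (\<xi> x * c) (\<xi> x0 * c) < e"
    proof eventually_elim
      case (elim x)
      have "\<xi> x * c - \<xi> x0 * c = mean (\<lambda>y. f (x + y) * cnj (\<xi> y) - f (x0 + y) * cnj (\<xi> y))"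
        unfolding c_def unimodular_hom_coefficient_shift[OF pc \<xi>, symmetric]
        by (intro mean_diff[symmetric] precompact_translates_intros pc pcx)
      also have "cmod \<dots> \<le> e / 2"
      proof (rule norm_mean_le)
        show "precompact_translates (\<lambda>y. f (x + y) * cnj (\<xi> y) - f (x0 + y) * cnj (\<xi> y))"
          by (intro precompact_translates_intros pc pcx)
        show "cmod (f (x + y) * cnj (\<xi> y) - f (x0 + y) * cnj (\<xi> y)) \<le> e / 2" for y
          using elim \<xi> by (simp add: unimodular_hom_def norm_mult flip: left_diff_distrib)
      qed
      also have "\<dots> < e" using e by simp
      finally show ?case by (simp add: dist_norm)
    qed
  qed
  then have "continuous_on UNIV (\<lambda>x. \<xi> x * c)"
    unfolding continuous_on_UNIV_iff_tendsto_nhds by blast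
  then have "continuous_on UNIV (\<lambda>x. \<xi> x * c / c)"
    by (rule continuous_on_divide[OF _ continuous_on_const]) (use nz in \<open>simp add: c_def\<close>)
  moreover have "(\<lambda>x. \<xi> x * c / c) = \<xi>"
    using nz by (simp add: c_def)
  ultimately have "continuous_on UNIV \<xi>"
    by (simp only:)
  then show ?thesis
    using \<xi> by (simp add: characters_iff)
qed

text \<open>
  Suppose the claim fails. Then for all finite sets of spectral characters and all tolerances there
  are translations that are invisible to these characters but move \<open>\<gamma>\<close> by more than \<open>e\<close>. The closures
  of these sets of translates have the finite intersection property in the compact hull, so they
  share a member \<open>U\<close>. Its Fourier coefficients agree with those of \<open>\<gamma>\<close>, hence \<open>U = \<gamma>\<close>; but \<open>U\<close> has
  distance at least \<open>e\<close> from \<open>\<gamma>\<close>.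
\<close>

lemma almost_periodic_bohr_neighbourhood_at_0:
  fixes \<gamma> :: "'a::topological_ab_group_add \<Rightarrow> complex"
  assumes \<gamma>: "\<gamma> \<in> almost_periodic" and e: "0 < e"
  shows "\<exists>S n. finite S \<and> S \<subseteq> {\<xi> \<in> characters. mean (\<lambda>x. \<gamma> x * cnj (\<xi> x)) \<noteq> 0} \<and>
    (\<forall>c. (\<forall>\<xi>\<in>S. cmod (\<xi> c - 1) < 1 / real (Suc n)) \<longrightarrow> (\<forall>x. cmod (\<gamma> (c + x) - \<gamma> x) \<le> e))"
proof (rule ccontr)
  define spec where "spec = {\<xi> \<in> characters. mean (\<lambda>x. \<gamma> x * cnj (\<xi> x)) \<noteq> 0}"
  assume "\<not> ?thesis"
  note not_ex = this[folded spec_def]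
  have neg: "\<exists>c. (\<forall>\<xi>\<in>S. cmod (\<xi> c - 1) < 1 / real (Suc n)) \<and> \<not> (\<forall>x. cmod (\<gamma> (c + x) - \<gamma> x) \<le> e)"
    if S: "finite S" "S \<subseteq> spec" for S n
  proof (rule ccontr)
    assume "\<not> ?thesis"
    then have "\<forall>c. (\<forall>\<xi>\<in>S. cmod (\<xi> c - 1) < 1 / real (Suc n)) \<longrightarrow> (\<forall>x. cmod (\<gamma> (c + x) - \<gamma> x) \<le> e)"
      by blast
    with S have "\<exists>S n. finite S \<and> S \<subseteq> spec \<and>
        (\<forall>c. (\<forall>\<xi>\<in>S. cmod (\<xi> c - 1) < 1 / real (Suc n)) \<longrightarrow> (\<forall>x. cmod (\<gamma> (c + x) - \<gamma> x) \<le> e))"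
      by (intro exI[of _ S] exI[of _ n]) simp
    then show False
      using not_ex by contradiction
  qed
  have pc: "precompact_translates \<gamma>"
    by (rule almost_periodic_precompact_translates[OF \<gamma>])
  define T where "T h = Bcontfun (\<lambda>x. \<gamma> (h + x))" for h
  have T: "apply_bcontfun (T h) x = \<gamma> (h + x)" for h x
    unfolding T_def almost_periodic_translate_bcontfun(2)[OF \<gamma>] ..
  define N where "N S n = {c. (\<forall>\<xi>\<in>S. cmod (\<xi> c - 1) < 1 / real (Suc n)) \<and>
      \<not> (\<forall>x. cmod (\<gamma> (c + x) - \<gamma> x) \<le> e)}" for S n
  define I where "I = {(S, n :: nat). finite S \<and> S \<subseteq> spec}"
  have "compact (closure (range T))"
    using \<gamma> unfolding almost_periodic_def T_def[abs_def] by blast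
  then have "closure (range T) \<inter> \<Inter> ((\<lambda>(S, n). closure (T ` N S n)) ` I) \<noteq> {}"
  proof (rule compact_imp_fip)
    fix F' assume F': "finite F'" "F' \<subseteq> (\<lambda>(S, n). closure (T ` N S n)) ` I"
    obtain J where J: "J \<subseteq> I" "finite J" "F' = (\<lambda>(S, n). closure (T ` N S n)) ` J"
      using finite_subset_image[OF F'] by blast
    define U where "U = (\<Union>(S, n)\<in>J. S)"
    define M where "M = Max (insert 0 (snd ` J))"
    have U: "finite U" "U \<subseteq> spec"
      using J unfolding U_def I_def by auto
    obtain c where c: "\<forall>\<xi>\<in>U. cmod (\<xi> c - 1) < 1 / real (Suc M)" "\<not> (\<forall>x. cmod (\<gamma> (c + x) - \<gamma> x) \<le> e)"
      using neg[OF U, of M] by blast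
    have "T c \<in> closure (T ` N S n)" if Sn: "(S, n) \<in> J" for S n
    proof -
      have "n \<in> insert 0 (snd ` J)"
        using Sn by force
      then have "n \<le> M"
        unfolding M_def using J(2) by (intro Max_ge) auto
      then have "1 / real (Suc M) \<le> 1 / real (Suc n)"
        by (simp add: frac_le)
      moreover have "S \<subseteq> U"
        using Sn unfolding U_def by auto
      ultimately have "c \<in> N S n"
        using c unfolding N_def by fastforce
      then show ?thesis
        by (intro subsetD[OF closure_subset] imageI)
    qed
    then have "T c \<in> \<Inter> F'"
      unfolding J(3) by auto
    moreover have "T c \<in> closure (range T)"
      by (rule subsetD[OF closure_subset]) simp
    ultimately show "closure (range T) \<inter> \<Inter> F' \<noteq> {}"
      by blast
  qed auto
  then obtain u where u: "u \<in> closure (range T)" "\<And>S n. finite S \<Longrightarrow> S \<subseteq> spec \<Longrightarrow> u \<in> closure (T ` N S n)"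
    unfolding I_def by fastforce
  define U where "U = apply_bcontfun u"
  have near: "\<exists>c\<in>N S n. \<forall>x. cmod (\<gamma> (c + x) - U x) < \<eta>" if S: "finite S" "S \<subseteq> spec" and "0 < \<eta>" for S n \<eta>
  proof -
    obtain y where y: "y \<in> T ` N S n" "dist y u < \<eta>"
      using u(2)[OF S, of n] \<open>0 < \<eta>\<close> unfolding closure_approachable by blast
    then obtain c where "c \<in> N S n" "y = T c" by blast
    moreover have "dist (T c) u < \<eta> \<Longrightarrow> cmod (\<gamma> (c + x) - U x) < \<eta>" for x
      using dist_fun_lt_imp_dist_val_lt[of "T c" u \<eta> x] by (simp add: T U_def dist_norm)
    ultimately show ?thesis
      using y(2) by blast
  qed
  have U: "precompact_translates U"
    unfolding precompact_translates_def
  proof (intro allI impI)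
    fix e :: real assume e: "0 < e"
    obtain c where c: "\<And>x. cmod (\<gamma> (c + x) - U x) < e / 3"
      using near[of "{}" "e/3" 0] e by auto
    obtain col :: "'a \<Rightarrow> nat" where col: "finite (range col)"
      "\<And>h k x. col h = col k \<Longrightarrow> norm (\<gamma> (c + (h + x)) - \<gamma> (c + (k + x))) \<le> e / 3"
      using precompact_translatesE[OF precompact_translates_shift[OF pc, of c], of "e/3"] e by auto
    have "norm (U (h + x) - U (k + x)) \<le> e" if "col h = col k" for h k x
    proof -
      have "norm (U (h + x) - U (k + x)) \<le>
          norm (\<gamma> (c + (h + x)) - U (h + x)) + (norm (\<gamma> (c + (h + x)) - \<gamma> (c + (k + x)))
          + norm (\<gamma> (c + (k + x)) - U (k + x)))"
        by norm
      then show ?thesis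
        using c[of "h + x"] c[of "k + x"] col(2)[OF that, of x] by linarith
    qed
    then show "\<exists>c::'a \<Rightarrow> nat. finite (range c) \<and> (\<forall>h k. c h = c k \<longrightarrow> (\<forall>x. norm (U (h + x) - U (k + x)) \<le> e))"
      using col(1) by blast
  qed
  have coeff: "mean (\<lambda>x. U x * cnj (\<xi> x)) = mean (\<lambda>x. \<gamma> x * cnj (\<xi> x))" if \<xi>: "\<xi> \<in> characters" for \<xi>
  proof -
    define g where "g = mean (\<lambda>x. \<gamma> x * cnj (\<xi> x))"
    have u\<xi>: "unimodular_hom \<xi>"
      using \<xi> by (simp add: characters_iff)
    note pcx = precompact_translates_unimodular_hom[OF u\<xi>]
    \<comment> \<open>for \<open>\<xi>\<close> outside the spectrum both coefficients vanish, since each translate of \<open>\<gamma>\<close> has coefficient \<open>0\<close> at \<open>\<xi>\<close>\<close>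
    define S where "S = (if \<xi> \<in> spec then {\<xi>} else {})"
    have S: "finite S" "S \<subseteq> spec"
      by (auto simp: S_def)
    have "cmod (mean (\<lambda>x. U x * cnj (\<xi> x)) - g) \<le> 0 + \<eta>" if \<eta>: "0 < \<eta>" for \<eta>
    proof -
      obtain n where "(cmod g + 1) * 2 / \<eta> < real (Suc n)"
        by (meson lessI less_trans of_nat_less_iff reals_Archimedean2)
      then have "2 * (cmod g + 1) < \<eta> * real (Suc n)"
        using \<eta> by (simp add: pos_divide_less_eq mult.commute)
      then have n: "(cmod g + 1) * (1 / real (Suc n)) \<le> \<eta> / 2"
        by (simp add: field_simps)
      obtain c where c: "c \<in> N S n" "\<And>x. cmod (\<gamma> (c + x) - U x) < \<eta> / 2"
        using near[OF S, of "\<eta>/2" n] \<eta> by auto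
      have "mean (\<lambda>x. U x * cnj (\<xi> x)) - \<xi> c * g = mean (\<lambda>x. U x * cnj (\<xi> x) - \<gamma> (c + x) * cnj (\<xi> x))"
        unfolding g_def unimodular_hom_coefficient_shift[OF pc u\<xi>, symmetric]
        by (intro mean_diff[symmetric] precompact_translates_intros pc pcx U)
      also have "cmod \<dots> \<le> \<eta> / 2"
      proof (rule norm_mean_le)
        show "precompact_translates (\<lambda>x. U x * cnj (\<xi> x) - \<gamma> (c + x) * cnj (\<xi> x))"
          by (intro precompact_translates_intros pc pcx U)
        show "cmod (U x * cnj (\<xi> x) - \<gamma> (c + x) * cnj (\<xi> x)) \<le> \<eta> / 2" for x
          using c(2)[of x] u\<xi>
          by (simp add: unimodular_hom_def norm_mult norm_minus_commute flip: left_diff_distrib)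
      qed
      finally have 1: "cmod (mean (\<lambda>x. U x * cnj (\<xi> x)) - \<xi> c * g) \<le> \<eta> / 2" .
      have 2: "cmod (\<xi> c * g - g) \<le> \<eta> / 2"
      proof (cases "g = 0")
        case True
        then show ?thesis using \<eta> by simp
      next
        case False
        then have "\<xi> \<in> S"
          using \<xi> by (simp add: S_def spec_def g_def)
        then have "cmod (\<xi> c - 1) < 1 / real (Suc n)"
          using c(1) by (simp add: N_def)
        moreover have "\<xi> c * g - g = (\<xi> c - 1) * g"
          by (simp add: algebra_simps)
        ultimately have "cmod (\<xi> c * g - g) \<le> 1 / real (Suc n) * (cmod g + 1)"
          unfolding norm_mult by (simp only: norm_mult) (intro mult_mono, auto)
        then show ?thesis
          using n unfolding mult.commute[of "cmod g + 1"] by linarith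
      qed
      show ?thesis
        using norm_triangle_le[OF add_mono[OF 1 2]] by simp
    qed
    then have "cmod (mean (\<lambda>x. U x * cnj (\<xi> x)) - g) \<le> 0"
      by (rule field_le_epsilon)
    then show ?thesis
      by (simp add: g_def)
  qed
  have "U = \<gamma>"
  proof (rule ccontr)
    assume "U \<noteq> \<gamma>"
    then obtain p where p: "U p - \<gamma> p \<noteq> 0" by auto
    have D: "precompact_translates (\<lambda>x. U x - \<gamma> x)"
      by (intro precompact_translates_intros U pc)
    obtain \<xi> where \<xi>: "unimodular_hom \<xi>" "mean (\<lambda>x. (U x - \<gamma> x) * cnj (\<xi> x)) \<noteq> 0"
      using exists_correlated_unimodular_hom[of "\<lambda>x. U x - \<gamma> x" p, OF D p] by blast
    note pcx = precompact_translates_unimodular_hom[OF \<xi>(1)]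
    have "continuous_on UNIV (\<lambda>x. U x - \<gamma> x)"
      unfolding U_def using \<gamma> by (intro continuous_intros) (auto simp: almost_periodic_def)
    then have "\<xi> \<in> characters"
      using D \<xi> by (rule unimodular_hom_continuous)
    moreover have "mean (\<lambda>x. (U x - \<gamma> x) * cnj (\<xi> x)) =
        mean (\<lambda>x. U x * cnj (\<xi> x)) - mean (\<lambda>x. \<gamma> x * cnj (\<xi> x))"
      unfolding left_diff_distrib by (intro mean_diff precompact_translates_intros U pc pcx)
    ultimately show False
      using \<xi>(2) coeff by simp
  qed
  moreover obtain c where "c \<in> N {} 0" "\<And>x. cmod (\<gamma> (c + x) - U x) < e"
    using near[of "{}" e 0] e by auto
  ultimately show False
    unfolding N_def by (auto simp: less_imp_le)
qed

lemma almost_periodic_bohr_neighbourhood: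
  fixes \<gamma> :: "'a::topological_ab_group_add \<Rightarrow> complex"
  assumes \<gamma>: "\<gamma> \<in> almost_periodic" and e: "0 < e"
  shows "\<exists>S \<delta>. finite S \<and> S \<subseteq> {\<xi> \<in> characters. mean (\<lambda>x. \<gamma> x * cnj (\<xi> x)) \<noteq> 0} \<and> 0 < \<delta> \<and>
    (\<forall>a b x. (\<forall>\<xi>\<in>S. cmod (\<xi> a - \<xi> b) < \<delta>) \<longrightarrow> cmod (\<gamma> (a + x) - \<gamma> (b + x)) \<le> e)"
proof -
  from almost_periodic_bohr_neighbourhood_at_0[OF assms]
  obtain S n where S: "finite S" "S \<subseteq> {\<xi> \<in> characters. mean (\<lambda>x. \<gamma> x * cnj (\<xi> x)) \<noteq> 0}"
    and n: "\<forall>c. (\<forall>\<xi>\<in>S. cmod (\<xi> c - 1) < 1 / real (Suc n)) \<longrightarrow> (\<forall>x. cmod (\<gamma> (c + x) - \<gamma> x) \<le> e)"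
    by (elim exE conjE)
  have "cmod (\<gamma> (a + x) - \<gamma> (b + x)) \<le> e"
    if ab: "\<forall>\<xi>\<in>S. cmod (\<xi> a - \<xi> b) < 1 / real (Suc n)" for a b x
  proof -
    have "cmod (\<xi> (a - b) - 1) < 1 / real (Suc n)" if "\<xi> \<in> S" for \<xi>
    proof -
      have u: "unimodular_hom \<xi>"
        using S(2) that by (auto simp: characters_iff)
      have "\<xi> (a - b) = \<xi> a * cnj (\<xi> b)"
        using u unimodular_hom_minus[OF u, of b] unfolding unimodular_hom_def
        by (metis diff_conv_add_uminus)
      then have "\<xi> (a - b) - 1 = (\<xi> a - \<xi> b) * cnj (\<xi> b)"
        using unimodular_hom_mult_cnj(1)[OF u, of b] by (simp add: algebra_simps)
      then show ?thesis
        using bspec[OF ab that] u by (simp add: norm_mult unimodular_hom_def)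
    qed
    then show ?thesis
      using n[rule_format, of "a - b" "b + x"] by (simp add: algebra_simps)
  qed
  then show ?thesis
    using S by (intro exI[of _ S] exI[of _ "1 / real (Suc n)"]) simp
qed

section \<open>The supremum formula under density of the orbit\<close>

definition nat_multiple :: "nat \<Rightarrow> 'a::ab_group_add \<Rightarrow> 'a" where
  "nat_multiple n g = ((+) g ^^ n) 0"

lemma nat_multiple_simps [simp]:
  "nat_multiple 0 g = 0" "nat_multiple (Suc n) g = g + nat_multiple n g"
  by (simp_all add: nat_multiple_def)

lemma nat_multiple_add: "nat_multiple (m + n) g = nat_multiple m g + nat_multiple n g"
  by (induction m) (simp_all add: add.assoc)

lemma funpow_plus_eq: "((+) g ^^ n) x = nat_multiple n g + x"
  by (induction n) (simp_all add: add.assoc)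

text \<open>
  By the pigeonhole principle two different multiples of \<open>g\<close> have the same colour.
\<close>

lemma precompact_translates_recurrence:
  assumes pc: "precompact_translates \<gamma>" and e: "0 < e"
  obtains p where "0 < p" "\<And>x. norm (\<gamma> (nat_multiple p g + x) - \<gamma> x) \<le> e"
proof -
  obtain c :: "'a \<Rightarrow> nat" where c: "finite (range c)"
    "\<And>h k x. c h = c k \<Longrightarrow> norm (\<gamma> (h + x) - \<gamma> (k + x)) \<le> e"
    using precompact_translatesE[OF pc e] by blast
  have "finite (range (\<lambda>n. c (nat_multiple n g)))"
    using c(1) by (rule finite_subset[rotated]) auto
  then have "\<not> inj (\<lambda>n. c (nat_multiple n g))"
    using finite_imageD infinite_UNIV_nat by blast
  then obtain i j where "c (nat_multiple i g) = c (nat_multiple j g)" "i \<noteq> j"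
    unfolding inj_def by blast
  then obtain i p where ip: "c (nat_multiple (i + p) g) = c (nat_multiple i g)" "0 < p"
    by (metis add.commute less_imp_add_positive linorder_neqE_nat)
  have "norm (\<gamma> (nat_multiple p g + x) - \<gamma> x) \<le> e" for x
    using c(2)[OF ip(1), of "x - nat_multiple i g"]
    by (simp add: nat_multiple_add algebra_simps)
  then show ?thesis
    using that ip(2) by blast
qed

definition partial_sum :: "'a::ab_group_add \<Rightarrow> ('a \<Rightarrow> real) \<Rightarrow> nat \<Rightarrow> 'a \<Rightarrow> real" where
  "partial_sum g f n x = (\<Sum>k<n. f (nat_multiple k g + x))"

lemma partial_sum_add:
  "partial_sum g f (m + n) x = partial_sum g f m x + partial_sum g f n (nat_multiple m g + x)"
  by (induction n) (simp_all add: partial_sum_def nat_multiple_add algebra_simps)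

lemma partial_sum_Suc: "partial_sum g f (Suc n) x = f x + partial_sum g f n (g + x)"
  using partial_sum_add[of g f 1 n x] by (simp add: partial_sum_def)

lemma partial_sum_diff_le:
  assumes "\<And>x. \<bar>f (h + x) - f (k + x)\<bar> \<le> d"
  shows "\<bar>partial_sum g f n h - partial_sum g f n k\<bar> \<le> real n * d"
proof -
  have "\<bar>f (nat_multiple i g + h) - f (nat_multiple i g + k)\<bar> \<le> d" for i
    using assms[of "nat_multiple i g"] by (simp add: add.commute)
  then show ?thesis
    unfolding partial_sum_def sum_subtractf[symmetric]
    using sum_norm_le[of "{..<n}" "\<lambda>i. f (nat_multiple i g + h) - f (nat_multiple i g + k)" "\<lambda>_. d"]
    by simp
qed

text \<open>
  The real function \<open>f\<close> stands for the real or imaginary part of \<open>\<gamma>\<close>. All distances are measured by \<open>\<gamma>\<close>,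
  so that the density of the orbit can be stated once, for \<open>\<gamma>\<close>, and used for both parts.
\<close>

locale bounded_almost_periodic_cocycle =
  fixes g :: "'a::topological_ab_group_add" and \<gamma> :: "'a \<Rightarrow> complex" and f :: "'a \<Rightarrow> real" and C :: real
  assumes cont: "continuous_on UNIV \<gamma>" and pc: "precompact_translates \<gamma>"
    and f_le: "\<And>x y. \<bar>f x - f y\<bar> \<le> cmod (\<gamma> x - \<gamma> y)"
    and bound: "\<And>n x. \<bar>partial_sum g f (Suc n) x\<bar> \<le> C"
begin

definition transfer :: "'a \<Rightarrow> real" where
  "transfer x = (SUP n. - partial_sum g f (Suc n) x)"

lemma bdd: "bdd_above (range (\<lambda>n. - partial_sum g f (Suc n) x))"
proof (rule bdd_aboveI)
  fix y assume "y \<in> range (\<lambda>n. - partial_sum g f (Suc n) x)"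
  then obtain n where "y = - partial_sum g f (Suc n) x" by blast
  then show "y \<le> C" using bound[of n x] by (simp add: abs_le_iff)
qed

lemma transfer_ge: "- partial_sum g f (Suc n) x \<le> transfer x"
  unfolding transfer_def by (rule cSUP_upper[OF UNIV_I bdd])

lemma transfer_leI: "(\<And>n. - partial_sum g f (Suc n) x \<le> b) \<Longrightarrow> transfer x \<le> b"
  unfolding transfer_def by (rule cSUP_least) auto

lemma transfer_approx:
  assumes "0 < e"
  obtains n where "transfer x - e < - partial_sum g f (Suc n) x"
proof -
  have "\<exists>n\<in>UNIV. transfer x - e < - partial_sum g f (Suc n) x"
    using less_cSUP_iff[OF UNIV_not_empty bdd, of "transfer x - e" x] assms
    unfolding transfer_def by simp
  then show ?thesis using that by blast
qed

lemma close_partial_sum: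
  assumes "\<And>x. cmod (\<gamma> (h + x) - \<gamma> (k + x)) \<le> d"
  shows "\<bar>partial_sum g f n h - partial_sum g f n k\<bar> \<le> real n * d"
  by (rule partial_sum_diff_le) (rule order_trans[OF f_le assms])

text \<open>
  Otherwise all partial sums at \<open>x\<close> are at least \<open>\<eta> > 0\<close>. Take a partial sum of length \<open>Suc q\<close> that is
  almost the supremum \<open>\<sigma>\<close> of all of them, and a return time \<open>p\<close> so good that the partial sum of
  length \<open>Suc q\<close> started at time \<open>p\<close> is almost the same. The partial sum of length \<open>p + Suc q\<close>
  then exceeds \<open>\<sigma>\<close>.
\<close>

lemma transfer_nonneg: "0 \<le> transfer x"
proof (rule ccontr)
  assume "\<not> 0 \<le> transfer x"
  define \<eta> where "\<eta> = - transfer x"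
  have \<eta>: "0 < \<eta>"
    using \<open>\<not> 0 \<le> transfer x\<close> by (simp add: \<eta>_def)
  have low: "\<eta> \<le> partial_sum g f (Suc n) x" for n
    using transfer_ge[of n x] unfolding \<eta>_def by linarith
  define \<sigma> where "\<sigma> = (SUP n. partial_sum g f (Suc n) x)"
  have bdd': "bdd_above (range (\<lambda>n. partial_sum g f (Suc n) x))"
    by (rule bdd_aboveI[of _ C]) (use bound[of _ x] in \<open>auto simp: abs_le_iff\<close>)
  have "\<exists>q\<in>UNIV. \<sigma> - \<eta> / 4 < partial_sum g f (Suc q) x"
    using less_cSUP_iff[OF UNIV_not_empty bdd', of "\<sigma> - \<eta> / 4"] \<eta> unfolding \<sigma>_def by simp
  then obtain q where q: "\<sigma> - \<eta> / 4 < partial_sum g f (Suc q) x" by blast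
  have "0 < \<eta> / (4 * real (Suc q))" using \<eta> by simp
  then obtain p where p: "0 < p"
    "\<And>y. norm (\<gamma> (nat_multiple p g + y) - \<gamma> y) \<le> \<eta> / (4 * real (Suc q))"
    using precompact_translates_recurrence[OF pc] by blast
  have "cmod (\<gamma> ((nat_multiple p g + x) + y) - \<gamma> (x + y)) \<le> \<eta> / (4 * real (Suc q))" for y
    using p(2)[of "x + y"] by (simp add: add.assoc)
  then have "\<bar>partial_sum g f (Suc q) (nat_multiple p g + x) - partial_sum g f (Suc q) x\<bar>
      \<le> real (Suc q) * (\<eta> / (4 * real (Suc q)))"
    by (rule close_partial_sum)
  also have "\<dots> = \<eta> / 4"
    by (simp del: of_nat_Suc)
  finally have 1: "\<sigma> - \<eta> / 2 < partial_sum g f (Suc q) (nat_multiple p g + x)"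
    using q by linarith
  have "partial_sum g f (p + Suc q) x = partial_sum g f p x + partial_sum g f (Suc q) (nat_multiple p g + x)"
    by (rule partial_sum_add)
  moreover have "\<eta> \<le> partial_sum g f p x"
    using low[of "p - 1"] p(1) by simp
  moreover have "partial_sum g f (Suc (p + q)) x \<le> \<sigma>"
    unfolding \<sigma>_def by (rule cSUP_upper[OF UNIV_I bdd'])
  ultimately show False
    using 1 \<eta> by simp
qed

text \<open>
  The partial sums at \<open>g + x\<close> are those at \<open>x\<close> without their first term \<open>f x\<close>. Only the partial sum of length
  one at \<open>x\<close> has no counterpart; it would contribute the candidate \<open>0\<close> to the supremum at \<open>g + x\<close>, and
  this does not exceed the supremum by \<open>transfer_nonneg\<close>.
\<close>

lemma transfer_equation: "transfer (g + x) - transfer x = f x"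
proof -
  have "transfer x \<le> transfer (g + x) - f x"
  proof (rule transfer_leI)
    fix n
    show "- partial_sum g f (Suc n) x \<le> transfer (g + x) - f x"
    proof (cases n)
      case 0
      then show ?thesis
        using transfer_nonneg[of "g + x"] by (simp add: partial_sum_def)
    next
      case (Suc m)
      then show ?thesis
        using transfer_ge[of m "g + x"] partial_sum_Suc[of g f "Suc m" x] by simp
    qed
  qed
  moreover have "transfer (g + x) \<le> transfer x + f x"
  proof (rule transfer_leI)
    fix n
    show "- partial_sum g f (Suc n) (g + x) \<le> transfer x + f x"
      using transfer_ge[of "Suc n" x] partial_sum_Suc[of g f "Suc n" x] by simp
  qed
  ultimately show ?thesis by simp
qed

lemma transfer_nat_multiple: "transfer (nat_multiple n g + x) = transfer x + partial_sum g f n x"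
proof (induction n arbitrary: x)
  case (Suc n)
  have "transfer (nat_multiple (Suc n) g + x) = transfer (nat_multiple n g + (g + x))"
    by (simp add: algebra_simps)
  then show ?case
    using Suc[of "g + x"] transfer_equation[of x] by (simp add: partial_sum_Suc)
qed (simp add: partial_sum_def)

text \<open>
  Choose \<open>x0\<close> where \<open>transfer\<close> is almost maximal. Near \<open>x0\<close> one fixed partial sum bounds it from below, so
  it varies there by at most \<open>e / 2\<close>. Every point is brought close to \<open>x0\<close> by adding one of finitely many
  multiples of \<open>g\<close>, one for each member of a finite net, and along these the difference of two values
  changes by a difference of partial sums of bounded length.
\<close>

lemma transfer_uniform_modulus:
  assumes dense: "\<And>a e. 0 < e \<Longrightarrow> \<exists>n. \<forall>x. cmod (\<gamma> (nat_multiple n g + x) - \<gamma> (a + x)) \<le> e"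
    and e: "0 < e"
  shows "\<exists>d>0. \<forall>h k. (\<forall>x. cmod (\<gamma> (h + x) - \<gamma> (k + x)) \<le> d) \<longrightarrow> \<bar>transfer h - transfer k\<bar> \<le> e"
proof -
  have "transfer x \<le> C" for x
    by (rule transfer_leI) (use bound[of _ x] in \<open>auto simp: abs_le_iff\<close>)
  then have bdd_t: "bdd_above (range transfer)"
    by (auto intro!: bdd_aboveI[of _ C])
  define s where "s = (SUP x. transfer x)"
  have le_s: "transfer x \<le> s" for x
    unfolding s_def by (rule cSUP_upper[OF UNIV_I bdd_t])
  have "\<exists>x0\<in>UNIV. s - e / 8 < transfer x0"
    using less_cSUP_iff[OF UNIV_not_empty bdd_t, of "s - e / 8"] e unfolding s_def by simp
  then obtain x0 where x0: "s - e / 8 < transfer x0" by blast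
  obtain n0 where n0: "transfer x0 - e / 8 < - partial_sum g f (Suc n0) x0"
    using transfer_approx[of "e/8" x0] e by auto
  define \<delta> where "\<delta> = e / (8 * real (Suc n0))"
  have \<delta>: "0 < \<delta>" "real (Suc n0) * \<delta> = e / 8"
    using e by (simp_all add: \<delta>_def del: of_nat_Suc)
  have near: "s - e / 2 \<le> transfer y" if "\<And>x. cmod (\<gamma> (y + x) - \<gamma> (x0 + x)) \<le> \<delta>" for y
  proof -
    have "\<bar>partial_sum g f (Suc n0) y - partial_sum g f (Suc n0) x0\<bar> \<le> e / 8"
      using close_partial_sum[OF that, of "Suc n0"] \<delta>(2) by simp
    then show ?thesis
      using transfer_ge[of n0 y] n0 x0 e by linarith
  qed
  have \<delta>3: "0 < \<delta> / 3" using \<delta> by simp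
  obtain F where F: "finite F" "\<And>h. \<exists>a\<in>F. \<forall>x. norm (\<gamma> (h + x) - \<gamma> (a + x)) \<le> \<delta> / 3"
    using precompact_translates_finite_net[OF pc \<delta>3] by blast
  have "\<forall>a. \<exists>n. \<forall>x. cmod (\<gamma> (nat_multiple n g + x) - \<gamma> ((x0 - a) + x)) \<le> \<delta> / 3"
    using dense[OF \<delta>3] by blast
  then obtain n where n: "\<And>a x. cmod (\<gamma> (nat_multiple (n a) g + x) - \<gamma> ((x0 - a) + x)) \<le> \<delta> / 3"
    by metis
  \<comment> \<open>a common bound for the finitely many lengths, positive so that one can divide by it\<close>
  define M where "M = real (Suc (Max (insert 0 (n ` F))))"
  have M: "0 < M" "\<And>a. a \<in> F \<Longrightarrow> real (n a) \<le> M"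
  proof -
    show "0 < M" by (simp add: M_def)
    fix a assume "a \<in> F"
    then have "n a \<le> Max (insert 0 (n ` F))"
      using F(1) by (intro Max_ge) auto
    then show "real (n a) \<le> M"
      by (simp add: M_def)
  qed
  define d where "d = min (\<delta> / 3) (e / (2 * M))"
  have d: "0 < d" "d \<le> \<delta> / 3" "M * d \<le> e / 2"
  proof -
    show "0 < d" "d \<le> \<delta> / 3"
      using \<delta>3 e M(1) by (simp_all add: d_def)
    have "M * d \<le> M * (e / (2 * M))"
      using M(1) by (intro mult_left_mono) (simp_all add: d_def)
    then show "M * d \<le> e / 2"
      using M(1) by simp
  qed
  have "\<bar>transfer h - transfer k\<bar> \<le> e" if hk: "\<And>x. cmod (\<gamma> (h + x) - \<gamma> (k + x)) \<le> d" for h k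
  proof -
    obtain a where a: "a \<in> F" "\<And>x. cmod (\<gamma> (h + x) - \<gamma> (a + x)) \<le> \<delta> / 3"
      using F(2) by blast
    define m where "m = nat_multiple (n a) g"
    have x0_a: "cmod (\<gamma> (m + a + x) - \<gamma> (x0 + x)) \<le> \<delta> / 3" for x
      using n[of a "a + x"] by (simp add: m_def add.assoc)
    have h_x0: "cmod (\<gamma> (m + h + x) - \<gamma> (x0 + x)) \<le> \<delta> / 3 + \<delta> / 3" for x
    proof -
      have "cmod (\<gamma> (m + h + x) - \<gamma> (m + a + x)) \<le> \<delta> / 3"
        using a(2)[of "m + x"] by (simp add: algebra_simps)
      then show ?thesis
        using norm_diff_triangle_le x0_a by blast
    qed
    have k_x0: "cmod (\<gamma> (m + k + x) - \<gamma> (x0 + x)) \<le> \<delta> / 3 + (\<delta> / 3 + \<delta> / 3)" for x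
    proof -
      have "cmod (\<gamma> (m + k + x) - \<gamma> (m + h + x)) \<le> \<delta> / 3"
        using hk[of "m + x"] d(2) by (simp add: algebra_simps norm_minus_commute)
      then show ?thesis
        using norm_diff_triangle_le h_x0 by blast
    qed
    have "s - e / 2 \<le> transfer (m + h)"
      by (rule near, rule order_trans[OF h_x0]) (use \<delta>(1) in simp)
    moreover have "s - e / 2 \<le> transfer (m + k)"
      by (rule near, rule order_trans[OF k_x0]) (use \<delta>(1) in simp)
    ultimately have "\<bar>transfer (m + h) - transfer (m + k)\<bar> \<le> e / 2"
      using le_s[of "m + h"] le_s[of "m + k"] by linarith
    moreover have "\<bar>partial_sum g f (n a) h - partial_sum g f (n a) k\<bar> \<le> e / 2"
    proof -
      have "\<bar>partial_sum g f (n a) h - partial_sum g f (n a) k\<bar> \<le> real (n a) * d"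
        by (rule close_partial_sum[OF hk])
      also have "\<dots> \<le> M * d"
        using M(2)[OF a(1)] d(1) by (intro mult_right_mono) auto
      finally show ?thesis using d(3) by linarith
    qed
    moreover have "transfer (m + h) = transfer h + partial_sum g f (n a) h"
      "transfer (m + k) = transfer k + partial_sum g f (n a) k"
      unfolding m_def by (rule transfer_nat_multiple)+
    ultimately show ?thesis
      by linarith
  qed
  then show ?thesis
    using d(1) by blast
qed

theorem transfer_almost_periodic:
  assumes dense: "\<And>a e. 0 < e \<Longrightarrow> \<exists>n. \<forall>x. cmod (\<gamma> (nat_multiple n g + x) - \<gamma> (a + x)) \<le> e"
  shows "(\<lambda>x. complex_of_real (transfer x)) \<in> almost_periodic"
proof (rule almost_periodicI)
  have modulus: "\<exists>d>0. \<forall>h k. (\<forall>x. cmod (\<gamma> (h + x) - \<gamma> (k + x)) \<le> d) \<longrightarrow> \<bar>transfer h - transfer k\<bar> \<le> e"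
    if "0 < e" for e
    using transfer_uniform_modulus[OF dense that] by simp
  show "continuous_on UNIV (\<lambda>x. complex_of_real (transfer x))"
    unfolding continuous_on_UNIV_iff_tendsto_nhds
  proof (intro allI tendstoI)
    fix x0 :: 'a and e :: real assume e: "0 < e"
    then obtain d where d: "0 < d"
      "\<And>h k. (\<forall>x. cmod (\<gamma> (h + x) - \<gamma> (k + x)) \<le> d) \<Longrightarrow> \<bar>transfer h - transfer k\<bar> \<le> e / 2"
      using modulus[of "e/2"] by auto
    have "\<forall>\<^sub>F x in nhds x0. \<forall>y. cmod (\<gamma> (x + y) - \<gamma> (x0 + y)) \<le> d"
      by (rule precompact_translates_uniformly_continuous[OF cont pc d(1)])
    then show "\<forall>\<^sub>F x in nhds x0. dist (complex_of_real (transfer x)) (complex_of_real (transfer x0)) < e"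
    proof eventually_elim
      case (elim x)
      have "dist (complex_of_real (transfer x)) (complex_of_real (transfer x0)) = \<bar>transfer x - transfer x0\<bar>"
        by (simp add: dist_norm flip: of_real_diff)
      then show ?case
        using d(2)[OF elim] e by simp
    qed
  qed
  show "precompact_translates (\<lambda>x. complex_of_real (transfer x))"
  proof (rule precompact_translates_of_real, rule precompact_translates_dominated[OF pc])
    fix e :: real assume "0 < e"
    then obtain d where d: "0 < d"
      "\<And>h k. (\<forall>x. cmod (\<gamma> (h + x) - \<gamma> (k + x)) \<le> d) \<Longrightarrow> \<bar>transfer h - transfer k\<bar> \<le> e"
      using modulus by blast
    have "norm (transfer (h + x) - transfer (k + x)) \<le> e"
      if "\<forall>x. norm (\<gamma> (h + x) - \<gamma> (k + x)) \<le> d" for h k x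
      using d(2)[of "h + x" "k + x"] that by (simp add: add.assoc)
    then show "\<exists>d>0. \<forall>h k. (\<forall>x. norm (\<gamma> (h + x) - \<gamma> (k + x)) \<le> d) \<longrightarrow>
        (\<forall>x. norm (transfer (h + x) - transfer (k + x)) \<le> e)"
      using d(1) by blast
  qed
qed

end

section \<open>The character group and density\<close>

lemma character_group_simps [simp]:
  "carrier character_group = characters"
  "\<xi> \<otimes>\<^bsub>character_group\<^esub> \<eta> = (\<lambda>x. \<xi> x * \<eta> x)"
  "\<one>\<^bsub>character_group\<^esub> = (\<lambda>_. 1)"
  by (simp_all add: character_group_def)

lemma characters_closed:
  "(\<lambda>_. 1) \<in> characters"
  "\<xi> \<in> characters \<Longrightarrow> \<eta> \<in> characters \<Longrightarrow> (\<lambda>x. \<xi> x * \<eta> x) \<in> characters"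
  "\<xi> \<in> characters \<Longrightarrow> (\<lambda>x. cnj (\<xi> x)) \<in> characters"
  unfolding characters_iff
  by (auto intro: continuous_intros unimodular_hom_one unimodular_hom_mult unimodular_hom_cnj)

lemma character_mult_cnj:
  assumes "\<xi> \<in> characters"
  shows "(\<lambda>x. cnj (\<xi> x) * \<xi> x) = (\<lambda>_. 1)"
  using assms unimodular_hom_mult_cnj(2) by (auto simp: characters_iff)

lemma group_character_group: "group (character_group :: ('a::topological_ab_group_add \<Rightarrow> complex) monoid)"
proof (rule groupI)
  fix \<xi> :: "'a \<Rightarrow> complex" assume "\<xi> \<in> carrier character_group"
  then show "\<exists>\<eta>\<in>carrier character_group. \<eta> \<otimes>\<^bsub>character_group\<^esub> \<xi> = \<one>\<^bsub>character_group\<^esub>"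
    using characters_closed(3) character_mult_cnj by (intro bexI[of _ "\<lambda>x. cnj (\<xi> x)"]) auto
qed (auto intro: characters_closed simp: mult.assoc)

lemma inv_character_group:
  assumes "\<xi> \<in> characters"
  shows "inv\<^bsub>character_group\<^esub> \<xi> = (\<lambda>x. cnj (\<xi> x))"
  by (rule group.inv_equality[OF group_character_group])
    (use assms characters_closed(3) character_mult_cnj in auto)

lemma subgroup_prod_power:
  assumes H: "subgroup H character_group" and S: "finite S" "S \<subseteq> H"
  shows "(\<lambda>x. \<Prod>\<xi>\<in>S. \<xi> x ^ (k \<xi> :: nat)) \<in> H"
  using S
proof (induction S rule: finite_induct)
  case empty
  then show ?case
    using subgroup.one_closed[OF H] by simp
next
  case (insert \<xi> S)
  have mult: "(\<lambda>x. \<eta> x * \<zeta> x) \<in> H" if "\<eta> \<in> H" "\<zeta> \<in> H" for \<eta> \<zeta>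
    using subgroup.m_closed[OF H that] by simp
  have "(\<lambda>x. \<xi> x ^ n) \<in> H" for n :: nat
    by (induction n) (use subgroup.one_closed[OF H] mult[of \<xi>] insert in auto)
  then show ?case
    using mult insert by simp
qed

lemma unimodular_hom_power_int:
  assumes "cmod z = 1"
  shows "unimodular_hom (\<lambda>n::int. z powi n)"
proof -
  have "z \<noteq> 0" using assms by auto
  then show ?thesis
    using assms by (simp add: unimodular_hom_def norm_power_int power_int_add)
qed

lemma character_nat_multiple:
  assumes "unimodular_hom \<xi>"
  shows "\<xi> (nat_multiple n g) = \<xi> g ^ n"
proof (induction n)
  case 0
  show ?case
    using unimodular_hom_mult_cnj(1)[OF assms, of 0] assms unimodular_hom_minus[OF assms, of 0]
    by (metis add.left_neutral minus_zero nat_multiple_simps(1) power_0 unimodular_hom_def)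
next
  case (Suc n)
  then show ?case using assms by (simp add: unimodular_hom_def)
qed

text \<open>
  The exponent is made nonnegative by adding a large common almost period of the powers, a multiple
  of \<open>\<bar>n\<bar> + 1\<close> found by the pigeonhole principle.
\<close>

lemma natural_powers_from_integer_powers:
  fixes z :: "'i \<Rightarrow> complex"
  assumes S: "finite S" and z: "\<And>s. s \<in> S \<Longrightarrow> cmod (z s) = 1" and \<delta>: "0 < \<delta>"
    and n: "\<And>s. s \<in> S \<Longrightarrow> cmod (z s powi n - t s) < \<delta> / 2"
  shows "\<exists>m::nat. \<forall>s\<in>S. cmod (z s ^ m - t s) < \<delta>"
proof -
  have "0 < \<delta> / 2" using \<delta> by simp
  then obtain c :: "int \<Rightarrow> nat" where c: "finite (range c)"
    "\<And>s h k x. s \<in> S \<Longrightarrow> c h = c k \<Longrightarrow> norm (z s powi (h + x) - z s powi (k + x)) \<le> \<delta> / 2"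
    using precompact_translates_common[of S "\<lambda>s n. z s powi n" "\<delta>/2", OF S]
      precompact_translates_unimodular_hom unimodular_hom_power_int z by blast
  define N where "N = \<bar>n\<bar> + 1"
  have "finite (range (\<lambda>m::nat. c (int m * N)))"
    using c(1) by (rule finite_subset[rotated]) auto
  then have "\<not> inj (\<lambda>m::nat. c (int m * N))"
    using finite_imageD infinite_UNIV_nat by blast
  then obtain i j :: nat where "c (int i * N) = c (int j * N)" "i \<noteq> j"
    unfolding inj_def by blast
  then obtain i p :: nat where ip: "c (int (i + p) * N) = c (int i * N)" "0 < p"
    by (metis add.commute less_imp_add_positive linorder_neqE_nat)
  have "1 * N \<le> int p * N"
    using ip(2) by (intro mult_right_mono) (auto simp: N_def)
  moreover have "- n < N"
    by (simp add: N_def)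
  ultimately have pos: "0 \<le> n + int p * N"
    by linarith
  define m where "m = nat (n + int p * N)"
  have "cmod (z s ^ m - t s) < \<delta>" if s: "s \<in> S" for s
  proof -
    have z0: "z s \<noteq> 0" using z[OF s] by auto
    have "z s ^ m = z s powi (n + int p * N)"
      using pos by (simp add: m_def power_int_def)
    then have "cmod (z s ^ m - z s powi n) =
        cmod (z s powi (int (i + p) * N + (n - int i * N)) - z s powi (int i * N + (n - int i * N)))"
      by (simp add: algebra_simps)
    also have "\<dots> \<le> \<delta> / 2"
      by (rule c(2)[OF s ip(1)])
    finally show ?thesis
      using n[OF s] norm_diff_triangle_less[of "z s ^ m" "z s powi n" "\<delta> / 2" "t s" "\<delta> / 2"]
        norm_triangle_ineq[of "z s ^ m - z s powi n" "z s powi n - t s"] by simp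
  qed
  then show ?thesis by blast
qed

text \<open>
  Finitely many spectral characters decide closeness of translates of \<open>\<gamma>\<close>, so by Kronecker's theorem
  for the integers it suffices that every multiplicative relation between their values at \<open>g\<close> holds
  between their values at \<open>a\<close>. Such a relation says that some member of the subgroup generated by the
  spectrum equals \<open>1\<close> at \<open>g\<close>; by hypothesis this member is the trivial character.
\<close>

lemma orbit_dense:
  fixes g :: "'a::topological_ab_group_add"
  assumes \<gamma>: "\<gamma> \<in> almost_periodic" and e: "0 < e"
    and trivial: "annihilator g \<inter> generate character_group
      {\<xi> \<in> characters. mean (\<lambda>x. \<gamma> x * cnj (\<xi> x)) \<noteq> 0} = {\<lambda>_. 1}"
  shows "\<exists>n. \<forall>x. cmod (\<gamma> (nat_multiple n g + x) - \<gamma> (a + x)) \<le> e"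
proof -
  define spec where "spec = {\<xi> \<in> characters. mean (\<lambda>x. \<gamma> x * cnj (\<xi> x)) \<noteq> 0}"
  define H where "H = generate character_group spec"
  from almost_periodic_bohr_neighbourhood[OF \<gamma> e, folded spec_def]
  obtain S \<delta> where S: "finite S" "S \<subseteq> spec" "0 < \<delta>"
    and approx: "\<forall>a b x. (\<forall>\<xi>\<in>S. cmod (\<xi> a - \<xi> b) < \<delta>) \<longrightarrow> cmod (\<gamma> (a + x) - \<gamma> (b + x)) \<le> e"
    by (elim exE conjE)
  have H: "subgroup H character_group"
    unfolding H_def by (rule group.generate_is_subgroup[OF group_character_group]) (auto simp: spec_def)
  have SH: "S \<subseteq> H"
    unfolding H_def using S(2) by (auto intro: generate.incl)
  have uS: "unimodular_hom \<xi>" if "\<xi> \<in> S" for \<xi>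
    using S(2) that by (auto simp: spec_def characters_iff)
  have relations: "(\<Prod>\<xi>\<in>S. \<xi> a ^ k \<xi>) = (\<Prod>\<xi>\<in>S. \<xi> a ^ l \<xi>)"
    if eq: "\<And>x::int. (\<Prod>\<xi>\<in>S. (\<xi> g powi x) ^ k \<xi>) = (\<Prod>\<xi>\<in>S. (\<xi> g powi x) ^ l \<xi>)" for k l
  proof -
    define P where "P k = (\<lambda>x. \<Prod>\<xi>\<in>S. \<xi> x ^ k \<xi>)" for k :: "('a \<Rightarrow> complex) \<Rightarrow> nat"
    \<comment> \<open>the relation is the statement that \<open>\<eta>\<close>, a member of \<open>H\<close>, is \<open>1\<close> at \<open>g\<close>\<close>
    have PH: "P k \<in> H" for k
      unfolding P_def by (rule subgroup_prod_power[OF H S(1) SH])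
    have PC: "P k \<in> characters" for k
      using PH subgroup.subset[OF H] by auto
    have unit: "cnj (P l x) * P l x = 1" for x
      using PC unimodular_hom_mult_cnj(2) by (auto simp: characters_iff)
    define \<eta> where "\<eta> = (\<lambda>x. P k x * cnj (P l x))"
    have "(\<lambda>x. cnj (P l x)) \<in> H"
      using subgroup.m_inv_closed[OF H PH[of l]] unfolding inv_character_group[OF PC] .
    then have \<eta>H: "\<eta> \<in> H"
      using subgroup.m_closed[OF H PH[of k]] unfolding \<eta>_def by simp
    have "P k g = P l g"
      using eq[of 1] unfolding P_def by simp
    then have "\<eta> g = 1"
      unfolding \<eta>_def using unit[of g] by (simp add: mult.commute)
    then have "\<eta> \<in> annihilator g \<inter> H"
      using \<eta>H subgroup.subset[OF H] unfolding annihilator_def by auto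
    then have "\<eta> = (\<lambda>_. 1)"
      using trivial unfolding H_def spec_def by blast
    then have "P k a * cnj (P l a) = 1"
      unfolding \<eta>_def by metis
    then have "P k a = P l a"
      using unit[of a] by (metis mult.assoc mult.left_neutral mult.right_neutral)
    then show ?thesis
      unfolding P_def .
  qed
  have "\<exists>n::int. \<forall>\<xi>\<in>S. cmod (\<xi> g powi n - \<xi> a) < \<delta> / 2"
  proof (rule kronecker_approximation[OF S(1)])
    show "unimodular_hom (\<lambda>n::int. \<xi> g powi n)" if "\<xi> \<in> S" for \<xi>
      using uS[OF that] by (intro unimodular_hom_power_int) (simp add: unimodular_hom_def)
    show "cmod (\<xi> a) = 1" if "\<xi> \<in> S" for \<xi>
      using uS[OF that] by (simp add: unimodular_hom_def)
    show "(\<Prod>\<xi>\<in>S. \<xi> a ^ k \<xi>) = (\<Prod>\<xi>\<in>S. \<xi> a ^ l \<xi>)"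
      if "\<And>x::int. (\<Prod>\<xi>\<in>S. (\<xi> g powi x) ^ k \<xi>) = (\<Prod>\<xi>\<in>S. (\<xi> g powi x) ^ l \<xi>)" for k l
      by (rule relations) (rule that)
    show "0 < \<delta> / 2" using S(3) by simp
  qed
  then obtain n :: int where "\<And>\<xi>. \<xi> \<in> S \<Longrightarrow> cmod (\<xi> g powi n - \<xi> a) < \<delta> / 2"
    by blast
  then have "\<exists>m::nat. \<forall>\<xi>\<in>S. cmod (\<xi> g ^ m - \<xi> a) < \<delta>"
    using uS S(1,3) by (intro natural_powers_from_integer_powers) (auto simp: unimodular_hom_def)
  then obtain m :: nat where m: "\<And>\<xi>. \<xi> \<in> S \<Longrightarrow> cmod (\<xi> g ^ m - \<xi> a) < \<delta>"
    by blast
  have "cmod (\<gamma> (nat_multiple m g + x) - \<gamma> (a + x)) \<le> e" for x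
    by (rule approx[rule_format]) (use m character_nat_multiple[OF uS] in simp)
  then show ?thesis by blast
qed

section \<open>A regular Borel measure from a positive functional\<close>

text \<open>
  The functional is evaluated on functions defined on the whole type, but only their behaviour on
  the space matters, by monotonicity. Homogeneity is a consequence of these axioms.
\<close>

locale normalized_positive_functional =
  fixes X :: "'b topology" and \<Lambda> :: "('b \<Rightarrow> real) \<Rightarrow> real"
  assumes compact: "compact_space X" and Hausdorff: "Hausdorff_space X"
    and \<Lambda>_add: "\<And>f h. continuous_map X euclideanreal f \<Longrightarrow> continuous_map X euclideanreal h \<Longrightarrow>
      \<Lambda> (\<lambda>x. f x + h x) = \<Lambda> f + \<Lambda> h"
    and \<Lambda>_mono: "\<And>f h. continuous_map X euclideanreal f \<Longrightarrow> continuous_map X euclideanreal h \<Longrightarrow>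
      (\<And>x. x \<in> topspace X \<Longrightarrow> f x \<le> h x) \<Longrightarrow> \<Lambda> f \<le> \<Lambda> h"
    and \<Lambda>_const: "\<And>c. \<Lambda> (\<lambda>_. c) = c"
begin

definition below :: "'b set \<Rightarrow> ('b \<Rightarrow> real) set" where
  "below U = {f. continuous_map X euclideanreal f \<and>
    (\<forall>x\<in>topspace X. 0 \<le> f x \<and> f x \<le> 1) \<and> (\<forall>x\<in>topspace X - U. f x = 0)}"

definition content :: "'b set \<Rightarrow> real" where
  "content U = (SUP f\<in>below U. \<Lambda> f)"

definition outer :: "'b set \<Rightarrow> ennreal" where
  "outer A = (INF U\<in>{U. openin X U \<and> A \<subseteq> U}. ennreal (content U))"

lemma below_continuous: "f \<in> below U \<Longrightarrow> continuous_map X euclideanreal f"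
  by (simp add: below_def)

lemma zero_below: "(\<lambda>_. 0) \<in> below U"
  by (simp add: below_def)

lemma \<Lambda>_below_le_1: "f \<in> below U \<Longrightarrow> \<Lambda> f \<le> 1"
  using \<Lambda>_mono[of f "\<lambda>_. 1"] \<Lambda>_const[of 1] by (simp add: below_def)

lemma bdd_below_functional: "bdd_above (\<Lambda> ` below U)"
  by (rule bdd_aboveI[of _ 1]) (auto intro: \<Lambda>_below_le_1)

lemma content_upper: "f \<in> below U \<Longrightarrow> \<Lambda> f \<le> content U"
  unfolding content_def by (rule cSUP_upper[OF _ bdd_below_functional])

lemma content_leI: "(\<And>f. f \<in> below U \<Longrightarrow> \<Lambda> f \<le> c) \<Longrightarrow> content U \<le> c"
  unfolding content_def using zero_below by (intro cSUP_least) auto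

lemma content_approx:
  assumes "0 < e"
  obtains f where "f \<in> below U" "content U - e < \<Lambda> f"
proof -
  have "\<exists>f\<in>below U. content U - e < \<Lambda> f"
    using less_cSUP_iff[of "below U" \<Lambda> "content U - e"] zero_below bdd_below_functional assms
    unfolding content_def by auto
  then show ?thesis using that by blast
qed

lemma content_nonneg: "0 \<le> content U"
  using content_upper[OF zero_below, of U] \<Lambda>_const[of 0] by simp

lemma content_mono:
  assumes "U \<subseteq> V"
  shows "content U \<le> content V"
  by (intro content_leI content_upper) (use assms in \<open>auto simp: below_def\<close>)

lemma content_empty: "content {} = 0"
proof -
  have "\<Lambda> f \<le> 0" if "f \<in> below {}" for f
    using \<Lambda>_mono[of f "\<lambda>_. 0"] \<Lambda>_const[of 0] that by (simp add: below_def)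
  then show ?thesis
    using content_leI[of "{}" 0] content_nonneg[of "{}"] by force
qed

lemma content_topspace: "content (topspace X) = 1"
proof -
  have "(\<lambda>_. 1) \<in> below (topspace X)"
    by (simp add: below_def)
  then have "1 \<le> content (topspace X)"
    using content_upper \<Lambda>_const[of 1] by fastforce
  moreover have "content (topspace X) \<le> 1"
    by (intro content_leI \<Lambda>_below_le_1)
  ultimately show ?thesis by simp
qed

lemma \<Lambda>_sum:
  assumes "finite I" "\<And>i. i \<in> I \<Longrightarrow> continuous_map X euclideanreal (F i)"
  shows "\<Lambda> (\<lambda>x. \<Sum>i\<in>I. F i x) = (\<Sum>i\<in>I. \<Lambda> (F i))"
  using assms
proof (induction I rule: finite_induct)
  case (insert j I)
  then show ?case
    by (simp add: \<Lambda>_add continuous_map_sum)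
qed (simp add: \<Lambda>_const)

lemma bump:
  assumes "openin X U" "x \<in> U"
  shows "\<exists>h\<in>below U. h x = 1"
proof -
  have "completely_regular_space X"
    using compact Hausdorff compact_Hausdorff_or_regular_imp_normal_space
      normal_imp_completely_regular_space_gen by blast
  moreover have "closedin X (topspace X - U)" "x \<in> topspace X - (topspace X - U)"
    using assms openin_subset[OF assms(1)] by auto
  ultimately obtain f where f: "continuous_map X (top_of_set {0..1::real}) f" "f x = 0"
    "f ` (topspace X - U) \<subseteq> {1}"
    unfolding completely_regular_space_def by blast
  have "continuous_map X euclideanreal f" "f \<in> topspace X \<rightarrow> {0..1}"
    using f(1) unfolding continuous_map_in_subtopology by auto
  then have "(\<lambda>x. 1 - f x) \<in> below U"
    using f(3) by (auto simp: below_def Pi_iff intro!: continuous_map_diff)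
  then show ?thesis
    using f(2) by (intro bexI[of _ "\<lambda>x. 1 - f x"]) auto
qed

lemma openin_superlevel:
  assumes "continuous_map X euclideanreal h"
  shows "openin X {x \<in> topspace X. c < h x}"
  using openin_continuous_map_preimage[OF assms, of "{c<..}"] by simp

lemma closedin_superlevel:
  assumes "continuous_map X euclideanreal h"
  shows "closedin X {x \<in> topspace X. c \<le> h x}"
  using closedin_continuous_map_preimage[OF assms, of "{c..}"] by simp

text \<open>
  Let \<open>f\<close> be an admissible function for the union that almost attains its content. The set \<open>K\<close> where \<open>f\<close>
  is not small is compact, so finitely many bump functions, each vanishing outside one \<open>U i\<close>, have a sum
  of at least \<open>1 / 2\<close> on \<open>K\<close>. Dividing by this sum splits \<open>f\<close>, up to a small error, into functions \<open>G i\<close>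
  that are admissible for the sets \<open>U i\<close>.
\<close>

lemma content_countably_subadditive:
  fixes U :: "nat \<Rightarrow> 'b set"
  assumes U: "\<And>i. openin X (U i)"
  shows "ennreal (content (\<Union>i. U i)) \<le> (\<Sum>i. ennreal (content (U i)))"
proof (rule ennreal_le_epsilon)
  fix e :: real assume e: "0 < e"
  obtain f where f: "f \<in> below (\<Union>i. U i)" "content (\<Union>i. U i) - e / 2 < \<Lambda> f"
    using content_approx[of "e/2" "\<Union>i. U i"] e by auto
  note fc = below_continuous[OF f(1)]
  define K where "K = {x \<in> topspace X. e / 2 \<le> f x}"
  have "compactin X K"
    unfolding K_def by (intro closedin_compact_space compact closedin_superlevel fc)
  have "\<exists>i h. h \<in> below (U i) \<and> h x = 1" if "x \<in> K" for x
  proof -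
    have "x \<in> (\<Union>i. U i)"
      using that f(1) e unfolding K_def below_def by force
    then show ?thesis
      using bump[OF U] by blast
  qed
  then obtain ix h where h: "\<And>x. x \<in> K \<Longrightarrow> h x \<in> below (U (ix x))" "\<And>x. x \<in> K \<Longrightarrow> h x x = (1::real)"
    by metis
  have "\<exists>\<F>. finite \<F> \<and> \<F> \<subseteq> (\<lambda>x. {y \<in> topspace X. 1 / 2 < h x y}) ` K \<and> K \<subseteq> \<Union> \<F>"
  proof (rule compactinD[OF \<open>compactin X K\<close>])
    show "openin X W" if "W \<in> (\<lambda>x. {y \<in> topspace X. 1 / 2 < h x y}) ` K" for W
      using that h(1) below_continuous openin_superlevel by blast
    show "K \<subseteq> \<Union> ((\<lambda>x. {y \<in> topspace X. 1 / 2 < h x y}) ` K)"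
    proof
      fix x assume x: "x \<in> K"
      then have "x \<in> {y \<in> topspace X. 1 / 2 < h x y}"
        using h(2)[OF x] by (simp add: K_def)
      then show "x \<in> \<Union> ((\<lambda>x. {y \<in> topspace X. 1 / 2 < h x y}) ` K)"
        using x by blast
    qed
  qed
  then obtain \<F> where \<F>: "finite \<F>" "\<F> \<subseteq> (\<lambda>x. {y \<in> topspace X. 1 / 2 < h x y}) ` K" "K \<subseteq> \<Union> \<F>"
    by (elim exE conjE)
  from finite_subset_image[OF \<F>(1,2)]
  obtain F where F: "F \<subseteq> K" "finite F" "\<F> = (\<lambda>x. {y \<in> topspace X. 1 / 2 < h x y}) ` F"
    by (elim exE conjE)
  note F = F(2,1) \<F>(3)[unfolded F(3)]
  have hF: "continuous_map X euclideanreal (h x)" "\<And>y. y \<in> topspace X \<Longrightarrow> 0 \<le> h x y"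
    "\<And>y. y \<in> topspace X - U (ix x) \<Longrightarrow> h x y = 0" if "x \<in> F" for x
    using h(1)[of x] F(2) that by (auto simp: below_def)
  \<comment> \<open>the maximum with \<open>1 / 2\<close> allows division outside \<open>K\<close>\<close>
  define D where "D y = max (\<Sum>x\<in>F. h x y) (1 / 2)" for y
  have D: "continuous_map X euclideanreal D" "\<And>y. 0 < D y"
    unfolding D_def by (intro continuous_map_real_max continuous_map_sum F(1) hF(1); simp)
      (simp add: less_max_iff_disj)
  define G where "G i y = (\<Sum>x | x \<in> F \<and> ix x = i. f y * h x y / D y)" for i y
  have f01: "0 \<le> f y" "f y \<le> 1" if "y \<in> topspace X" for y
    using f(1) that by (auto simp: below_def)
  have G: "G i \<in> below (U i)" for i
  proof -
    have "continuous_map X euclideanreal (G i)"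
      unfolding G_def using D(2) F(1)
      by (intro continuous_map_sum continuous_map_real_divide continuous_map_real_mult fc hF(1) D(1))
        (auto simp: less_imp_neq[symmetric])
    moreover have "0 \<le> G i y" if "y \<in> topspace X" for y
      unfolding G_def using f01[OF that] hF(2)[OF _ that] D(2)[of y]
      by (intro sum_nonneg divide_nonneg_pos mult_nonneg_nonneg) auto
    moreover have "G i y \<le> 1" if y: "y \<in> topspace X" for y
    proof -
      have "G i y = f y * (\<Sum>x | x \<in> F \<and> ix x = i. h x y) / D y"
        unfolding G_def by (simp add: sum_distrib_left sum_divide_distrib)
      also have "\<dots> \<le> 1 * D y / D y"
      proof (intro divide_right_mono mult_mono)
        have "(\<Sum>x | x \<in> F \<and> ix x = i. h x y) \<le> (\<Sum>x\<in>F. h x y)"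
          using F(1) hF(2)[OF _ y] by (intro sum_mono2) auto
        then show "(\<Sum>x | x \<in> F \<and> ix x = i. h x y) \<le> D y"
          by (simp add: D_def)
        show "0 \<le> (\<Sum>x | x \<in> F \<and> ix x = i. h x y)"
          using hF(2)[OF _ y] by (intro sum_nonneg) auto
      qed (use f01[OF y] D(2)[of y] in auto)
      finally show ?thesis
        using D(2)[of y] by simp
    qed
    moreover have "G i y = 0" if "y \<in> topspace X - U i" for y
      unfolding G_def using hF(3) that by (intro sum.neutral) auto
    ultimately show ?thesis
      by (simp add: below_def)
  qed
  have sumG: "(\<Sum>i\<in>ix ` F. G i y) = f y * (\<Sum>x\<in>F. h x y) / D y" for y
    unfolding G_def by (subst sum.image_gen[OF F(1), of "\<lambda>x. f y * h x y / D y" ix, symmetric])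
      (simp add: sum_distrib_left sum_divide_distrib)
  have "f y \<le> (\<Sum>i\<in>ix ` F. G i y) + e / 2" if y: "y \<in> topspace X" for y
  proof (cases "y \<in> K")
    case True
    then obtain x where x: "x \<in> F" "1 / 2 < h x y"
      using F(3) by blast
    have "h x y \<le> (\<Sum>x\<in>F. h x y)"
      using F(1) x(1) hF(2)[OF _ y] by (intro member_le_sum) auto
    then have "D y = (\<Sum>x\<in>F. h x y)"
      using x(2) by (simp add: D_def max_def)
    then have "(\<Sum>i\<in>ix ` F. G i y) = f y"
      unfolding sumG using D(2)[of y] by simp
    then show ?thesis using e by simp
  next
    case False
    have "0 \<le> (\<Sum>i\<in>ix ` F. G i y)"
      using G y by (intro sum_nonneg) (auto simp: below_def)
    then show ?thesis
      using False y by (simp add: K_def)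
  qed
  then have "\<Lambda> f \<le> \<Lambda> (\<lambda>y. (\<Sum>i\<in>ix ` F. G i y) + e / 2)"
    by (intro \<Lambda>_mono fc continuous_map_add continuous_map_sum continuous_map_canonical_const
        below_continuous[OF G]) (use F(1) in auto)
  also have "\<dots> = (\<Sum>i\<in>ix ` F. \<Lambda> (G i)) + e / 2"
    using F(1) below_continuous[OF G] by (simp add: \<Lambda>_add \<Lambda>_sum \<Lambda>_const continuous_map_sum)
  also have "\<dots> \<le> (\<Sum>i\<in>ix ` F. content (U i)) + e / 2"
    by (intro add_right_mono sum_mono content_upper G)
  finally have "content (\<Union>i. U i) \<le> (\<Sum>i\<in>ix ` F. content (U i)) + e"
    using f(2) by linarith
  then have "ennreal (content (\<Union>i. U i)) \<le> ennreal ((\<Sum>i\<in>ix ` F. content (U i)) + e)"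
    by (rule ennreal_leI)
  also have "\<dots> = (\<Sum>i\<in>ix ` F. ennreal (content (U i))) + ennreal e"
    using e by (simp add: content_nonneg sum_nonneg)
  also have "(\<Sum>i\<in>ix ` F. ennreal (content (U i))) \<le> (\<Sum>i. ennreal (content (U i)))"
    using F(1) by (intro sum_le_suminf) auto
  finally show "ennreal (content (\<Union>i. U i)) \<le> (\<Sum>i. ennreal (content (U i))) + ennreal e"
    by (simp add: add_right_mono)
qed

lemma outer_le: "openin X U \<Longrightarrow> A \<subseteq> U \<Longrightarrow> outer A \<le> ennreal (content U)"
  unfolding outer_def by (rule INF_lower) simp

lemma outer_open:
  assumes "openin X U"
  shows "outer U = ennreal (content U)"
  by (rule antisym, rule outer_le[OF assms order_refl], unfold outer_def, rule INF_greatest)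
    (auto intro: ennreal_leI content_mono)

lemma outer_mono: "A \<subseteq> B \<Longrightarrow> outer A \<le> outer B"
  unfolding outer_def by (rule INF_superset_mono) auto

lemma outer_le_1: "A \<subseteq> topspace X \<Longrightarrow> outer A \<le> 1"
  using outer_le[of "topspace X" A] by (simp add: content_topspace)

lemma outer_approx:
  assumes A: "A \<subseteq> topspace X" and e: "0 < e"
  obtains U where "openin X U" "A \<subseteq> U" "ennreal (content U) \<le> outer A + ennreal e"
proof -
  obtain r where r: "outer A = ennreal r" "0 \<le> r"
    using outer_le_1[OF A] by (cases "outer A") (auto simp: top_unique)
  have "outer A < outer A + ennreal e"
    unfolding r(1) using r(2) e by (simp add: ennreal_lessI flip: ennreal_plus)
  then have "\<exists>U\<in>{U. openin X U \<and> A \<subseteq> U}. ennreal (content U) < outer A + ennreal e"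
    unfolding outer_def INF_less_iff .
  then show ?thesis
    using that by (auto simp: less_imp_le)
qed

lemma outer_measure_space_outer: "outer_measure_space (Pow (topspace X)) outer"
  unfolding outer_measure_space_def
proof (intro conjI)
  show "positive (Pow (topspace X)) outer"
    unfolding positive_def using outer_open[of "{}"] by (simp add: content_empty)
  show "increasing (Pow (topspace X)) outer"
    unfolding increasing_def using outer_mono by blast
  show "countably_subadditive (Pow (topspace X)) outer"
    unfolding countably_subadditive_def
  proof (intro allI impI)
    fix A :: "nat \<Rightarrow> 'b set"
    assume A: "range A \<subseteq> Pow (topspace X)"
    show "outer (\<Union>i. A i) \<le> (\<Sum>i. outer (A i))"
    proof (rule ennreal_le_epsilon)
      fix e :: real assume e: "0 < e"
      have "\<exists>U. openin X U \<and> A i \<subseteq> U \<and> ennreal (content U) \<le> outer (A i) + ennreal (e * (1/2) ^ Suc i)" for i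
      proof -
        have "A i \<subseteq> topspace X" "0 < e * (1/2) ^ Suc i"
          using A e by auto
        then show ?thesis
          using outer_approx by metis
      qed
      then obtain U where U: "\<And>i. openin X (U i)" "\<And>i. A i \<subseteq> U i"
        "\<And>i. ennreal (content (U i)) \<le> outer (A i) + ennreal (e * (1/2) ^ Suc i)"
        by metis
      have "outer (\<Union>i. A i) \<le> ennreal (content (\<Union>i. U i))"
        using U(1,2) by (intro outer_le) blast+
      also have "\<dots> \<le> (\<Sum>i. ennreal (content (U i)))"
        by (rule content_countably_subadditive[OF U(1)])
      also have "\<dots> \<le> (\<Sum>i. outer (A i) + ennreal (e * (1/2) ^ Suc i))"
        by (intro suminf_le U(3)) auto
      also have "\<dots> = (\<Sum>i. outer (A i)) + (\<Sum>i. ennreal (e * (1/2) ^ Suc i))"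
        by (intro suminf_add[symmetric]) auto
      also have "(\<Sum>i. ennreal (e * (1/2) ^ Suc i)) = ennreal (e * 1)"
        using e by (intro suminf_ennreal_eq sums_mult power_half_series) auto
      finally show "outer (\<Union>i. A i) \<le> (\<Sum>i. outer (A i)) + ennreal e"
        by simp
    qed
  qed
qed

text \<open>
  Take \<open>f\<close> almost attaining the content of \<open>V \<inter> U\<close>, and \<open>h\<close> almost attaining that of \<open>V - K\<close>, where \<open>K\<close> is the
  set where \<open>f\<close> is not small. After lowering \<open>f\<close> slightly the two functions have disjoint supports, so
  their sum is admissible for \<open>V\<close>. This makes open sets measurable in the sense of Caratheodory.
\<close>

lemma content_split:
  assumes U: "openin X U" and V: "openin X V"
  shows "ennreal (content (V \<inter> U)) + outer (V - U) \<le> ennreal (content V)"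
proof (rule ennreal_le_epsilon)
  fix e :: real assume "0 < e"
  then have e: "0 < e / 3" by simp
  obtain f where f: "f \<in> below (V \<inter> U)" "content (V \<inter> U) - e / 3 < \<Lambda> f"
    using content_approx[OF e] by blast
  note fc = below_continuous[OF f(1)]
  have f01: "0 \<le> f y" "f y \<le> 1" if "y \<in> topspace X" for y
    using f(1) that by (auto simp: below_def)
  define K where "K = {x \<in> topspace X. e / 3 \<le> f x}"
  have W: "openin X (V - K)"
    unfolding K_def by (intro openin_diff V closedin_superlevel fc)
  have "V - U \<subseteq> V - K"
  proof -
    have "y \<notin> K" if "y \<in> V - U" for y
      using f(1) e that by (auto simp: below_def K_def)
    then show ?thesis by blast
  qed
  then have outer_W: "outer (V - U) \<le> ennreal (content (V - K))"
    by (rule outer_le[OF W])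
  obtain h where h: "h \<in> below (V - K)" "content (V - K) - e / 3 < \<Lambda> h"
    using content_approx[OF e] by blast
  note hc = below_continuous[OF h(1)]
  \<comment> \<open>\<open>h\<close> vanishes on \<open>K\<close>, and the first summand vanishes outside \<open>K\<close>\<close>
  define F where "F x = max (f x - e / 3) 0 + h x" for x
  have Fc: "continuous_map X euclideanreal F"
    unfolding F_def by (intro continuous_intros fc hc)
  have "F \<in> below V"
    unfolding below_def
  proof (intro CollectI conjI ballI)
    fix y assume y: "y \<in> topspace X"
    have h01: "0 \<le> h y" "h y \<le> 1"
      using h(1) y by (auto simp: below_def)
    show "0 \<le> F y"
      using h01 by (simp add: F_def)
    show "F y \<le> 1"
    proof (cases "y \<in> K")
      case True
      then have "h y = 0"
        using h(1) y by (auto simp: below_def)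
      then show ?thesis
        using f01[OF y] e by (simp add: F_def)
    next
      case False
      then have "f y - e / 3 \<le> 0"
        using y by (simp add: K_def)
      then show ?thesis
        using h01 by (simp add: F_def max_def)
    qed
  next
    fix y assume y: "y \<in> topspace X - V"
    then have "f y = 0" "h y = 0"
      using f(1) h(1) by (auto simp: below_def)
    then show "F y = 0"
      using e by (simp add: F_def)
  qed (rule Fc)
  then have "\<Lambda> F \<le> content V"
    by (rule content_upper)
  moreover have "\<Lambda> (\<lambda>x. (f x + - (e / 3)) + h x) \<le> \<Lambda> F"
    by (intro \<Lambda>_mono Fc continuous_intros fc hc) (simp add: F_def)
  moreover have "\<Lambda> (\<lambda>x. (f x + - (e / 3)) + h x) = \<Lambda> f + - (e / 3) + \<Lambda> h"
    by (simp only: \<Lambda>_add[OF continuous_map_add[OF fc continuous_map_canonical_const] hc]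
      \<Lambda>_add[OF fc continuous_map_canonical_const] \<Lambda>_const)
  ultimately have "content (V \<inter> U) + content (V - K) \<le> content V + e"
    using f(2) h(2) by linarith
  then have "ennreal (content (V \<inter> U)) + ennreal (content (V - K)) \<le> ennreal (content V) + ennreal e"
    using content_nonneg \<open>0 < e\<close> by (simp flip: ennreal_plus add: ennreal_leI)
  then show "ennreal (content (V \<inter> U)) + outer (V - U) \<le> ennreal (content V) + ennreal e"
    using outer_W by (meson add_left_mono order_trans)
qed

lemma open_in_lambda_system:
  assumes U: "openin X U"
  shows "U \<in> lambda_system (topspace X) (Pow (topspace X)) outer"
proof -
  interpret sigma_algebra "topspace X" "Pow (topspace X)"
    by (rule sigma_algebra_Pow)
  have subadd: "subadditive (Pow (topspace X)) outer"
    using outer_measure_space_outer unfolding outer_measure_space_def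
    by (intro countably_subadditive_subadditive) auto
  have "outer (A \<inter> U) + outer (A - U) = outer A" if A: "A \<subseteq> topspace X" for A
  proof (rule antisym)
    show "outer (A \<inter> U) + outer (A - U) \<le> outer A"
      unfolding outer_def[of A]
    proof (rule INF_greatest)
      fix V assume V: "V \<in> {V. openin X V \<and> A \<subseteq> V}"
      then have "outer (A \<inter> U) \<le> ennreal (content (V \<inter> U))"
        using U by (intro outer_le) auto
      moreover have "outer (A - U) \<le> outer (V - U)"
        using V by (intro outer_mono) auto
      ultimately have "outer (A \<inter> U) + outer (A - U) \<le> ennreal (content (V \<inter> U)) + outer (V - U)"
        by (rule add_mono)
      also have "\<dots> \<le> ennreal (content V)"
        using V by (intro content_split U) auto
      finally show "outer (A \<inter> U) + outer (A - U) \<le> ennreal (content V)" .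
    qed
    have "outer ((A \<inter> U) \<union> (A - U)) \<le> outer (A \<inter> U) + outer (A - U)"
      by (rule subadditiveD[OF subadd]) (use A in auto)
    then show "outer A \<le> outer (A \<inter> U) + outer (A - U)"
      by (simp add: Int_Diff_Un)
  qed
  then show ?thesis
    unfolding lambda_system_eq using openin_subset[OF U] by auto
qed

definition representing_measure :: "'b measure" where
  "representing_measure = measure_of (topspace X) (sigma_sets (topspace X) {U. openin X U}) outer"

lemma opens_Pow: "{U. openin X U} \<subseteq> Pow (topspace X)"
  using openin_subset by auto

lemma measure_space_outer:
  "measure_space (topspace X) (sigma_sets (topspace X) {U. openin X U}) outer"
proof -
  interpret sigma_algebra "topspace X" "Pow (topspace X)"
    by (rule sigma_algebra_Pow)
  have ms: "measure_space (topspace X) (lambda_system (topspace X) (Pow (topspace X)) outer) outer"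
    by (rule caratheodory_lemma[OF outer_measure_space_outer])
  then have "sigma_sets (topspace X) {U. openin X U} \<subseteq>
      lambda_system (topspace X) (Pow (topspace X)) outer"
    using open_in_lambda_system unfolding measure_space_def
    by (intro sigma_algebra.sigma_sets_subset) auto
  then show ?thesis
    by (rule measure_down[OF ms sigma_algebra_sigma_sets[OF opens_Pow]])
qed

lemma space_representing_measure: "space representing_measure = topspace X"
  unfolding representing_measure_def
  by (rule space_measure_of) (use sigma_sets_into_sp[OF opens_Pow] in auto)

lemma sets_representing_measure:
  "sets representing_measure = sigma_sets (topspace X) {U. openin X U}"
  unfolding representing_measure_def
  by (subst sets_measure_of) (use sigma_sets_into_sp[OF opens_Pow] in \<open>auto simp: sigma_sets_sigma_sets_eq[OF opens_Pow]\<close>)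

lemma emeasure_representing_measure:
  assumes "B \<in> sigma_sets (topspace X) {U. openin X U}"
  shows "emeasure representing_measure B = outer B"
  unfolding representing_measure_def
  by (rule emeasure_measure_of_sigma) (use measure_space_outer assms in \<open>auto simp: measure_space_def\<close>)

lemma emeasure_representing_topspace: "emeasure representing_measure (topspace X) = 1"
  using emeasure_representing_measure[of "topspace X"] outer_open[of "topspace X"]
  by (simp add: content_topspace sigma_sets.Basic)

text \<open>
  Outer regularity holds by construction; passing to complements in a space of finite measure turns
  approximation from outside by open sets into approximation from inside by compact sets.
\<close>

lemma inner_regular:
  assumes B: "B \<in> sets representing_measure"
  shows "emeasure representing_measure B =
    (SUP C\<in>{C. compactin X C \<and> C \<subseteq> B}. emeasure representing_measure C)"
proof (rule antisym)
  let ?\<mu> = "emeasure representing_measure"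
  have Bsub: "B \<subseteq> topspace X"
    using sets.sets_into_space[OF B] by (simp add: space_representing_measure)
  show "(SUP C\<in>{C. compactin X C \<and> C \<subseteq> B}. ?\<mu> C) \<le> ?\<mu> B"
    by (rule SUP_least) (auto intro: emeasure_mono B)
  show "?\<mu> B \<le> (SUP C\<in>{C. compactin X C \<and> C \<subseteq> B}. ?\<mu> C)"
  proof (rule ennreal_le_epsilon)
    fix e :: real assume e: "0 < e"
    have cB: "topspace X - B \<in> sets representing_measure"
      using sets.compl_sets[OF B] by (simp add: space_representing_measure)
    obtain V where V: "openin X V" "topspace X - B \<subseteq> V" "ennreal (content V) \<le> outer (topspace X - B) + ennreal e"
      using outer_approx[OF Diff_subset e] by blast
    have Vs: "V \<in> sets representing_measure"
      using V(1) by (simp add: sets_representing_measure sigma_sets.Basic)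
    define C where "C = topspace X - V"
    have C: "compactin X C" "C \<subseteq> B"
      unfolding C_def using V by (auto intro: closedin_compact_space[OF compact])
    have Cs: "C \<in> sets representing_measure"
      unfolding C_def using sets.compl_sets[OF Vs] by (simp add: space_representing_measure)
    have "?\<mu> V = ?\<mu> (topspace X - B) + ?\<mu> (V \<inter> B)"
    proof -
      have "V = (topspace X - B) \<union> (V \<inter> B)"
        using V(2) openin_subset[OF V(1)] by auto
      moreover have "(topspace X - B) \<inter> (V \<inter> B) = {}" by auto
      ultimately show ?thesis
        using plus_emeasure[OF cB sets.Int[OF Vs B]] by simp
    qed
    moreover have "?\<mu> V \<le> ?\<mu> (topspace X - B) + ennreal e"
      using V(1,3) cB Vs by (simp add: emeasure_representing_measure sets_representing_measure outer_open)
    moreover have "?\<mu> (topspace X - B) \<noteq> Orderings.top"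
      using cB outer_le_1[of "topspace X - B"]
      by (auto simp: emeasure_representing_measure sets_representing_measure top_unique)
    ultimately have small: "?\<mu> (V \<inter> B) \<le> ennreal e"
      by (simp add: ennreal_add_left_cancel_le)
    have "B = C \<union> (V \<inter> B)"
      using Bsub C(2) by (auto simp: C_def)
    then have "?\<mu> B \<le> ?\<mu> C + ?\<mu> (V \<inter> B)"
      using emeasure_subadditive[OF Cs sets.Int[OF Vs B]] by simp
    also have "\<dots> \<le> (SUP C\<in>{C. compactin X C \<and> C \<subseteq> B}. ?\<mu> C) + ennreal e"
      using C small by (intro add_mono SUP_upper) auto
    finally show "?\<mu> B \<le> (SUP C\<in>{C. compactin X C \<and> C \<subseteq> B}. ?\<mu> C) + ennreal e" .
  qed
qed

text \<open>
  Composition with \<open>\<tau>\<close> maps the functions admissible for the image of \<open>U\<close> to functions admissible for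
  \<open>U\<close>, without changing the value of the functional.
\<close>

lemma outer_image_le:
  assumes hm: "homeomorphic_maps X X \<tau> \<sigma>" and B: "B \<subseteq> topspace X"
    and inv: "\<And>f. continuous_map X euclideanreal f \<Longrightarrow> \<Lambda> (\<lambda>x. f (\<tau> x)) = \<Lambda> f"
  shows "outer (\<tau> ` B) \<le> outer B"
  unfolding outer_def[of B]
proof (rule INF_greatest)
  fix U assume "U \<in> {U. openin X U \<and> B \<subseteq> U}"
  then have U: "openin X U" "B \<subseteq> U" by auto
  have \<tau>: "continuous_map X X \<tau>" "\<And>x. x \<in> topspace X \<Longrightarrow> \<sigma> (\<tau> x) = x"
    using hm by (auto simp: homeomorphic_maps_def)
  have open_im: "openin X (\<tau> ` U)"
    using hm U(1) homeomorphic_maps_map homeomorphic_map_openness_eq by metis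
  have "content (\<tau> ` U) \<le> content U"
  proof (rule content_leI)
    fix f assume f: "f \<in> below (\<tau> ` U)"
    have "(\<lambda>x. f (\<tau> x)) \<in> below U"
      unfolding below_def
    proof (intro CollectI conjI ballI)
      show "continuous_map X euclideanreal (\<lambda>x. f (\<tau> x))"
        using continuous_map_compose[OF \<tau>(1) below_continuous[OF f]] by (simp add: o_def)
      fix x assume x: "x \<in> topspace X"
      then have "\<tau> x \<in> topspace X"
        using \<tau>(1) by (auto simp: continuous_map_def)
      then show "0 \<le> f (\<tau> x)" "f (\<tau> x) \<le> 1"
        using f by (auto simp: below_def)
    next
      fix x assume x: "x \<in> topspace X - U"
      then have "\<tau> x \<in> topspace X"
        using \<tau>(1) by (auto simp: continuous_map_def)
      moreover have "\<tau> x \<notin> \<tau> ` U"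
        using x \<tau>(2) openin_subset[OF U(1)] by (metis DiffE image_iff subsetD)
      ultimately show "f (\<tau> x) = 0"
        using f by (auto simp: below_def)
    qed
    then show "\<Lambda> f \<le> content U"
      using content_upper inv[OF below_continuous[OF f]] by force
  qed
  moreover have "outer (\<tau> ` B) \<le> ennreal (content (\<tau> ` U))"
    using U(2) by (intro outer_le open_im image_mono)
  ultimately show "outer (\<tau> ` B) \<le> ennreal (content U)"
    by (meson ennreal_leI order_trans)
qed

end

section \<open>The Bohr compactification\<close>

lemma bohr_group_simps:
  "y \<in> carrier bohr_group \<longleftrightarrow> y \<in> extensional characters \<and> (\<forall>\<xi>\<in>characters. cmod (y \<xi>) = 1) \<and>
    (\<forall>\<xi>\<in>characters. \<forall>\<eta>\<in>characters. y (\<lambda>x. \<xi> x * \<eta> x) = y \<xi> * y \<eta>)"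
  "a \<otimes>\<^bsub>bohr_group\<^esub> b = (\<lambda>\<xi>\<in>characters. a \<xi> * b \<xi>)"
  by (auto simp: bohr_group_def hom_def character_group_def circle_group_def)

lemma bohr_cmod: "y \<in> carrier bohr_group \<Longrightarrow> \<xi> \<in> characters \<Longrightarrow> cmod (y \<xi>) = 1"
  by (simp add: bohr_group_simps)

lemma bohr_mult_closed:
  assumes "a \<in> carrier bohr_group" "b \<in> carrier bohr_group"
  shows "a \<otimes>\<^bsub>bohr_group\<^esub> b \<in> carrier bohr_group"
  using assms by (auto simp: bohr_group_simps characters_closed norm_mult)

definition bohr_inverse :: "(('a::topological_ab_group_add \<Rightarrow> complex) \<Rightarrow> complex) \<Rightarrow> ('a \<Rightarrow> complex) \<Rightarrow> complex" where
  "bohr_inverse a = (\<lambda>\<xi>\<in>characters. cnj (a \<xi>))"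

lemma bohr_inverse_closed:
  "a \<in> carrier bohr_group \<Longrightarrow> bohr_inverse a \<in> carrier bohr_group"
  by (auto simp: bohr_group_simps bohr_inverse_def characters_closed)

lemma bohr_inverse_cancel:
  assumes a: "a \<in> carrier bohr_group" and y: "y \<in> carrier bohr_group"
  shows "bohr_inverse a \<otimes>\<^bsub>bohr_group\<^esub> (a \<otimes>\<^bsub>bohr_group\<^esub> y) = y"
    "a \<otimes>\<^bsub>bohr_group\<^esub> (bohr_inverse a \<otimes>\<^bsub>bohr_group\<^esub> y) = y"
proof -
  have unit: "a \<xi> * cnj (a \<xi>) = 1" if "\<xi> \<in> characters" for \<xi>
    using bohr_cmod[OF a that] by (simp add: complex_norm_square[symmetric])
  have "cnj (a \<xi>) * (a \<xi> * y \<xi>) = y \<xi>" "a \<xi> * (cnj (a \<xi>) * y \<xi>) = y \<xi>" if "\<xi> \<in> characters" for \<xi>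
    using unit[OF that] by (metis mult.assoc mult.commute mult.left_neutral)+
  moreover have "y \<in> extensional characters"
    using y by (simp add: bohr_group_simps)
  ultimately show "bohr_inverse a \<otimes>\<^bsub>bohr_group\<^esub> (a \<otimes>\<^bsub>bohr_group\<^esub> y) = y"
    "a \<otimes>\<^bsub>bohr_group\<^esub> (bohr_inverse a \<otimes>\<^bsub>bohr_group\<^esub> y) = y"
    by (auto simp: bohr_group_simps bohr_inverse_def extensional_def fun_eq_iff)
qed

lemma bohr_map_apply: "\<xi> \<in> characters \<Longrightarrow> bohr_map x \<xi> = \<xi> x"
  by (simp add: bohr_map_def)

lemma bohr_map_closed: "bohr_map x \<in> carrier bohr_group"
proof -
  have "cmod (\<xi> x) = 1" if "\<xi> \<in> characters" for \<xi>
    using that by (simp add: characters_iff unimodular_hom_def)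
  then show ?thesis
    unfolding bohr_group_simps by (auto simp: bohr_map_def characters_closed)
qed

subsection \<open>Topology\<close>

lemma topspace_bohr [simp]: "topspace bohr_topology = carrier bohr_group"
proof -
  have "carrier bohr_group \<subseteq> topspace (product_topology (\<lambda>_. euclidean) characters)"
    by (auto simp: bohr_group_simps PiE_def)
  then show ?thesis
    unfolding bohr_topology_def topspace_subtopology by blast
qed

lemma Hausdorff_bohr: "Hausdorff_space bohr_topology"
  unfolding bohr_topology_def
  by (intro Hausdorff_space_subtopology) (simp add: Hausdorff_space_product_topology)

lemma continuous_map_bohr_character:
  "\<xi> \<in> characters \<Longrightarrow> continuous_map bohr_topology euclidean (\<lambda>y. y \<xi>)"
  unfolding bohr_topology_def
  by (intro continuous_map_from_subtopology continuous_map_product_projection)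

text \<open>
  By Tychonoff's theorem the product of circles is compact, and the homomorphisms form a closed
  subset of it.
\<close>

lemma compact_bohr: "compact_space (bohr_topology :: (('a::topological_ab_group_add \<Rightarrow> complex) \<Rightarrow> complex) topology)"
proof -
  let ?P = "product_topology (\<lambda>_::'a \<Rightarrow> complex. euclidean :: complex topology) characters"
  define R where "R \<xi> \<eta> = {y \<in> topspace ?P. y (\<lambda>x. \<xi> x * \<eta> x) - y \<xi> * y \<eta> \<in> {0}}" for \<xi> \<eta> :: "'a \<Rightarrow> complex"
  have "closedin ?P (R \<xi> \<eta>)" if "\<xi> \<in> characters" "\<eta> \<in> characters" for \<xi> \<eta>
  proof -
    have proj: "continuous_map ?P euclidean (\<lambda>y. y \<zeta>)" if "\<zeta> \<in> characters" for \<zeta>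
      by (rule continuous_map_product_projection[OF that])
    have "continuous_map ?P euclidean (\<lambda>y. (y \<xi>, y \<eta>))"
      using proj that by (simp add: continuous_map_pairedI flip: prod_topology_euclidean)
    then have "continuous_map ?P euclidean ((\<lambda>z. fst z * snd z) \<circ> (\<lambda>y. (y \<xi>, y \<eta>)))"
      by (rule continuous_map_compose)
        (simp add: continuous_on_mult continuous_on_fst continuous_on_snd continuous_on_id)
    then have "continuous_map ?P euclidean (\<lambda>y. y \<xi> * y \<eta>)"
      by (simp add: o_def)
    then have "continuous_map ?P euclidean (\<lambda>y. y (\<lambda>x. \<xi> x * \<eta> x) - y \<xi> * y \<eta>)"
      by (intro continuous_map_diff proj characters_closed that)
    then show ?thesis
      unfolding R_def by (rule closedin_continuous_map_preimage) simp
  qed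
  then have "closedin ?P (\<Inter>p\<in>characters \<times> characters. R (fst p) (snd p))"
    using characters_closed(1) by (intro closedin_Inter) auto
  moreover have "compactin ?P (PiE characters (\<lambda>_. sphere 0 1))"
    by (simp add: compactin_PiE)
  ultimately have "compactin ?P (PiE characters (\<lambda>_. sphere 0 1) \<inter>
      (\<Inter>p\<in>characters \<times> characters. R (fst p) (snd p)))"
    by (rule compact_Int_closedin[rotated])
  moreover have "PiE characters (\<lambda>_. sphere 0 1) \<inter>
      (\<Inter>p\<in>characters \<times> characters. R (fst p) (snd p)) = carrier bohr_group"
    using characters_closed(1)[where 'a = 'a]
    by (auto simp: bohr_group_simps R_def PiE_iff dest: extensional_arb)
  ultimately have "compactin ?P (carrier bohr_group)"
    by simp
  then show ?thesis
    unfolding bohr_topology_def by (rule compact_space_subtopology)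
qed

lemma openin_bohr_neighbourhood:
  assumes "finite S" "S \<subseteq> characters"
  shows "openin bohr_topology {z \<in> carrier bohr_group. \<forall>\<xi>\<in>S. cmod (z \<xi> - y \<xi>) < d}"
  using assms
proof (induction S rule: finite_induct)
  case empty
  show ?case
    using openin_topspace[of bohr_topology] by simp
next
  case (insert \<xi> S)
  have "openin bohr_topology {z \<in> topspace bohr_topology. z \<xi> \<in> ball (y \<xi>) d}"
    by (rule openin_continuous_map_preimage[OF continuous_map_bohr_character]) (use insert.prems in auto)
  moreover have "openin bohr_topology {z \<in> carrier bohr_group. \<forall>\<xi>\<in>S. cmod (z \<xi> - y \<xi>) < d}"
    using insert by simp
  ultimately have "openin bohr_topology ({z \<in> topspace bohr_topology. z \<xi> \<in> ball (y \<xi>) d} \<inter>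
      {z \<in> carrier bohr_group. \<forall>\<xi>\<in>S. cmod (z \<xi> - y \<xi>) < d})"
    by (rule openin_Int)
  moreover have "{z \<in> topspace bohr_topology. z \<xi> \<in> ball (y \<xi>) d} \<inter>
      {z \<in> carrier bohr_group. \<forall>\<xi>\<in>S. cmod (z \<xi> - y \<xi>) < d} =
      {z \<in> carrier bohr_group. \<forall>\<xi>\<in>insert \<xi> S. cmod (z \<xi> - y \<xi>) < d}"
    by (auto simp: dist_norm norm_minus_commute)
  ultimately show ?case by simp
qed

lemma bohr_basic_neighbourhood:
  assumes W: "openin bohr_topology W" and y: "y \<in> W"
  shows "\<exists>S d. finite S \<and> S \<subseteq> characters \<and> 0 < d \<and>
    {z \<in> carrier bohr_group. \<forall>\<xi>\<in>S. cmod (z \<xi> - y \<xi>) < d} \<subseteq> W"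
proof -
  obtain T where T: "openin (product_topology (\<lambda>_. euclidean) characters) T" "W = T \<inter> carrier bohr_group"
    using W unfolding bohr_topology_def openin_subtopology by blast
  then have "y \<in> T" using y by simp
  from bspec[OF iffD1[OF openin_product_topology_alt T(1)] this]
  obtain U where U: "finite {\<xi> \<in> characters. U \<xi> \<noteq> topspace euclidean}"
    "\<forall>\<xi>\<in>characters. openin euclidean (U \<xi>)" "y \<in> PiE characters U" "PiE characters U \<subseteq> T"
    by (elim exE conjE)
  define S where "S = {\<xi> \<in> characters. U \<xi> \<noteq> UNIV}"
  have S: "finite S" "S \<subseteq> characters"
    using U(1) by (auto simp: S_def)
  have "\<exists>r>0. ball (y \<xi>) r \<subseteq> U \<xi>" if "\<xi> \<in> S" for \<xi>
  proof -
    have "open (U \<xi>)" "y \<xi> \<in> U \<xi>"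
      using U(2,3) that by (auto simp: S_def PiE_iff)
    then show ?thesis
      unfolding open_contains_ball by simp
  qed
  then obtain r where r: "\<And>\<xi>. \<xi> \<in> S \<Longrightarrow> 0 < r \<xi>" "\<And>\<xi>. \<xi> \<in> S \<Longrightarrow> ball (y \<xi>) (r \<xi>) \<subseteq> U \<xi>"
    by metis
  \<comment> \<open>the element \<open>1\<close> only keeps the minimum defined when \<open>S\<close> is empty\<close>
  define d where "d = Min (insert 1 (r ` S))"
  have d: "0 < d" "\<And>\<xi>. \<xi> \<in> S \<Longrightarrow> d \<le> r \<xi>"
    using S(1) r(1) by (auto simp: d_def)
  have "z \<in> W" if z: "z \<in> carrier bohr_group" "\<forall>\<xi>\<in>S. cmod (z \<xi> - y \<xi>) < d" for z
  proof -
    have "z \<xi> \<in> U \<xi>" if \<xi>: "\<xi> \<in> characters" for \<xi>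
    proof (cases "\<xi> \<in> S")
      case True
      then have "z \<xi> \<in> ball (y \<xi>) (r \<xi>)"
        using z(2) d(2)[OF True] by (force simp: dist_norm norm_minus_commute)
      then show ?thesis
        using r(2)[OF True] by blast
    next
      case False
      then show ?thesis
        using \<xi> by (simp add: S_def)
    qed
    moreover have "z \<in> extensional characters"
      using z(1) by (simp add: bohr_group_simps)
    ultimately have "z \<in> PiE characters U"
      by (simp add: PiE_iff)
    then show ?thesis
      using U(4) T(2) z(1) by auto
  qed
  then show ?thesis
    using S d(1) by blast
qed

text \<open>
  Uniform continuity in terms of finitely many coordinates, by the usual covering argument. The
  coordinates are homomorphisms to the circle, so this modulus is invariant under translations.
\<close>

lemma bohr_uniformly_continuous:
  fixes F :: "(('a::topological_ab_group_add \<Rightarrow> complex) \<Rightarrow> complex) \<Rightarrow> 'c::real_normed_vector"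
  assumes F: "continuous_map bohr_topology euclidean F" and e: "0 < e"
  shows "\<exists>S d. finite S \<and> S \<subseteq> characters \<and> 0 < d \<and>
    (\<forall>y\<in>carrier bohr_group. \<forall>z\<in>carrier bohr_group.
      (\<forall>\<xi>\<in>S. cmod (y \<xi> - z \<xi>) < d) \<longrightarrow> norm (F y - F z) \<le> e)"
proof -
  have "\<exists>S d. finite S \<and> S \<subseteq> characters \<and> 0 < d \<and>
    (\<forall>z\<in>carrier bohr_group. (\<forall>\<xi>\<in>S. cmod (z \<xi> - p \<xi>) < 2 * d) \<longrightarrow> norm (F z - F p) < e / 2)"
    if p: "p \<in> carrier bohr_group" for p
  proof -
    have "openin bohr_topology {z \<in> topspace bohr_topology. F z \<in> ball (F p) (e / 2)}"
      by (rule openin_continuous_map_preimage[OF F]) simp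
    moreover have "p \<in> {z \<in> topspace bohr_topology. F z \<in> ball (F p) (e / 2)}"
      using p e by simp
    ultimately have "\<exists>S d. finite S \<and> S \<subseteq> characters \<and> 0 < d \<and>
      {z \<in> carrier bohr_group. \<forall>\<xi>\<in>S. cmod (z \<xi> - p \<xi>) < d} \<subseteq>
        {z \<in> topspace bohr_topology. F z \<in> ball (F p) (e / 2)}"
      by (rule bohr_basic_neighbourhood)
    then obtain S d where S: "finite S" "S \<subseteq> characters" "0 < d"
      "{z \<in> carrier bohr_group. \<forall>\<xi>\<in>S. cmod (z \<xi> - p \<xi>) < d} \<subseteq>
        {z \<in> topspace bohr_topology. F z \<in> ball (F p) (e / 2)}"
      by (elim exE conjE)
    have "norm (F z - F p) < e / 2"
      if "z \<in> carrier bohr_group" "\<forall>\<xi>\<in>S. cmod (z \<xi> - p \<xi>) < 2 * (d / 2)" for z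
      using subsetD[OF S(4), of z] that by (simp add: dist_norm norm_minus_commute)
    then show ?thesis
      using S(1-3) by (intro exI[of _ S] exI[of _ "d / 2"]) simp
  qed
  then have "\<forall>p\<in>carrier bohr_group. \<exists>Sd. finite (fst Sd) \<and> fst Sd \<subseteq> characters \<and> 0 < snd Sd \<and>
    (\<forall>z\<in>carrier bohr_group. (\<forall>\<xi>\<in>fst Sd. cmod (z \<xi> - p \<xi>) < 2 * snd Sd) \<longrightarrow> norm (F z - F p) < e / 2)"
    by simp
  from bchoice[OF this] obtain Sd' where Sd': "\<forall>p\<in>carrier bohr_group.
    finite (fst (Sd' p)) \<and> fst (Sd' p) \<subseteq> characters \<and> 0 < snd (Sd' p) \<and>
    (\<forall>z\<in>carrier bohr_group. (\<forall>\<xi>\<in>fst (Sd' p). cmod (z \<xi> - p \<xi>) < 2 * snd (Sd' p)) \<longrightarrow>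
      norm (F z - F p) < e / 2)" ..
  define S where "S p = fst (Sd' p)" for p
  define d where "d p = snd (Sd' p)" for p
  have Sd: "finite (S p)" "S p \<subseteq> characters" "0 < d p"
    "\<And>z. z \<in> carrier bohr_group \<Longrightarrow> (\<forall>\<xi>\<in>S p. cmod (z \<xi> - p \<xi>) < 2 * d p) \<Longrightarrow>
      norm (F z - F p) < e / 2" if "p \<in> carrier bohr_group" for p
    using bspec[OF Sd' that] unfolding S_def d_def by simp_all
  define N where "N p = {z \<in> carrier bohr_group. \<forall>\<xi>\<in>S p. cmod (z \<xi> - p \<xi>) < d p}" for p
  have "compactin bohr_topology (carrier bohr_group)"
    using compact_bohr unfolding compact_space_def by simp
  then have "\<exists>\<F>. finite \<F> \<and> \<F> \<subseteq> N ` carrier bohr_group \<and> carrier bohr_group \<subseteq> \<Union> \<F>"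
  proof (rule compactinD)
    show "openin bohr_topology U" if U: "U \<in> N ` carrier bohr_group" for U
    proof -
      obtain p where "p \<in> carrier bohr_group" "U = N p"
        using U by auto
      then show ?thesis
        unfolding N_def by (simp only: openin_bohr_neighbourhood[OF Sd(1,2)])
    qed
    show "carrier bohr_group \<subseteq> \<Union> (N ` carrier bohr_group)"
      using Sd(3) by (auto simp: N_def)
  qed
  then obtain \<F> where \<F>: "finite \<F>" "\<F> \<subseteq> N ` carrier bohr_group" "carrier bohr_group \<subseteq> \<Union> \<F>"
    by (elim exE conjE)
  from finite_subset_image[OF \<F>(1,2)]
  obtain P where P: "P \<subseteq> carrier bohr_group" "finite P" "\<F> = N ` P"
    by (elim exE conjE)
  define S' where "S' = (\<Union>p\<in>P. S p)"
  define d' where "d' = Min (insert 1 (d ` P))"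
  have d': "0 < d'" "\<And>p. p \<in> P \<Longrightarrow> d' \<le> d p"
    using P(1,2) Sd(3) by (auto simp: d'_def)
  have S': "finite S'" "S' \<subseteq> characters"
    using P Sd(1,2) by (auto simp: S'_def)
  have "norm (F y - F z) \<le> e"
    if y: "y \<in> carrier bohr_group" and z: "z \<in> carrier bohr_group" and yz: "\<forall>\<xi>\<in>S'. cmod (y \<xi> - z \<xi>) < d'" for y z
  proof -
    obtain p where p: "p \<in> P" "y \<in> N p"
      using \<F>(3) y P(3) by blast
    then have pK: "p \<in> carrier bohr_group"
      using P(1) by blast
    have near_y: "cmod (y \<xi> - p \<xi>) < d p" if "\<xi> \<in> S p" for \<xi>
      using p(2) that by (simp add: N_def)
    have near_z: "cmod (z \<xi> - p \<xi>) < 2 * d p" if \<xi>: "\<xi> \<in> S p" for \<xi>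
    proof -
      have "cmod (y \<xi> - z \<xi>) < d p"
        using yz p(1) \<xi> d'(2)[OF p(1)] unfolding S'_def by fastforce
      then show ?thesis
        using near_y[OF \<xi>] norm_triangle_ineq4[of "y \<xi> - p \<xi>" "y \<xi> - z \<xi>"] by simp
    qed
    have "norm (F y - F p) < e / 2"
      by (rule Sd(4)[OF pK y]) (use near_y Sd(3)[OF pK] in fastforce)
    moreover have "norm (F z - F p) < e / 2"
      by (rule Sd(4)[OF pK z]) (use near_z in blast)
    ultimately show ?thesis
      using norm_triangle_ineq4[of "F y - F p" "F z - F p"] by simp
  qed
  then show ?thesis
    using S' d'(1) by blast
qed

lemma homeomorphic_maps_bohr_translation:
  assumes a: "a \<in> carrier bohr_group"
  shows "homeomorphic_maps bohr_topology bohr_topology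
    (\<lambda>y. a \<otimes>\<^bsub>bohr_group\<^esub> y) (\<lambda>y. bohr_inverse a \<otimes>\<^bsub>bohr_group\<^esub> y)"
proof -
  have cont: "continuous_map bohr_topology bohr_topology (\<lambda>y. b \<otimes>\<^bsub>bohr_group\<^esub> y)"
    if b: "b \<in> carrier bohr_group" for b :: "('a \<Rightarrow> complex) \<Rightarrow> complex"
  proof -
    have coord: "continuous_map bohr_topology euclidean (\<lambda>y. b \<xi> * y \<xi>)" if "\<xi> \<in> characters" for \<xi>
    proof -
      have "continuous_map bohr_topology euclidean ((\<lambda>z. b \<xi> * z) \<circ> (\<lambda>y. y \<xi>))"
        by (rule continuous_map_compose[OF continuous_map_bohr_character[OF that]])
          (simp add: continuous_on_mult_const)
      then show ?thesis by (simp add: o_def)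
    qed
    have "continuous_map bohr_topology (product_topology (\<lambda>_. euclidean) characters)
        (\<lambda>y. b \<otimes>\<^bsub>bohr_group\<^esub> y)"
      unfolding continuous_map_componentwise bohr_group_simps(2)
      using coord by (auto intro: continuous_map_eq)
    moreover have "(\<lambda>y. b \<otimes>\<^bsub>bohr_group\<^esub> y) \<in> topspace bohr_topology \<rightarrow> carrier bohr_group"
      using bohr_mult_closed[OF b] by auto
    ultimately show ?thesis
      unfolding bohr_topology_def[of] continuous_map_in_subtopology by (simp add: bohr_topology_def)
  qed
  show ?thesis
    unfolding homeomorphic_maps_def
    using cont a bohr_inverse_closed[OF a] bohr_inverse_cancel[OF a] by simp
qed

subsection \<open>Density of the image of the group\<close>

lemma bohr_one:
  assumes "y \<in> carrier bohr_group"
  shows "y (\<lambda>_. 1) = 1"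
proof -
  have "y (\<lambda>_. 1) = y (\<lambda>_. 1) * y (\<lambda>_. 1)"
    using assms characters_closed(1) unfolding bohr_group_simps by fastforce
  moreover have "y (\<lambda>_. 1) \<noteq> 0"
    using bohr_cmod[OF assms characters_closed(1)] by auto
  ultimately show ?thesis by simp
qed

lemma bohr_prod_power:
  assumes y: "y \<in> carrier bohr_group" and S: "finite S" "S \<subseteq> characters"
  shows "(\<lambda>x. \<Prod>\<xi>\<in>S. \<xi> x ^ (k \<xi> :: nat)) \<in> characters \<and>
    y (\<lambda>x. \<Prod>\<xi>\<in>S. \<xi> x ^ k \<xi>) = (\<Prod>\<xi>\<in>S. y \<xi> ^ k \<xi>)"
proof -
  have mult: "y (\<lambda>x. \<xi> x * \<eta> x) = y \<xi> * y \<eta>" if "\<xi> \<in> characters" "\<eta> \<in> characters" for \<xi> \<eta>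
    using y that unfolding bohr_group_simps by blast
  have power: "(\<lambda>x. \<xi> x ^ n) \<in> characters \<and> y (\<lambda>x. \<xi> x ^ n) = y \<xi> ^ n" if "\<xi> \<in> characters" for \<xi> and n :: nat
    by (induction n) (use that characters_closed mult bohr_one[OF y] in auto)
  show ?thesis
    using S
  proof (induction S rule: finite_induct)
    case empty
    then show ?case
      using characters_closed(1) bohr_one[OF y] by simp
  next
    case (insert \<xi> S)
    define P where "P = (\<lambda>x. \<Prod>\<xi>\<in>S. \<xi> x ^ k \<xi>)"
    have P: "P \<in> characters" "y P = (\<Prod>\<xi>\<in>S. y \<xi> ^ k \<xi>)"
      using insert unfolding P_def by auto
    have p: "(\<lambda>x. \<xi> x ^ k \<xi>) \<in> characters" "y (\<lambda>x. \<xi> x ^ k \<xi>) = y \<xi> ^ k \<xi>"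
      using power[of \<xi> "k \<xi>"] insert.prems by auto
    have "(\<lambda>x. \<Prod>\<xi>\<in>insert \<xi> S. \<xi> x ^ k \<xi>) = (\<lambda>x. \<xi> x ^ k \<xi> * P x)"
      using insert.hyps by (simp add: P_def)
    then show ?case
      using characters_closed(2)[OF p(1) P(1)] mult[OF p(1) P(1)] P(2) p(2) insert.hyps by simp
  qed
qed

text \<open>
  A point of the Bohr compactification is a homomorphism on characters, hence it respects all
  multiplicative relations between them, as Kronecker's theorem requires.
\<close>

lemma bohr_map_dense:
  fixes y :: "('a::topological_ab_group_add \<Rightarrow> complex) \<Rightarrow> complex"
  assumes y: "y \<in> carrier bohr_group" and S: "finite S" "S \<subseteq> characters" and d: "0 < d"
  shows "\<exists>x. \<forall>\<xi>\<in>S. cmod (\<xi> x - y \<xi>) < d"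
proof (rule kronecker_approximation[OF S(1) _ _ _ d])
  show "unimodular_hom \<xi>" if "\<xi> \<in> S" for \<xi>
    using S(2) that by (auto simp: characters_iff)
  show "cmod (y \<xi>) = 1" if "\<xi> \<in> S" for \<xi>
    using S(2) that bohr_cmod[OF y] by blast
  fix k l :: "('a \<Rightarrow> complex) \<Rightarrow> nat"
  assume "\<And>x. (\<Prod>\<xi>\<in>S. \<xi> x ^ k \<xi>) = (\<Prod>\<xi>\<in>S. \<xi> x ^ l \<xi>)"
  then have "(\<lambda>x. \<Prod>\<xi>\<in>S. \<xi> x ^ k \<xi>) = (\<lambda>x. \<Prod>\<xi>\<in>S. \<xi> x ^ l \<xi>)"
    by (rule ext)
  then show "(\<Prod>\<xi>\<in>S. y \<xi> ^ k \<xi>) = (\<Prod>\<xi>\<in>S. y \<xi> ^ l \<xi>)"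
    using bohr_prod_power[OF y S, of k] bohr_prod_power[OF y S, of l] by simp
qed

lemma precompact_translates_bohr_map:
  fixes F :: "(('a::topological_ab_group_add \<Rightarrow> complex) \<Rightarrow> complex) \<Rightarrow> complex"
  assumes F: "continuous_map bohr_topology euclidean F"
  shows "precompact_translates (\<lambda>x. F (bohr_map x))"
  unfolding precompact_translates_def
proof (intro allI impI)
  fix e :: real assume "0 < e"
  from bohr_uniformly_continuous[OF F this]
  obtain S d where S: "finite S" "S \<subseteq> characters" "0 < d"
    and unif: "\<forall>y\<in>carrier bohr_group. \<forall>z\<in>carrier bohr_group.
      (\<forall>\<xi>\<in>S. cmod (y \<xi> - z \<xi>) < d) \<longrightarrow> norm (F y - F z) \<le> e"
    by (elim exE conjE)
  have "precompact_translates \<xi>" if "\<xi> \<in> S" for \<xi>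
  proof -
    have "\<xi> \<in> characters" using S(2) that by blast
    then show ?thesis
      by (simp add: characters_iff precompact_translates_unimodular_hom)
  qed
  then obtain c :: "'a \<Rightarrow> nat" where c: "finite (range c)"
    "\<And>\<xi> h k x. \<xi> \<in> S \<Longrightarrow> c h = c k \<Longrightarrow> norm (\<xi> (h + x) - \<xi> (k + x)) \<le> d / 2"
    using precompact_translates_common[of S "\<lambda>\<xi>. \<xi>" "d/2", OF S(1)] S(3) by auto
  have "norm (F (bohr_map (h + x)) - F (bohr_map (k + x))) \<le> e" if "c h = c k" for h k x
  proof (rule unif[rule_format, OF bohr_map_closed bohr_map_closed])
    fix \<xi> assume \<xi>: "\<xi> \<in> S"
    then show "cmod (bohr_map (h + x) \<xi> - bohr_map (k + x) \<xi>) < d"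
      using c(2)[OF \<xi> that, of x] S(2,3) by (simp add: bohr_map_apply subset_eq)
  qed
  then show "\<exists>c::'a \<Rightarrow> nat. finite (range c) \<and>
       (\<forall>h k. c h = c k \<longrightarrow> (\<forall>x. norm (F (bohr_map (h + x)) - F (bohr_map (k + x))) \<le> e))"
    using c(1) by blast
qed

text \<open>
  Translation by a point of the image of the group does not change the mean value; every other
  translation is uniformly close to such a translation.
\<close>

lemma mean_bohr_translation:
  fixes F :: "(('a::topological_ab_group_add \<Rightarrow> complex) \<Rightarrow> complex) \<Rightarrow> complex"
  assumes F: "continuous_map bohr_topology euclidean F" and a: "a \<in> carrier bohr_group"
  shows "mean (\<lambda>x. F (a \<otimes>\<^bsub>bohr_group\<^esub> bohr_map x)) = mean (\<lambda>x. F (bohr_map x))"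
proof -
  note pF = precompact_translates_bohr_map[OF F]
  have "continuous_map bohr_topology bohr_topology (\<lambda>y. a \<otimes>\<^bsub>bohr_group\<^esub> y)"
    using homeomorphic_maps_bohr_translation[OF a] unfolding homeomorphic_maps_def by blast
  from continuous_map_compose[OF this F]
  have pFa: "precompact_translates (\<lambda>x. F (a \<otimes>\<^bsub>bohr_group\<^esub> bohr_map x))"
    using precompact_translates_bohr_map[of "F \<circ> (\<lambda>y. a \<otimes>\<^bsub>bohr_group\<^esub> y)"] by (simp add: o_def)
  have "norm (mean (\<lambda>x. F (a \<otimes>\<^bsub>bohr_group\<^esub> bohr_map x)) - mean (\<lambda>x. F (bohr_map x))) \<le> 0 + e"
    if e: "0 < e" for e
  proof -
    from bohr_uniformly_continuous[OF F e]
    obtain S d where S: "finite S" "S \<subseteq> characters" "0 < d"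
      and unif: "\<forall>y\<in>carrier bohr_group. \<forall>z\<in>carrier bohr_group.
        (\<forall>\<xi>\<in>S. cmod (y \<xi> - z \<xi>) < d) \<longrightarrow> norm (F y - F z) \<le> e"
      by (elim exE conjE)
    obtain x0 where x0: "\<forall>\<xi>\<in>S. cmod (\<xi> x0 - a \<xi>) < d"
      using bohr_map_dense[OF a S] by blast
    have close: "norm (F (a \<otimes>\<^bsub>bohr_group\<^esub> bohr_map x) - F (bohr_map (x0 + x))) \<le> e" for x
    proof (rule unif[rule_format, OF bohr_mult_closed[OF a bohr_map_closed] bohr_map_closed])
      fix \<xi> assume \<xi>: "\<xi> \<in> S"
      then have \<xi>': "\<xi> \<in> characters" "unimodular_hom \<xi>"
        using S(2) by (auto simp: characters_iff)
      have "(a \<otimes>\<^bsub>bohr_group\<^esub> bohr_map x) \<xi> - bohr_map (x0 + x) \<xi> = (a \<xi> - \<xi> x0) * \<xi> x"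
        using \<xi>' by (simp add: bohr_group_simps bohr_map_apply unimodular_hom_def algebra_simps)
      then show "cmod ((a \<otimes>\<^bsub>bohr_group\<^esub> bohr_map x) \<xi> - bohr_map (x0 + x) \<xi>) < d"
        using x0 \<xi> \<xi>'(2) by (simp add: norm_mult unimodular_hom_def norm_minus_commute)
    qed
    have "norm (mean (\<lambda>x. F (a \<otimes>\<^bsub>bohr_group\<^esub> bohr_map x) - F (bohr_map (x0 + x)))) \<le> e"
      by (rule norm_mean_le[OF precompact_translates_diff[OF pFa precompact_translates_shift[OF pF]] close])
    then show ?thesis
      using mean_diff[OF pFa precompact_translates_shift[OF pF, of x0]] mean_shift[OF pF, of x0] by simp
  qed
  then have "norm (mean (\<lambda>x. F (a \<otimes>\<^bsub>bohr_group\<^esub> bohr_map x)) - mean (\<lambda>x. F (bohr_map x))) \<le> 0"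
    by (rule field_le_epsilon)
  then show ?thesis by simp
qed

subsection \<open>Haar measure\<close>

definition bohr_functional :: "((('a::topological_ab_group_add \<Rightarrow> complex) \<Rightarrow> complex) \<Rightarrow> real) \<Rightarrow> real" where
  "bohr_functional F = Re (mean (\<lambda>x. complex_of_real (F (bohr_map x))))"

lemma continuous_map_of_real:
  "continuous_map X euclideanreal F \<Longrightarrow> continuous_map X euclidean (\<lambda>y. complex_of_real (F y))"
  using continuous_map_compose[of X euclideanreal F euclidean complex_of_real]
  by (simp add: o_def continuous_on_of_real_id)

lemma normalized_positive_functional_bohr: "normalized_positive_functional bohr_topology bohr_functional"
proof
  fix F H :: "(('a \<Rightarrow> complex) \<Rightarrow> complex) \<Rightarrow> real"
  assume F: "continuous_map bohr_topology euclideanreal F" and H: "continuous_map bohr_topology euclideanreal H"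
  note pF = precompact_translates_bohr_map[OF continuous_map_of_real[OF F]]
  note pH = precompact_translates_bohr_map[OF continuous_map_of_real[OF H]]
  show "bohr_functional (\<lambda>y. F y + H y) = bohr_functional F + bohr_functional H"
    unfolding bohr_functional_def by (simp add: mean_add[OF pF pH])
  assume "\<And>y. y \<in> topspace bohr_topology \<Longrightarrow> F y \<le> H y"
  then show "bohr_functional F \<le> bohr_functional H"
    unfolding bohr_functional_def by (intro Re_mean_mono pF pH) (simp add: bohr_map_closed)
next
  show "bohr_functional (\<lambda>_. c) = c" for c
    by (simp add: bohr_functional_def mean_const)
qed (rule compact_bohr Hausdorff_bohr)+

interpretation bohr: normalized_positive_functional bohr_topology bohr_functional
  by (rule normalized_positive_functional_bohr)

lemma sigma_sets_homeomorphic_image: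
  assumes hm: "homeomorphic_maps X X \<tau> \<sigma>" and B: "B \<in> sigma_sets (topspace X) {U. openin X U}"
  shows "\<tau> ` B \<in> sigma_sets (topspace X) {U. openin X U}"
  using B
proof induction
  case (Basic U)
  have "openin X (\<tau> ` U)"
    using hm Basic homeomorphic_maps_map homeomorphic_map_openness_eq by (metis mem_Collect_eq)
  then show ?case by (simp add: sigma_sets.Basic)
next
  case Empty
  then show ?case by (simp add: sigma_sets.Empty)
next
  case (Compl B)
  have "B \<subseteq> topspace X"
    using Compl.hyps sigma_sets_into_sp[of "{U. openin X U}" "topspace X"] openin_subset by blast
  moreover have "\<tau> ` topspace X = topspace X" "inj_on \<tau> (topspace X)"
    using hm homeomorphic_maps_map homeomorphic_imp_surjective_map homeomorphic_imp_injective_map by metis+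
  ultimately have "\<tau> ` (topspace X - B) = topspace X - \<tau> ` B"
    using inj_on_image_set_diff[of \<tau> "topspace X" "topspace X" B] by auto
  then show ?case
    using Compl.IH by (simp add: sigma_sets.Compl)
next
  case (Union B)
  then show ?case
    by (simp add: image_UN sigma_sets.Union)
qed

text \<open>
  The measure is constructed from the functional \<open>F \<mapsto> mean (F \<circ> bohr_map)\<close>, which is invariant under
  translations; since the outer measure depends on nothing but the functional and the topology, it
  inherits the invariance.
\<close>

lemma normalized_haar_measure_exists:
  "normalized_haar_measure bohr_group bohr_topology bohr.representing_measure"
  unfolding normalized_haar_measure_def
proof (intro conjI ballI)
  show "space bohr.representing_measure = topspace bohr_topology"
    by (rule bohr.space_representing_measure)
  show "sets bohr.representing_measure = sigma_sets (topspace bohr_topology) {U. openin bohr_topology U}"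
    by (rule bohr.sets_representing_measure)
  show "emeasure bohr.representing_measure (topspace bohr_topology) = 1"
    by (rule bohr.emeasure_representing_topspace)
  show "emeasure bohr.representing_measure B =
      (SUP C\<in>{C. compactin bohr_topology C \<and> C \<subseteq> B}. emeasure bohr.representing_measure C)"
    if "B \<in> sets bohr.representing_measure" for B :: "(('a \<Rightarrow> complex) \<Rightarrow> complex) set"
    by (rule bohr.inner_regular[OF that])
next
  fix a :: "('a \<Rightarrow> complex) \<Rightarrow> complex" and B :: "(('a \<Rightarrow> complex) \<Rightarrow> complex) set"
  assume a: "a \<in> carrier bohr_group" and B: "B \<in> sets bohr.representing_measure"
  let ?\<tau> = "\<lambda>y. a \<otimes>\<^bsub>bohr_group\<^esub> y" and ?\<sigma> = "\<lambda>y. bohr_inverse a \<otimes>\<^bsub>bohr_group\<^esub> y"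
  have inv: "bohr_functional (\<lambda>y. f (b \<otimes>\<^bsub>bohr_group\<^esub> y)) = bohr_functional f"
    if "b \<in> carrier bohr_group" "continuous_map bohr_topology euclideanreal f"
    for b :: "('a \<Rightarrow> complex) \<Rightarrow> complex" and f
    using mean_bohr_translation[OF continuous_map_of_real[OF that(2)] that(1)]
    by (simp add: bohr_functional_def)
  have hm: "homeomorphic_maps bohr_topology bohr_topology ?\<tau> ?\<sigma>"
    by (rule homeomorphic_maps_bohr_translation[OF a])
  have B': "B \<in> sigma_sets (topspace bohr_topology) {U. openin bohr_topology U}"
    using B by (simp only: bohr.sets_representing_measure)
  have sub: "B \<subseteq> topspace bohr_topology"
    using sets.sets_into_space[OF B] by (simp only: bohr.space_representing_measure)
  note im = sigma_sets_homeomorphic_image[OF hm B']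
  have "bohr.outer (?\<tau> ` B) \<le> bohr.outer B"
    by (rule bohr.outer_image_le[OF hm sub inv[OF a]])
  moreover have "bohr.outer (?\<sigma> ` (?\<tau> ` B)) \<le> bohr.outer (?\<tau> ` B)"
  proof (rule bohr.outer_image_le[OF _ _ inv[OF bohr_inverse_closed[OF a]]])
    show "homeomorphic_maps bohr_topology bohr_topology ?\<sigma> ?\<tau>"
      using hm homeomorphic_maps_sym by blast
    show "?\<tau> ` B \<subseteq> topspace bohr_topology"
      using sub bohr_mult_closed[OF a] by auto
  qed
  moreover have "?\<sigma> ` (?\<tau> ` B) = B"
  proof -
    have "?\<sigma> (?\<tau> y) = y" if "y \<in> B" for y
      using bohr_inverse_cancel(1)[OF a] sub that by auto
    then show ?thesis
      by (simp add: image_image)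
  qed
  ultimately have "bohr.outer (?\<tau> ` B) = bohr.outer B"
    by simp
  then show "emeasure bohr.representing_measure (?\<tau> ` B) = emeasure bohr.representing_measure B"
    using bohr.emeasure_representing_measure[OF im] bohr.emeasure_representing_measure[OF B'] by simp
qed

lemma normalized_haar_measure_bohr_haar: "normalized_haar_measure bohr_group bohr_topology bohr_haar"
  unfolding bohr_haar_def by (rule someI) (rule normalized_haar_measure_exists)

section \<open>Haar integrals are mean values\<close>

text \<open>
  Some average of translates of \<open>F\<close> by points of the group is uniformly close to the constant
  \<open>mean (F \<circ> bohr_map)\<close>, first on the image of the group and then everywhere by density. By invariance
  this average has the same integral as \<open>F\<close>.
\<close>

lemma bohr_integral_eq_mean:
  fixes F :: "(('a::topological_ab_group_add \<Rightarrow> complex) \<Rightarrow> complex) \<Rightarrow> complex"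
  assumes \<nu>: "normalized_haar_measure bohr_group bohr_topology \<nu>"
    and F: "continuous_map bohr_topology euclidean F"
  shows "(\<integral>y. F y \<partial>\<nu>) = mean (\<lambda>x. F (bohr_map x))"
proof -
  have space: "space \<nu> = carrier bohr_group"
    and sets: "sets \<nu> = sigma_sets (topspace bohr_topology) {U. openin bohr_topology U}"
    and total: "emeasure \<nu> (carrier bohr_group) = 1"
    and inv: "\<And>a B. a \<in> carrier bohr_group \<Longrightarrow> B \<in> sets \<nu> \<Longrightarrow>
      emeasure \<nu> ((\<lambda>y. a \<otimes>\<^bsub>bohr_group\<^esub> y) ` B) = emeasure \<nu> B"
    using \<nu> unfolding normalized_haar_measure_def by auto
  interpret finite_measure \<nu>
    by (rule finite_measureI) (simp add: space total)
  have measure_space: "measure \<nu> (space \<nu>) = 1"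
    by (simp add: measure_def space total)
  have meas: "H \<in> borel_measurable \<nu>" if H: "continuous_map bohr_topology euclidean H"
    for H :: "(('a \<Rightarrow> complex) \<Rightarrow> complex) \<Rightarrow> complex"
  proof (rule borel_measurableI)
    fix S :: "complex set" assume "open S"
    then have "openin bohr_topology {y \<in> topspace bohr_topology. H y \<in> S}"
      by (intro openin_continuous_map_preimage[OF H]) simp
    moreover have "H -` S \<inter> space \<nu> = {y \<in> topspace bohr_topology. H y \<in> S}"
      by (auto simp: space)
    ultimately show "H -` S \<inter> space \<nu> \<in> sets \<nu>"
      unfolding sets by (simp add: sigma_sets.Basic)
  qed
  have integrable: "integrable \<nu> H" if H: "continuous_map bohr_topology euclidean H"
    for H :: "(('a \<Rightarrow> complex) \<Rightarrow> complex) \<Rightarrow> complex"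
  proof -
    have "compactin euclidean (H ` topspace bohr_topology)"
      using compact_bohr unfolding compact_space_def by (rule image_compactin[OF _ H])
    then have "bounded (H ` carrier bohr_group)"
      by (simp add: compact_imp_bounded)
    then obtain B where "\<forall>y\<in>carrier bohr_group. norm (H y) \<le> B"
      unfolding bounded_iff by blast
    then show ?thesis
      by (intro integrable_const_bound[of _ B] meas H AE_I2) (simp add: space)
  qed
  have cont_trans: "continuous_map bohr_topology euclidean (\<lambda>y. F (a \<otimes>\<^bsub>bohr_group\<^esub> y))"
    if a: "a \<in> carrier bohr_group" for a
    using homeomorphic_maps_bohr_translation[OF a] continuous_map_compose[OF _ F]
    unfolding homeomorphic_maps_def by (auto simp: o_def)
  have trans: "(\<integral>y. F (a \<otimes>\<^bsub>bohr_group\<^esub> y) \<partial>\<nu>) = (\<integral>y. F y \<partial>\<nu>)" if a: "a \<in> carrier bohr_group" for a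
  proof -
    let ?\<tau> = "\<lambda>y. a \<otimes>\<^bsub>bohr_group\<^esub> y" and ?\<sigma> = "\<lambda>y. bohr_inverse a \<otimes>\<^bsub>bohr_group\<^esub> y"
    have hm: "homeomorphic_maps bohr_topology bohr_topology ?\<sigma> ?\<tau>"
      using homeomorphic_maps_bohr_translation[OF a] homeomorphic_maps_sym by blast
    have preimage: "?\<tau> -` B \<inter> space \<nu> = ?\<sigma> ` B" "?\<sigma> ` B \<in> sets \<nu>" if B: "B \<in> sets \<nu>" for B
    proof -
      show "?\<sigma> ` B \<in> sets \<nu>"
        using sigma_sets_homeomorphic_image[OF hm] B unfolding sets by blast
      have sub: "B \<subseteq> carrier bohr_group"
        using sets.sets_into_space[OF B] space by simp
      show "?\<tau> -` B \<inter> space \<nu> = ?\<sigma> ` B"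
      proof (intro equalityI subsetI)
        fix y assume "y \<in> ?\<tau> -` B \<inter> space \<nu>"
        then have "?\<tau> y \<in> B" "y = ?\<sigma> (?\<tau> y)"
          using bohr_inverse_cancel(1)[OF a] space by auto
        then show "y \<in> ?\<sigma> ` B" by blast
      next
        fix y assume "y \<in> ?\<sigma> ` B"
        then show "y \<in> ?\<tau> -` B \<inter> space \<nu>"
          using sub bohr_inverse_cancel(2)[OF a] bohr_mult_closed[OF bohr_inverse_closed[OF a]] space
          by auto
      qed
    qed
    have \<tau>m: "?\<tau> \<in> measurable \<nu> \<nu>"
      by (rule measurableI) (use preimage bohr_mult_closed[OF a] space in auto)
    have "distr \<nu> \<nu> ?\<tau> = \<nu>"
    proof (rule measure_eqI)
      fix B assume "B \<in> sets (distr \<nu> \<nu> ?\<tau>)"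
      then have B: "B \<in> sets \<nu>" by simp
      show "emeasure (distr \<nu> \<nu> ?\<tau>) B = emeasure \<nu> B"
        unfolding emeasure_distr[OF \<tau>m B] preimage(1)[OF B]
        by (rule inv[OF bohr_inverse_closed[OF a] B])
    qed simp
    then show ?thesis
      using integral_distr[OF \<tau>m meas[OF F]] by simp
  qed
  note pF = precompact_translates_bohr_map[OF F]
  define c where "c = mean (\<lambda>x. F (bohr_map x))"
  have "norm ((\<integral>y. F y \<partial>\<nu>) - c) \<le> 0 + e" if "0 < e" for e
  proof -
    have e: "0 < e / 2" using that by simp
    obtain as where as: "as \<noteq> []"
      "\<And>x. norm (translation_average as (\<lambda>x. F (bohr_map x)) x - c) \<le> e / 2"
      using has_mean_mean[OF pF] e unfolding has_mean_def c_def by blast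
    have n: "0 < real (length as)" using as(1) by simp
    define A where "A y = (\<Sum>a\<leftarrow>as. F (bohr_map a \<otimes>\<^bsub>bohr_group\<^esub> y)) /\<^sub>R real (length as)" for y
    from bohr_uniformly_continuous[OF F e]
    obtain S d where S: "finite S" "S \<subseteq> characters" "0 < d"
      and unif: "\<forall>y\<in>carrier bohr_group. \<forall>z\<in>carrier bohr_group.
        (\<forall>\<xi>\<in>S. cmod (y \<xi> - z \<xi>) < d) \<longrightarrow> norm (F y - F z) \<le> e / 2"
      by (elim exE conjE)
    have A_le: "norm (A y - c) \<le> e" if y: "y \<in> carrier bohr_group" for y
    proof -
      obtain x where x: "\<forall>\<xi>\<in>S. cmod (\<xi> x - y \<xi>) < d"
        using bohr_map_dense[OF y S] by blast
      have close: "norm (F (bohr_map a \<otimes>\<^bsub>bohr_group\<^esub> y) - F (bohr_map (a + x))) \<le> e / 2" for a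
      proof (rule unif[rule_format, OF bohr_mult_closed[OF bohr_map_closed y] bohr_map_closed])
        fix \<xi> assume \<xi>: "\<xi> \<in> S"
        then have \<xi>': "\<xi> \<in> characters" "unimodular_hom \<xi>"
          using S(2) by (auto simp: characters_iff)
        have "(bohr_map a \<otimes>\<^bsub>bohr_group\<^esub> y) \<xi> - bohr_map (a + x) \<xi> = \<xi> a * (y \<xi> - \<xi> x)"
          using \<xi>' by (simp add: bohr_group_simps bohr_map_apply unimodular_hom_def algebra_simps)
        then show "cmod ((bohr_map a \<otimes>\<^bsub>bohr_group\<^esub> y) \<xi> - bohr_map (a + x) \<xi>) < d"
          using x \<xi> \<xi>'(2) by (simp add: norm_mult unimodular_hom_def norm_minus_commute)
      qed
      have "A y - translation_average as (\<lambda>x. F (bohr_map x)) x =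
          (\<Sum>a\<leftarrow>as. F (bohr_map a \<otimes>\<^bsub>bohr_group\<^esub> y) - F (bohr_map (a + x))) /\<^sub>R real (length as)"
        unfolding A_def translation_average_def
        by (simp add: sum_list_subtractf scaleR_right_diff_distrib)
      also have "norm \<dots> \<le> e / 2"
        using norm_sum_list_le[of as "\<lambda>a. F (bohr_map a \<otimes>\<^bsub>bohr_group\<^esub> y) - F (bohr_map (a + x))" "e / 2"]
          close n by (simp add: field_simps)
      finally have "norm (A y - translation_average as (\<lambda>x. F (bohr_map x)) x) \<le> e / 2" .
      then show ?thesis
        using norm_diff_triangle_le[OF _ as(2)[of x]] by fastforce
    qed
    have "integrable \<nu> (\<lambda>y. \<Sum>a\<leftarrow>bs. F (bohr_map a \<otimes>\<^bsub>bohr_group\<^esub> y)) \<and>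
        (\<integral>y. (\<Sum>a\<leftarrow>bs. F (bohr_map a \<otimes>\<^bsub>bohr_group\<^esub> y)) \<partial>\<nu>) = real (length bs) *\<^sub>R (\<integral>y. F y \<partial>\<nu>)" for bs
    proof (induction bs)
      case (Cons b bs)
      have "integrable \<nu> (\<lambda>y. F (bohr_map b \<otimes>\<^bsub>bohr_group\<^esub> y))"
        by (intro integrable cont_trans bohr_map_closed)
      then show ?case
        using Cons trans[OF bohr_map_closed, of b] by (simp add: algebra_simps)
    qed simp
    then have A_int: "integrable \<nu> A" "(\<integral>y. A y \<partial>\<nu>) = (\<integral>y. F y \<partial>\<nu>)"
      using n by (simp_all add: A_def[abs_def])
    have "(\<integral>y. A y - c \<partial>\<nu>) = (\<integral>y. F y \<partial>\<nu>) - c"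
      using A_int measure_space by (simp add: Bochner_Integration.integral_diff)
    moreover have "norm (\<integral>y. A y - c \<partial>\<nu>) \<le> e"
    proof -
      have "norm (\<integral>y. A y - c \<partial>\<nu>) \<le> (\<integral>y. norm (A y - c) \<partial>\<nu>)"
        by (rule integral_norm_bound)
      also have "\<dots> \<le> (\<integral>y. e \<partial>\<nu>)"
        using A_int(1) A_le by (intro integral_mono) (auto simp: space)
      also have "\<dots> = e"
        using measure_space by simp
      finally show ?thesis .
    qed
    ultimately show ?thesis by simp
  qed
  then have "norm ((\<integral>y. F y \<partial>\<nu>) - c) \<le> 0"
    by (rule field_le_epsilon)
  then show ?thesis
    by (simp add: c_def)
qed

section \<open>Extension of almost periodic functions to the Bohr compactification\<close>

text \<open>
  For every tolerance \<open>1 / Suc m\<close> a finite set \<open>S m\<close> of characters controls \<open>\<gamma>\<close>. Hence \<open>\<gamma>\<close> is a Cauchy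
  net along the points of the group that approach a point \<open>y\<close> of the Bohr compactification, and its
  limit at \<open>y\<close> depends continuously on \<open>y\<close>.
\<close>

lemma bohr_extension_exists:
  fixes \<gamma> :: "'a::topological_ab_group_add \<Rightarrow> complex"
  assumes \<gamma>: "\<gamma> \<in> almost_periodic"
  shows "\<exists>F. continuous_map bohr_topology euclidean F \<and> (\<forall>x. F (bohr_map x) = \<gamma> x)"
proof -
  have "\<forall>m. \<exists>Sd. finite (fst Sd) \<and> fst Sd \<subseteq> characters \<and> 0 < snd Sd \<and>
    (\<forall>a b. (\<forall>\<xi>\<in>fst Sd. cmod (\<xi> a - \<xi> b) < snd Sd) \<longrightarrow> cmod (\<gamma> a - \<gamma> b) \<le> 1 / real (Suc m))"
  proof
    fix m
    have "0 < 1 / real (Suc m)" by simp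
    from almost_periodic_bohr_neighbourhood[OF \<gamma> this]
    obtain S d where S: "finite S" "S \<subseteq> {\<xi> \<in> characters. mean (\<lambda>x. \<gamma> x * cnj (\<xi> x)) \<noteq> 0}" "0 < d"
      "\<forall>a b x. (\<forall>\<xi>\<in>S. cmod (\<xi> a - \<xi> b) < d) \<longrightarrow> cmod (\<gamma> (a + x) - \<gamma> (b + x)) \<le> 1 / real (Suc m)"
      by (elim exE conjE)
    have "cmod (\<gamma> a - \<gamma> b) \<le> 1 / real (Suc m)" if "\<forall>\<xi>\<in>S. cmod (\<xi> a - \<xi> b) < d" for a b
      using S(4)[rule_format, of a b 0] that by simp
    then show "\<exists>Sd. finite (fst Sd) \<and> fst Sd \<subseteq> characters \<and> 0 < snd Sd \<and>
      (\<forall>a b. (\<forall>\<xi>\<in>fst Sd. cmod (\<xi> a - \<xi> b) < snd Sd) \<longrightarrow> cmod (\<gamma> a - \<gamma> b) \<le> 1 / real (Suc m))"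
      using S(1-3) by (intro exI[of _ "(S, d)"]) auto
  qed
  from choice[OF this] obtain Sd where Sd: "\<forall>m. finite (fst (Sd m)) \<and> fst (Sd m) \<subseteq> characters \<and> 0 < snd (Sd m) \<and>
    (\<forall>a b. (\<forall>\<xi>\<in>fst (Sd m). cmod (\<xi> a - \<xi> b) < snd (Sd m)) \<longrightarrow> cmod (\<gamma> a - \<gamma> b) \<le> 1 / real (Suc m))" ..
  define S where "S m = fst (Sd m)" for m
  define d where "d m = snd (Sd m)" for m
  have S: "finite (S m)" "S m \<subseteq> characters" "0 < d m" for m
    using Sd unfolding S_def d_def by auto
  have close: "cmod (\<gamma> a - \<gamma> b) \<le> 1 / real (Suc m)" if "\<forall>\<xi>\<in>S m. cmod (\<xi> a - \<xi> b) < d m" for a b m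
    using Sd that unfolding S_def d_def by blast
  define near where "near y m x \<longleftrightarrow> (\<forall>\<xi>\<in>S m. cmod (\<xi> x - y \<xi>) < d m / 2)" for y m x
  have near_close: "cmod (\<gamma> a - \<gamma> b) \<le> 1 / real (Suc m)" if "near y m a" "near y m b" for y m a b
  proof (rule close, rule ballI)
    fix \<xi> assume "\<xi> \<in> S m"
    then have "cmod (\<xi> a - y \<xi>) < d m / 2" "cmod (\<xi> b - y \<xi>) < d m / 2"
      using that by (auto simp: near_def)
    then show "cmod (\<xi> a - \<xi> b) < d m"
      using norm_triangle_ineq4[of "\<xi> a - y \<xi>" "\<xi> b - y \<xi>"] by simp
  qed
  have "\<exists>c. \<forall>m x. near y m x \<longrightarrow> cmod (\<gamma> x - c) \<le> 1 / real (Suc m)" if y: "y \<in> carrier bohr_group" for y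
  proof -
    have "\<exists>x. \<forall>l\<le>m. near y l x" for m
    proof -
      \<comment> \<open>one point of the group that is near \<open>y\<close> for all tolerances up to index \<open>m\<close> at once\<close>
      define D where "D = Min ((\<lambda>l. d l / 2) ` {..m})"
      have "0 < D"
        using S(3) by (simp add: D_def)
      moreover have "\<And>l. l \<le> m \<Longrightarrow> D \<le> d l / 2"
        unfolding D_def by (intro Min_le) auto
      moreover obtain x where "\<forall>\<xi>\<in>(\<Union>l\<le>m. S l). cmod (\<xi> x - y \<xi>) < D"
        using bohr_map_dense[OF y _ _ \<open>0 < D\<close>, of "\<Union>l\<le>m. S l"] S(1,2) by blast
      ultimately show ?thesis
        unfolding near_def by (meson UN_I atMost_iff less_le_trans)
    qed
    then obtain x where x: "\<And>m l. l \<le> m \<Longrightarrow> near y l (x m)"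
      by metis
    have "Cauchy (\<lambda>m. \<gamma> (x m))"
    proof (rule metric_CauchyI)
      fix e :: real assume "0 < e"
      then obtain M where "inverse (real (Suc M)) < e"
        using reals_Archimedean by blast
      then have M: "1 / real (Suc M) < e"
        by (simp add: inverse_eq_divide)
      have "dist (\<gamma> (x m)) (\<gamma> (x n)) < e" if "m \<ge> M" "n \<ge> M" for m n
        using near_close[OF x[OF that(1)] x[OF that(2)]] M by (simp add: dist_norm)
      then show "\<exists>M. \<forall>m\<ge>M. \<forall>n\<ge>M. dist (\<gamma> (x m)) (\<gamma> (x n)) < e"
        by blast
    qed
    then obtain c where c: "(\<lambda>m. \<gamma> (x m)) \<longlonglongrightarrow> c"
      using Cauchy_convergent convergent_def by blast
    have "cmod (\<gamma> z - c) \<le> 1 / real (Suc m)" if "near y m z" for m z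
    proof (rule tendsto_upperbound)
      show "(\<lambda>n. cmod (\<gamma> z - \<gamma> (x n))) \<longlonglongrightarrow> cmod (\<gamma> z - c)"
        by (intro tendsto_intros c)
      show "\<forall>\<^sub>F n in sequentially. cmod (\<gamma> z - \<gamma> (x n)) \<le> 1 / real (Suc m)"
        using eventually_ge_at_top[of m]
        by eventually_elim (rule near_close[OF that x])
    qed simp
    then show ?thesis by blast
  qed
  then have "\<forall>y\<in>carrier bohr_group. \<exists>c. \<forall>m x. near y m x \<longrightarrow> cmod (\<gamma> x - c) \<le> 1 / real (Suc m)"
    by simp
  from bchoice[OF this] obtain F where F: "\<forall>y\<in>carrier bohr_group. \<forall>m x. near y m x \<longrightarrow>
      cmod (\<gamma> x - F y) \<le> 1 / real (Suc m)" ..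
  have F_ext: "F (bohr_map x) = \<gamma> x" for x
  proof -
    have "cmod (\<gamma> x - F (bohr_map x)) \<le> 1 / real (Suc m)" for m
    proof -
      have "near (bohr_map x) m x"
        unfolding near_def using S(2,3)[of m] by (auto simp: bohr_map_apply subset_eq)
      then show ?thesis
        using F bohr_map_closed by blast
    qed
    moreover have "(\<lambda>m. 1 / real (Suc m)) \<longlonglongrightarrow> 0"
      using LIMSEQ_inverse_real_of_nat by (simp add: inverse_eq_divide)
    ultimately have "cmod (\<gamma> x - F (bohr_map x)) \<le> 0"
      by (intro tendsto_lowerbound[of "\<lambda>m. 1 / real (Suc m)" 0 sequentially]) auto
    then show ?thesis by simp
  qed
  have F_close: "cmod (F y - F z) \<le> 2 / real (Suc m)"
    if y: "y \<in> carrier bohr_group" and z: "z \<in> carrier bohr_group"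
      and yz: "\<forall>\<xi>\<in>S m. cmod (z \<xi> - y \<xi>) < d m / 4" for y z m
  proof -
    have "0 < d m / 4" using S(3)[of m] by simp
    then obtain x where x: "\<forall>\<xi>\<in>S m. cmod (\<xi> x - y \<xi>) < d m / 4"
      using bohr_map_dense[OF y S(1,2)] by blast
    have "near y m x"
      using x S(3)[of m] unfolding near_def by fastforce
    moreover have "near z m x"
      unfolding near_def
    proof
      fix \<xi> assume "\<xi> \<in> S m"
      then have "cmod (\<xi> x - y \<xi>) < d m / 4" "cmod (z \<xi> - y \<xi>) < d m / 4"
        using x yz by auto
      then show "cmod (\<xi> x - z \<xi>) < d m / 2"
        using norm_triangle_ineq4[of "\<xi> x - y \<xi>" "z \<xi> - y \<xi>"] by simp
    qed
    ultimately have "cmod (\<gamma> x - F y) \<le> 1 / real (Suc m)" "cmod (\<gamma> x - F z) \<le> 1 / real (Suc m)"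
      using F y z by blast+
    then show ?thesis
      using norm_triangle_ineq4[of "\<gamma> x - F z" "\<gamma> x - F y"] by simp
  qed
  have "continuous_map bohr_topology euclidean F"
    unfolding continuous_map_def
  proof (intro conjI allI impI)
    fix W :: "complex set" assume "openin euclidean W"
    then have W: "open W" by simp
    show "openin bohr_topology {y \<in> topspace bohr_topology. F y \<in> W}"
    proof (subst openin_subopen, rule ballI)
      fix y assume "y \<in> {y \<in> topspace bohr_topology. F y \<in> W}"
      then have y: "y \<in> carrier bohr_group" "F y \<in> W" by auto
      obtain e where e: "0 < e" "ball (F y) e \<subseteq> W"
        using W y(2) unfolding open_contains_ball by blast
      have "0 < e / 2" using e(1) by simp
      then obtain m where "inverse (real (Suc m)) < e / 2"
        using reals_Archimedean by blast
      then have m: "2 / real (Suc m) < e"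
        by (simp add: inverse_eq_divide)
      define N where "N = {z \<in> carrier bohr_group. \<forall>\<xi>\<in>S m. cmod (z \<xi> - y \<xi>) < d m / 4}"
      have "openin bohr_topology N"
        unfolding N_def by (rule openin_bohr_neighbourhood[OF S(1,2)])
      moreover have "y \<in> N"
        unfolding N_def using y(1) S(3)[of m] by simp
      moreover have "N \<subseteq> {y \<in> topspace bohr_topology. F y \<in> W}"
      proof
        fix z assume z: "z \<in> N"
        then have "cmod (F y - F z) < e"
          using F_close[OF y(1), of z m] m unfolding N_def by auto
        then have "F z \<in> ball (F y) e"
          by (simp add: dist_norm)
        then show "z \<in> {y \<in> topspace bohr_topology. F y \<in> W}"
          using e(2) z unfolding N_def by auto
      qed
      ultimately show "\<exists>T. openin bohr_topology T \<and> y \<in> T \<and> T \<subseteq> {y \<in> topspace bohr_topology. F y \<in> W}"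
        by blast
    qed
  qed simp
  then show ?thesis
    using F_ext by blast
qed

lemma bohr_extension:
  assumes "\<gamma> \<in> almost_periodic"
  shows "continuous_map bohr_topology euclidean (bohr_extension \<gamma>)"
    "bohr_extension \<gamma> (bohr_map x) = \<gamma> x"
  using someI_ex[OF bohr_extension_exists[OF assms]] unfolding bohr_extension_def by auto

lemma fourier_coefficient_eq_mean:
  assumes \<gamma>: "\<gamma> \<in> almost_periodic" and \<xi>: "\<xi> \<in> characters"
  shows "fourier_coefficient \<gamma> \<xi> = mean (\<lambda>x. \<gamma> x * cnj (\<xi> x))"
proof -
  have cont: "continuous_map bohr_topology euclidean (\<lambda>y. bohr_extension \<gamma> y * cnj (y \<xi>))"
  proof -
    have "continuous_map bohr_topology euclidean (\<lambda>y. (bohr_extension \<gamma> y, y \<xi>))"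
      using bohr_extension(1)[OF \<gamma>] continuous_map_bohr_character[OF \<xi>]
      by (simp add: continuous_map_pairedI flip: prod_topology_euclidean)
    then have "continuous_map bohr_topology euclidean
        ((\<lambda>z. fst z * cnj (snd z)) \<circ> (\<lambda>y. (bohr_extension \<gamma> y, y \<xi>)))"
      by (rule continuous_map_compose)
        (simp add: continuous_on_mult continuous_on_fst continuous_on_snd continuous_on_id continuous_on_cnj)
    then show ?thesis by (simp add: o_def)
  qed
  show ?thesis
    unfolding fourier_coefficient_def
      bohr_integral_eq_mean[OF normalized_haar_measure_bohr_haar cont]
    by (simp add: bohr_extension(2)[OF \<gamma>] bohr_map_apply[OF \<xi>])
qed

lemma spectrum_eq:
  assumes "\<gamma> \<in> almost_periodic"
  shows "spectrum \<gamma> = {\<xi> \<in> characters. mean (\<lambda>x. \<gamma> x * cnj (\<xi> x)) \<noteq> 0}"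
  unfolding spectrum_def using fourier_coefficient_eq_mean[OF assms] by auto

section \<open>The cohomological equation\<close>

lemma orbit_sum_eq: "orbit_sum g \<gamma> n x = (\<Sum>k<Suc n. \<gamma> (nat_multiple k g + x))"
  unfolding orbit_sum_def funpow_plus_eq by (intro sum.cong) auto

lemma almost_periodic_imp_continuous: "\<gamma> \<in> almost_periodic \<Longrightarrow> continuous_on UNIV \<gamma>"
  by (simp add: almost_periodic_def)

lemma solution_imp_bounded_orbit_sums:
  assumes \<phi>: "\<phi> \<in> almost_periodic" and sol: "solves_cohomological_equation g \<gamma> \<phi>"
  shows "uniformly_bounded_orbit_sums g \<gamma>"
proof -
  have telescope: "(\<Sum>k<n. \<gamma> (nat_multiple k g + x)) = \<phi> (nat_multiple n g + x) - \<phi> x" for n x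
  proof (induction n)
    case (Suc n)
    have "\<gamma> (nat_multiple n g + x) = \<phi> (nat_multiple (Suc n) g + x) - \<phi> (nat_multiple n g + x)"
      using sol unfolding solves_cohomological_equation_def by (simp add: add.assoc)
    then show ?case
      using Suc by simp
  qed simp
  obtain B where B: "\<And>x. cmod (\<phi> x) \<le> B"
    using precompact_translates_bounded[OF almost_periodic_precompact_translates[OF \<phi>]] by blast
  have "cmod (orbit_sum g \<gamma> n x) \<le> 2 * B" for n x
    unfolding orbit_sum_eq telescope
    using norm_triangle_ineq4[of "\<phi> (nat_multiple (Suc n) g + x)" "\<phi> x"]
      B[of "nat_multiple (Suc n) g + x"] B[of x] by linarith
  then show ?thesis
    unfolding uniformly_bounded_orbit_sums_def by blast
qed

text \<open>
  The real and imaginary parts are solved separately, both with the density of the orbit of \<open>g\<close> with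
  respect to \<open>\<gamma>\<close>; for real \<open>\<gamma>\<close> the function \<open>transfer\<close> is literally the stated supremum.
\<close>

theorem theorem7p11:
  fixes g :: "'a::topological_ab_group_add"
    and \<gamma> :: "'a \<Rightarrow> complex"
  assumes "\<gamma> \<in> almost_periodic"
    and "annihilator g \<inter> spectral_subgroup \<gamma> = {\<lambda>_. 1}"
  shows "((\<exists>\<phi>\<in>almost_periodic. solves_cohomological_equation g \<gamma> \<phi>) \<longleftrightarrow>
            uniformly_bounded_orbit_sums g \<gamma>)
       \<and> (uniformly_bounded_orbit_sums g \<gamma> \<and> (\<forall>x. \<gamma> x \<in> \<real>) \<longrightarrow>
            (\<lambda>x. complex_of_real (SUP n. - Re (orbit_sum g \<gamma> n x))) \<in> almost_periodic \<and>
            solves_cohomological_equation g \<gamma>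
              (\<lambda>x. complex_of_real (SUP n. - Re (orbit_sum g \<gamma> n x))))"
proof -
  note pc = almost_periodic_precompact_translates[OF assms(1)]
  note cont = almost_periodic_imp_continuous[OF assms(1)]
  have dense: "\<exists>n. \<forall>x. cmod (\<gamma> (nat_multiple n g + x) - \<gamma> (a + x)) \<le> e" if "0 < e" for a e
    using orbit_dense[OF assms(1) that] assms(2)
    unfolding spectral_subgroup_def spectrum_eq[OF assms(1)] by blast
  have cocycle: "bounded_almost_periodic_cocycle g \<gamma> (\<lambda>x. Re (\<gamma> x)) C"
    "bounded_almost_periodic_cocycle g \<gamma> (\<lambda>x. Im (\<gamma> x)) C"
    if C: "\<And>n x. cmod (orbit_sum g \<gamma> n x) \<le> C" for C
  proof -
    show "bounded_almost_periodic_cocycle g \<gamma> (\<lambda>x. Re (\<gamma> x)) C"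
    proof
      show "\<bar>Re (\<gamma> x) - Re (\<gamma> y)\<bar> \<le> cmod (\<gamma> x - \<gamma> y)" for x y
        using abs_Re_le_cmod[of "\<gamma> x - \<gamma> y"] by simp
      show "\<bar>partial_sum g (\<lambda>x. Re (\<gamma> x)) (Suc n) x\<bar> \<le> C" for n x
        using order_trans[OF abs_Re_le_cmod C[of n x]]
        unfolding orbit_sum_eq partial_sum_def by (simp only: Re_sum)
    qed (rule cont pc)+
    show "bounded_almost_periodic_cocycle g \<gamma> (\<lambda>x. Im (\<gamma> x)) C"
    proof
      show "\<bar>Im (\<gamma> x) - Im (\<gamma> y)\<bar> \<le> cmod (\<gamma> x - \<gamma> y)" for x y
        using abs_Im_le_cmod[of "\<gamma> x - \<gamma> y"] by simp
      show "\<bar>partial_sum g (\<lambda>x. Im (\<gamma> x)) (Suc n) x\<bar> \<le> C" for n x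
        using order_trans[OF abs_Im_le_cmod C[of n x]]
        unfolding orbit_sum_eq partial_sum_def by (simp only: Im_sum)
    qed (rule cont pc)+
  qed
  have exists: "\<exists>\<phi>\<in>almost_periodic. solves_cohomological_equation g \<gamma> \<phi>"
    if bounded: "uniformly_bounded_orbit_sums g \<gamma>"
  proof -
    obtain C where C: "\<And>n x. cmod (orbit_sum g \<gamma> n x) \<le> C"
      using bounded unfolding uniformly_bounded_orbit_sums_def by blast
    interpret re: bounded_almost_periodic_cocycle g \<gamma> "\<lambda>x. Re (\<gamma> x)" C
      by (rule cocycle(1)[OF C])
    interpret im: bounded_almost_periodic_cocycle g \<gamma> "\<lambda>x. Im (\<gamma> x)" C
      by (rule cocycle(2)[OF C])
    define \<phi> where "\<phi> x = complex_of_real (re.transfer x) + \<i> * complex_of_real (im.transfer x)" for x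
    have ap: "(\<lambda>x. complex_of_real (re.transfer x)) \<in> almost_periodic"
      "(\<lambda>x. complex_of_real (im.transfer x)) \<in> almost_periodic"
      by (rule re.transfer_almost_periodic[OF dense], assumption,
          rule im.transfer_almost_periodic[OF dense], assumption)
    have "\<phi> \<in> almost_periodic"
    proof (rule almost_periodicI)
      show "continuous_on UNIV \<phi>"
        unfolding \<phi>_def
        by (intro continuous_on_add continuous_on_mult continuous_on_const
            ap[THEN almost_periodic_imp_continuous])
      show "precompact_translates \<phi>"
        unfolding \<phi>_def[abs_def]
        by (intro precompact_translates_add precompact_translates_cmult
            almost_periodic_precompact_translates ap)
    qed
    moreover have "\<phi> (g + x) - \<phi> x = \<gamma> x" for x
      using re.transfer_equation[of x] im.transfer_equation[of x]
      by (simp add: \<phi>_def complex_eq_iff)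
    ultimately show ?thesis
      unfolding solves_cohomological_equation_def by blast
  qed
  have real_case: "(\<lambda>x. complex_of_real (SUP n. - Re (orbit_sum g \<gamma> n x))) \<in> almost_periodic \<and>
      solves_cohomological_equation g \<gamma> (\<lambda>x. complex_of_real (SUP n. - Re (orbit_sum g \<gamma> n x)))"
    if bounded: "uniformly_bounded_orbit_sums g \<gamma>" and real: "\<forall>x. \<gamma> x \<in> \<real>"
  proof -
    obtain C where C: "\<And>n x. cmod (orbit_sum g \<gamma> n x) \<le> C"
      using bounded unfolding uniformly_bounded_orbit_sums_def by blast
    interpret re: bounded_almost_periodic_cocycle g \<gamma> "\<lambda>x. Re (\<gamma> x)" C
      by (rule cocycle(1)[OF C])
    have sup: "(SUP n. - Re (orbit_sum g \<gamma> n x)) = re.transfer x" for x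
      unfolding re.transfer_def orbit_sum_eq partial_sum_def Re_sum ..
    have "complex_of_real (re.transfer (g + x)) - complex_of_real (re.transfer x) = \<gamma> x" for x
      using re.transfer_equation[of x] real by (simp add: complex_eq_iff complex_is_Real_iff)
    then show ?thesis
      unfolding sup solves_cohomological_equation_def
      using re.transfer_almost_periodic[OF dense] by blast
  qed
  show ?thesis
    using exists real_case solution_imp_bounded_orbit_sums by blast
qed

end
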